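(* Let $\mathbb{F}$ be an algebraically closed field of characteristic zero and let $\Gamma_2$ be the fine grading, with universal group $G_2=\mathbb{Z}_2\times\mathbb{Z}_2^3\times\mathbb{Z}$, on the Lie algebra $\mathfrak{g}(S_8,S_2)$ of type $E_6$ described in the context. Identify the Weyl group $\mathcal{W}(\Gamma_2)$ with a subgroup of $\mathrm{Aut}(G_2)$, and elements of $\mathrm{Aut}(G_2)$ with their matrices (by columns, in $1+3+1$ blocks) relative to the canonical basis of $G_2$. Then $\mathcal{W}(\Gamma_2)$ coincides with $$\left\{\begin{pmatrix}\bar1&0&b\\0&A&D\\0&0&c\end{pmatrix}\;\middle|\; b\in\{\bar0,\bar1\},\ c\in\{\pm1\},\ A\in\mathrm{GL}_3(\mathbb{Z}_2),\ D\in\mathrm{Mat}_{3\times1}(\mathbb{Z}_2)\right\}.$$ Thus $\mathcal{W}(\Gamma_2)\cong\mathbb{Z}_2^4\rtimes(\mathrm{GL}_3(\mathbb{Z}_2)\times\mathbb{Z}_2)$.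
   Context: **Gradings.** For an abelian group $G$, a $G$-grading on an algebra $A$ is a decomposition $\Gamma: A=\bigoplus_{g\in G}A_g$ with $A_gA_h\subseteq A_{g+h}$; $\mathrm{Supp}\,\Gamma=\{g:A_g\ne0\}$. It is fine if it has no proper refinement (a decomposition graded by some abelian group whose components are contained in components of $\Gamma$, some properly). The universal group of $\Gamma$ is the abelian group $G$ realizing $\Gamma$ such that for any other realization over a group $H$ there is a unique homomorphism $G\to H$ restricting to the identity on the support. $\mathrm{Aut}(\Gamma)$ is the group of algebra automorphisms permuting the components, $\mathrm{Stab}(\Gamma)$ the subgroup fixing every component, and $\mathcal{W}(\Gamma)=\mathrm{Aut}(\Gamma)/\mathrm{Stab}(\Gamma)$. Each $f\in\mathrm{Aut}(\Gamma)$ induces $\alpha_f\in\mathrm{Aut}(G)$ ($G$ universal) with $f(A_s)=A_{\alpha_f(s)}$ for $s\in\mathrm{Supp}\,\Gamma$, which identifies $\mathcal{W}(\Gamma)$ with a subgroup of $\mathrm{Aut}(G)$. For $G=\mathbb{Z}_p^m\times\mathbb{Z}^n$, the matrix of $\alpha\in\mathrm{Aut}(G)$ has as $j$-th column the coordinates of the image of the $j$-th canonical basis element; its first $m$ rows have entries in $\mathbb{Z}_p$ and the last $n$ rows in $\mathbb{Z}$. **Algebras.** $\mathcal{C}$ is the split octonion algebra over $\mathbb{F}$ with multiplicative norm $q$, polar form $q(x,y)=q(x+y)-q(x)-q(y)$, and involution $\bar x=q(x,1)1-x$. $S_8$ is $\mathcal{C}$ with the new product $x*y=\bar x\bar y$;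 $S_2$ is $\mathbb{F}\oplus\mathbb{F}$ (norm $q(a,b)=ab$, involution the swap) with the new product $x*y=\bar x\bar y$. For $S=S_8,S_2$: $\mathfrak{tri}(S)=\{(d_0,d_1,d_2)\in\mathfrak{o}(S,q)^3: d_0(x*y)=d_1(x)*y+x*d_2(y)\ \forall x,y\}$, $\vartheta(d_0,d_1,d_2)=(d_2,d_0,d_1)$, $t_{x,y}=(\sigma_{x,y},\frac12q(x,y)\mathrm{id}-r_xl_y,\frac12q(x,y)\mathrm{id}-l_xr_y)\in\mathfrak{tri}(S)$, where $\sigma_{x,y}(z)=q(x,z)y-q(y,z)x$, $l_x(z)=x*z$, $r_x(z)=z*x$. $\mathfrak{g}(S_8,S_2)=\mathfrak{tri}(S_8)\oplus\mathfrak{tri}(S_2)\oplus\bigoplus_{i=0}^2\iota_i(S_8\otimes S_2)$, with each $\iota_i(S_8\otimes S_2)$ a copy of $S_8\otimes S_2$; $\mathfrak{tri}(S_8)\oplus\mathfrak{tri}(S_2)$ is a subalgebra, $[(d_0,d_1,d_2),\iota_i(x\otimes x')]=\iota_i(d_i(x)\otimes x')$, $[(d_0',d_1',d_2'),\iota_i(x\otimes x')]=\iota_i(x\otimes d_i'(x'))$, $[\iota_i(x\otimes x'),\iota_{i+1}(y\otimes y')]=\iota_{i+2}((x*y)\otimes(x'*y'))$, $[\iota_i(x\otimes x'),\iota_i(y\otimes y')]=q(x',y')\vartheta^i(t_{x,y})+q(x,y)\vartheta^i(t_{x',y'})$ (indices mod 3). It is a Lie algebra of type $E_6$. Automorphisms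 $f$ of $S_8$ and $f'$ of $S_2$ extend to the automorphism $(f,f')$ acting by conjugation (componentwise) on $\mathfrak{tri}(S_8)$, $\mathfrak{tri}(S_2)$ and by $\iota_i(x\otimes x')\mapsto\iota_i(f(x)\otimes f'(x'))$. **The grading $\Gamma_2$.** Take trace zero mutually orthogonal $w_1,w_2,w_3\in\mathcal{C}$ with $w_i^2=1$ and $w_3$ orthogonal to $w_1w_2$ (products in $\mathcal{C}$), and let $F_i$ be the extension to $\mathfrak{g}(S_8,S_2)$ of the automorphism of $\mathcal{C}$ (hence of $S_8$) with $w_i\mapsto-w_i$, $w_j\mapsto w_j$ for $j\ne i$. Let $\varrho=(\mathrm{id},\text{swap})$. Fix $\mathbf{i}\in\mathbb{F}$ with $\mathbf{i}^2=-1$. A homogeneous element of degree $(\bar k;\bar k_1,\bar k_2,\bar k_3;n)\in\mathbb{Z}_2\times\mathbb{Z}_2^3\times\mathbb{Z}$ is one on which $\varrho$ acts as $(-1)^k$, $F_i$ acts as $(-1)^{k_i}$, and $\mathrm{ad}(\iota_0(1\otimes1))$ acts as $n\mathbf{i}$; here $n\in\{0,\pm1,\pm2\}$. *)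

theory Defs
  imports
    "HOL-Analysis.Cartesian_Space"
    "HOL-Library.Function_Algebras"
    "HOL-Library.Numeral_Type"
    "HOL-Computational_Algebra.Polynomial"
    "HOL-Algebra.Bij"
    "HOL-Algebra.Coset"
begin

section \<open>Gradings on algebras and their Weyl groups\<close>

definition additive_group :: "'g::ab_group_add monoid" where
  "additive_group = \<lparr>carrier = UNIV, mult = (+), one = 0\<rparr>"

text \<open>A (not necessarily associative) algebra whose underlying vector space is a subspace \<open>V\<close>
  of an ambient type.\<close>

locale algebra_on =
  fixes V :: "'v::ab_group_add set"
    and scale :: "'a::field \<Rightarrow> 'v \<Rightarrow> 'v"
    and mul :: "'v \<Rightarrow> 'v \<Rightarrow> 'v"
begin

definition automorphisms :: "('v \<Rightarrow> 'v) set" where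
  "automorphisms = {f \<in> Bij V.
     (\<forall>x\<in>V. \<forall>y\<in>V. f (x + y) = f x + f y) \<and>
     (\<forall>c. \<forall>x\<in>V. f (scale c x) = scale c (f x)) \<and>
     (\<forall>x\<in>V. \<forall>y\<in>V. f (mul x y) = mul (f x) (f y))}"

definition is_grading :: "'g monoid \<Rightarrow> ('g \<Rightarrow> 'v set) \<Rightarrow> bool" where
  "is_grading G \<Gamma> \<longleftrightarrow> comm_group G \<and>
     (\<forall>g\<in>carrier G. module.subspace scale (\<Gamma> g) \<and> \<Gamma> g \<subseteq> V) \<and>
     (\<forall>x\<in>V. \<exists>!c. (\<forall>g\<in>carrier G. c g \<in> \<Gamma> g) \<and> (\<forall>g. g \<notin> carrier G \<longrightarrow> c g = 0) \<and>
        finite {g. c g \<noteq> 0} \<and> x = (\<Sum>g | c g \<noteq> 0. c g)) \<and>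
     (\<forall>g\<in>carrier G. \<forall>h\<in>carrier G. \<forall>x\<in>\<Gamma> g. \<forall>y\<in>\<Gamma> h. mul x y \<in> \<Gamma> (g \<otimes>\<^bsub>G\<^esub> h))"

definition Supp :: "'g monoid \<Rightarrow> ('g \<Rightarrow> 'v set) \<Rightarrow> 'g set" where
  "Supp G \<Gamma> = {g \<in> carrier G. \<Gamma> g \<noteq> {0}}"

definition components :: "'g monoid \<Rightarrow> ('g \<Rightarrow> 'v set) \<Rightarrow> 'v set set" where
  "components G \<Gamma> = \<Gamma> ` Supp G \<Gamma>"

text \<open>A realization of \<open>\<Gamma>\<close> over \<open>H\<close> is an \<open>H\<close>-grading \<open>\<Delta>\<close> with the same nonzero components.
  A homomorphism \<open>\<phi>\<close> ``restricts to the identity on the support'' when it sends the label of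
  each component in \<open>\<Gamma>\<close> to its label in \<open>\<Delta>\<close>. The type argument is the type of the elements
  of the groups \<open>H\<close>.\<close>

definition universal_group ::
    "'h itself \<Rightarrow> 'g monoid \<Rightarrow> ('g \<Rightarrow> 'v set) \<Rightarrow> bool" where
  "universal_group _ G \<Gamma> \<longleftrightarrow> is_grading G \<Gamma> \<and>
     (\<forall>(H :: 'h monoid) \<Delta>. is_grading H \<Delta> \<and> components H \<Delta> = components G \<Gamma> \<longrightarrow>
        (\<exists>!\<phi>. \<phi> \<in> hom G H \<and> \<phi> \<in> extensional (carrier G) \<and>
              (\<forall>s\<in>Supp G \<Gamma>. \<Delta> (\<phi> s) = \<Gamma> s)))"

definition Aut_grading :: "'g monoid \<Rightarrow> ('g \<Rightarrow> 'v set) \<Rightarrow> ('v \<Rightarrow> 'v) set" where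
  "Aut_grading G \<Gamma> = {f \<in> automorphisms. (`) f ` components G \<Gamma> = components G \<Gamma>}"

definition Stab_grading :: "'g monoid \<Rightarrow> ('g \<Rightarrow> 'v set) \<Rightarrow> ('v \<Rightarrow> 'v) set" where
  "Stab_grading G \<Gamma> = {f \<in> automorphisms. \<forall>A\<in>components G \<Gamma>. f ` A = A}"

definition Weyl_group :: "'g monoid \<Rightarrow> ('g \<Rightarrow> 'v set) \<Rightarrow> ('v \<Rightarrow> 'v) set monoid" where
  "Weyl_group G \<Gamma> = (BijGroup V)\<lparr>carrier := Aut_grading G \<Gamma>\<rparr> Mod Stab_grading G \<Gamma>"

definition induced_auto :: "'g monoid \<Rightarrow> ('g \<Rightarrow> 'v set) \<Rightarrow> ('v \<Rightarrow> 'v) \<Rightarrow> 'g \<Rightarrow> 'g" where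
  "induced_auto G \<Gamma> f = (THE \<alpha>. \<alpha> \<in> auto G \<and> (\<forall>s\<in>Supp G \<Gamma>. f ` \<Gamma> s = \<Gamma> (\<alpha> s)))"

definition Weyl_subgroup :: "'g monoid \<Rightarrow> ('g \<Rightarrow> 'v set) \<Rightarrow> ('g \<Rightarrow> 'g) set" where
  "Weyl_subgroup G \<Gamma> = induced_auto G \<Gamma> ` Aut_grading G \<Gamma>"

end

section \<open>Triality Lie algebras\<close>

definition polar :: "('b::ab_group_add \<Rightarrow> 'a::ab_group_add) \<Rightarrow> 'b \<Rightarrow> 'b \<Rightarrow> 'a" where
  "polar q x y = q (x + y) - q x - q y"

text \<open>Here \<open>s\<close> is the scalar multiplication, \<open>q\<close> the norm and \<open>m\<close> the product \<open>*\<close>. Triples are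
  functions on the numeral type \<open>3\<close>, whose arithmetic is modulo 3.\<close>

definition orth_Lie ::
    "('a::field \<Rightarrow> 'b::ab_group_add \<Rightarrow> 'b) \<Rightarrow> ('b \<Rightarrow> 'a) \<Rightarrow> ('b \<Rightarrow> 'b) set" where
  "orth_Lie s q = {d. Vector_Spaces.linear s s d \<and>
     (\<forall>x y. polar q (d x) y + polar q x (d y) = 0)}"

definition tri ::
    "('a::field \<Rightarrow> 'b::ab_group_add \<Rightarrow> 'b) \<Rightarrow> ('b \<Rightarrow> 'a) \<Rightarrow> ('b \<Rightarrow> 'b \<Rightarrow> 'b) \<Rightarrow> (3 \<Rightarrow> 'b \<Rightarrow> 'b) set"
  where
  "tri s q m = {d. (\<forall>i. d i \<in> orth_Lie s q) \<and>
     (\<forall>x y. d 0 (m x y) = m (d 1 x) y + m x (d 2 y))}"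

definition tri_scale ::
    "('a \<Rightarrow> 'b \<Rightarrow> 'b) \<Rightarrow> 'a \<Rightarrow> (3 \<Rightarrow> 'b \<Rightarrow> 'b) \<Rightarrow> 3 \<Rightarrow> 'b \<Rightarrow> 'b" where
  "tri_scale s c d = (\<lambda>i z. s c (d i z))"

definition tri_bracket ::
    "(3 \<Rightarrow> 'b \<Rightarrow> 'b) \<Rightarrow> (3 \<Rightarrow> 'b \<Rightarrow> 'b) \<Rightarrow> 3 \<Rightarrow> 'b \<Rightarrow> 'b::ab_group_add" where
  "tri_bracket d e = (\<lambda>i z. d i (e i z) - e i (d i z))"

text \<open>\<open>theta_pow i\<close> is \<open>\<vartheta>\<^sup>i\<close>; in particular
  \<open>theta_pow 1 (d\<^sub>0, d\<^sub>1, d\<^sub>2) = (d\<^sub>2, d\<^sub>0, d\<^sub>1)\<close>.\<close>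

definition theta_pow :: "3 \<Rightarrow> (3 \<Rightarrow> 'c) \<Rightarrow> 3 \<Rightarrow> 'c" where
  "theta_pow i d = (\<lambda>j. d (j - i))"

definition tri_t ::
    "('a::field \<Rightarrow> 'b::ab_group_add \<Rightarrow> 'b) \<Rightarrow> ('b \<Rightarrow> 'a) \<Rightarrow> ('b \<Rightarrow> 'b \<Rightarrow> 'b) \<Rightarrow>
     'b \<Rightarrow> 'b \<Rightarrow> 3 \<Rightarrow> 'b \<Rightarrow> 'b" where
  "tri_t s q m x y = (\<lambda>i z.
     if i = 0 then s (polar q x z) y - s (polar q y z) x
     else if i = 1 then s (polar q x y / 2) z - m (m y z) x
     else s (polar q x y / 2) z - m x (m z y))"

section \<open>The algebras \<open>S\<^sub>8\<close> and \<open>S\<^sub>2\<close>\<close>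

text \<open>The split octonion algebra is Zorn's algebra of vector matrices: \<open>(a, u, v, b)\<close> stands for
  the matrix with rows \<open>(a, u)\<close> and \<open>(v, b)\<close>.\<close>

type_synonym 'a oct = "'a \<times> ('a ^ 3) \<times> ('a ^ 3) \<times> 'a"

definition dot :: "'a::field ^ 3 \<Rightarrow> 'a ^ 3 \<Rightarrow> 'a" where
  "dot u v = (\<Sum>i\<in>UNIV. u $ i * v $ i)"

definition cross :: "'a::field ^ 3 \<Rightarrow> 'a ^ 3 \<Rightarrow> 'a ^ 3" where
  "cross u v = vector [u $ 2 * v $ 3 - u $ 3 * v $ 2,
                       u $ 3 * v $ 1 - u $ 1 * v $ 3,
                       u $ 1 * v $ 2 - u $ 2 * v $ 1]"

definition oct_scale :: "'a::field \<Rightarrow> 'a oct \<Rightarrow> 'a oct" where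
  "oct_scale c = (\<lambda>(a, u, v, b). (c * a, c *s u, c *s v, c * b))"

definition oct_one :: "'a::field oct" where
  "oct_one = (1, 0, 0, 1)"

definition oct_mult :: "'a::field oct \<Rightarrow> 'a oct \<Rightarrow> 'a oct" where
  "oct_mult = (\<lambda>(a, u, v, b) (a', u', v', b').
     (a * a' + dot u v',
      a *s u' + b' *s u - cross v v',
      a' *s v + b *s v' + cross u u',
      b * b' + dot v u'))"

definition oct_norm :: "'a::field oct \<Rightarrow> 'a" where
  "oct_norm = (\<lambda>(a, u, v, b). a * b - dot u v)"

definition oct_conj :: "'a::field oct \<Rightarrow> 'a oct" where
  "oct_conj x = oct_scale (polar oct_norm x oct_one) oct_one - x"

definition S8_mult :: "'a::field oct \<Rightarrow> 'a oct \<Rightarrow> 'a oct" where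
  "S8_mult x y = oct_mult (oct_conj x) (oct_conj y)"

type_synonym 'a s2 = "'a \<times> 'a"

definition s2_scale :: "'a::field \<Rightarrow> 'a s2 \<Rightarrow> 'a s2" where
  "s2_scale c = (\<lambda>(a, b). (c * a, c * b))"

definition s2_norm :: "'a::field s2 \<Rightarrow> 'a" where
  "s2_norm = (\<lambda>(a, b). a * b)"

definition s2_swap :: "'a s2 \<Rightarrow> 'a s2" where
  "s2_swap = (\<lambda>(a, b). (b, a))"

definition S2_mult :: "'a::field s2 \<Rightarrow> 'a s2 \<Rightarrow> 'a s2" where
  "S2_mult x y = (fst (s2_swap x) * fst (s2_swap y), snd (s2_swap x) * snd (s2_swap y))"

section \<open>The Lie algebra \<open>\<gg>(S\<^sub>8, S\<^sub>2)\<close>\<close>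

text \<open>The pair \<open>(v, w)\<close> of octonions is the tensor \<open>v \<otimes> (1, 0) + w \<otimes> (0, 1)\<close> of
  \<open>S\<^sub>8 \<otimes> S\<^sub>2\<close>.\<close>

type_synonym 'a tens = "'a oct \<times> 'a oct"

definition tensor :: "'a::field oct \<Rightarrow> 'a s2 \<Rightarrow> 'a tens" where
  "tensor x x' = (oct_scale (fst x') x, oct_scale (snd x') x)"

definition tens_map ::
    "('a::field oct \<Rightarrow> 'a oct) \<Rightarrow> ('a s2 \<Rightarrow> 'a s2) \<Rightarrow> 'a tens \<Rightarrow> 'a tens" where
  "tens_map f f' v = tensor (f (fst v)) (f' (1, 0)) + tensor (f (snd v)) (f' (0, 1))"

text \<open>For \<open>B x x' y y'\<close> linear in each argument, \<open>tens_lift B\<close> is the bilinear map with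
  \<open>tens_lift B (x \<otimes> x') (y \<otimes> y') = B x x' y y'\<close>.\<close>

definition tens_lift ::
    "('a::field oct \<Rightarrow> 'a s2 \<Rightarrow> 'a oct \<Rightarrow> 'a s2 \<Rightarrow> 'c::ab_group_add) \<Rightarrow>
     'a tens \<Rightarrow> 'a tens \<Rightarrow> 'c" where
  "tens_lift B v w =
     B (fst v) (1, 0) (fst w) (1, 0) + B (fst v) (1, 0) (snd w) (0, 1) +
     B (snd v) (0, 1) (fst w) (1, 0) + B (snd v) (0, 1) (snd w) (0, 1)"

definition tens_mult :: "'a::field tens \<Rightarrow> 'a tens \<Rightarrow> 'a tens" where
  "tens_mult = tens_lift (\<lambda>x x' y y'. tensor (S8_mult x y) (S2_mult x' y'))"

text \<open>\<open>(d, d', v)\<close> stands for \<open>d + d' + \<iota>\<^sub>0(v 0) + \<iota>\<^sub>1(v 1) + \<iota>\<^sub>2(v 2)\<close>.\<close>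

type_synonym 'a g_elem =
  "(3 \<Rightarrow> 'a oct \<Rightarrow> 'a oct) \<times> (3 \<Rightarrow> 'a s2 \<Rightarrow> 'a s2) \<times> (3 \<Rightarrow> 'a tens)"

definition g_carrier :: "'a::field g_elem set" where
  "g_carrier = tri oct_scale oct_norm S8_mult \<times> tri s2_scale s2_norm S2_mult \<times> UNIV"

definition g_scale :: "'a::field \<Rightarrow> 'a g_elem \<Rightarrow> 'a g_elem" where
  "g_scale c = (\<lambda>(d, d', v). (tri_scale oct_scale c d, tri_scale s2_scale c d',
     \<lambda>i. (oct_scale c (fst (v i)), oct_scale c (snd (v i)))))"

definition iota :: "3 \<Rightarrow> 'a::field tens \<Rightarrow> 'a g_elem" where
  "iota i v = (0, 0, \<lambda>j. if j = i then v else 0)"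

text \<open>Since \<open>[\<iota>\<^sub>j(v), \<iota>\<^bsub>j+1\<^esub>(w)]\<close> lies in \<open>\<iota>\<^bsub>j+2\<^esub>\<close>, the \<open>\<iota>\<^sub>i\<close>-component of a bracket
  collects the pairs with \<open>j = i + 1\<close>.\<close>

definition g_bracket :: "'a::field g_elem \<Rightarrow> 'a g_elem \<Rightarrow> 'a g_elem" where
  "g_bracket = (\<lambda>(d, d', v) (e, e', w).
     (tri_bracket d e +
        (\<Sum>i\<in>UNIV. tens_lift (\<lambda>x x' y y'. tri_scale oct_scale (polar s2_norm x' y')
            (theta_pow i (tri_t oct_scale oct_norm S8_mult x y))) (v i) (w i)),
      tri_bracket d' e' +
        (\<Sum>i\<in>UNIV. tens_lift (\<lambda>x x' y y'. tri_scale s2_scale (polar oct_norm x y)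
            (theta_pow i (tri_t s2_scale s2_norm S2_mult x' y'))) (v i) (w i)),
      \<lambda>i. tens_map (d i) id (w i) + tens_map id (d' i) (w i)
          - tens_map (e i) id (v i) - tens_map id (e' i) (v i)
          + tens_mult (v (i + 1)) (w (i + 2)) - tens_mult (w (i + 1)) (v (i + 2))))"

definition g_ext ::
    "('a::field oct \<Rightarrow> 'a oct) \<Rightarrow> ('a s2 \<Rightarrow> 'a s2) \<Rightarrow> 'a g_elem \<Rightarrow> 'a g_elem" where
  "g_ext f f' = (\<lambda>(d, d', v).
     (\<lambda>i. f \<circ> d i \<circ> inv_into UNIV f, \<lambda>i. f' \<circ> d' i \<circ> inv_into UNIV f',
      \<lambda>i. tens_map f f' (v i)))"

section \<open>The grading \<open>\<Gamma>\<^sub>2\<close>\<close>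

text \<open>The vectors \<open>w\<^sub>1, w\<^sub>2, w\<^sub>3\<close> are the values of a function on the numeral type \<open>3\<close>, in which
  \<open>3 = 0\<close>.\<close>

definition oct_sign :: "(3 \<Rightarrow> 'a::field oct) \<Rightarrow> 3 \<Rightarrow> 'a oct \<Rightarrow> 'a oct" where
  "oct_sign w i = (THE f. f \<in> algebra_on.automorphisms UNIV oct_scale oct_mult \<and>
     (\<forall>j. f (w j) = (if j = i then - w j else w j)))"

type_synonym G2 = "2 \<times> (2 ^ 3) \<times> int"

definition Gamma2 :: "(3 \<Rightarrow> 'a::field oct) \<Rightarrow> 'a \<Rightarrow> G2 \<Rightarrow> 'a g_elem set" where
  "Gamma2 w im = (\<lambda>(k, ks, n). {z \<in> g_carrier.
     g_ext id s2_swap z = g_scale (if k = 0 then 1 else - 1) z \<and>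
     (\<forall>i. g_ext (oct_sign w i) id z = g_scale (if ks $ i = 0 then 1 else - 1) z) \<and>
     g_bracket (iota 0 (tensor oct_one (1, 1))) z = g_scale (of_int n * im) z})"

text \<open>The matrix of an endomorphism of \<open>\<int>\<^sub>2 \<times> \<int>\<^sub>2\<^sup>3 \<times> \<int>\<close>, as a \<open>3 \<times> 3\<close> array of blocks. The columns
  are the images of the canonical basis, whose elements are \<open>(1, 0, 0)\<close>, \<open>(0, axis j 1, 0)\<close> and
  \<open>(0, 0, 1)\<close>.\<close>

type_synonym G2_matrix =
  "(2 \<times> (2 ^ 3) \<times> 2) \<times> ((2 ^ 3) \<times> (2 ^ 3 ^ 3) \<times> (2 ^ 3)) \<times> (int \<times> (int ^ 3) \<times> int)"

definition matrix_of :: "(G2 \<Rightarrow> G2) \<Rightarrow> G2_matrix" where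
  "matrix_of \<alpha> =
     (let p1 = fst; p2 = fst \<circ> snd; p3 = snd \<circ> snd;
          x = \<alpha> (1, 0, 0); y = (\<lambda>j. \<alpha> (0, axis j 1, 0)); z = \<alpha> (0, 0, 1)
      in ((p1 x, (\<chi> j. p1 (y j)),        p1 z),
          (p2 x, (\<chi> i j. p2 (y j) $ i),  p2 z),
          (p3 x, (\<chi> j. p3 (y j)),        p3 z)))"

section \<open>The group \<open>\<int>\<^sub>2\<^sup>4 \<rtimes> (GL\<^sub>3(\<int>\<^sub>2) \<times> \<int>\<^sub>2)\<close>\<close>

definition semidirect ::
    "'n monoid \<Rightarrow> 'h monoid \<Rightarrow> ('h \<Rightarrow> 'n \<Rightarrow> 'n) \<Rightarrow> ('n \<times> 'h) monoid" where
  "semidirect N H act =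
     \<lparr>carrier = carrier N \<times> carrier H,
      mult = (\<lambda>(n, h) (n', h'). (n \<otimes>\<^bsub>N\<^esub> act h n', h \<otimes>\<^bsub>H\<^esub> h')),
      one = (\<one>\<^bsub>N\<^esub>, \<one>\<^bsub>H\<^esub>)\<rparr>"

definition GL3_Z2 :: "(2 ^ 3 ^ 3) monoid" where
  "GL3_Z2 = \<lparr>carrier = {A. invertible A}, mult = (**), one = mat 1\<rparr>"

text \<open>Conjugation by a block diagonal matrix \<open>diag(1, A, c)\<close> sends the matrix with
  last column \<open>(b, D, 1)\<close> to the one with last column \<open>(b, A D, 1)\<close>, as \<open>c = \<plusminus>1\<close> is trivial
  modulo 2. Here \<open>\<int>\<^sub>2\<^sup>4\<close> is written as \<open>\<int>\<^sub>2 \<times> \<int>\<^sub>2\<^sup>3\<close>.\<close>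

definition Weyl_model :: "((2 \<times> (2 ^ 3)) \<times> (2 ^ 3 ^ 3) \<times> 2) monoid" where
  "Weyl_model = semidirect additive_group (GL3_Z2 \<times>\<times> additive_group)
     (\<lambda>(A, c) (b, D). (b, A *v D))"

end

(*
The algebra is graded by the joint eigenspaces of the four commuting involutions and of the
derivation D = ad(iota_0(1 (x) 1)), which satisfies D^2 = -1 on iota_1 + iota_2 and D^3 = -4 D on
the rest.  All brackets between components of level 1 and level -1 are nonzero, and each component
of level 2 or -2 contains a nonzero bracket of two components of level 1 or -1; the resulting
relations between labels give the universal property, and with it the homomorphism of G_2 induced
by an element of Aut(Gamma_2).

Upper bound: the levels 2 and -2 occur exactly in the degrees (1,0) and (0,u) with u nonzero, a
set of which (1,0) is an intrinsic element, so that the matrix has the given shape.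

Lower bound: pairs of related triples of isometries of S_8 and S_2 act as automorphisms.  The
matrix A comes from the octonion automorphism moving the basis elements X_v to X_{Av} up to sign
(the multiplication table of an octonion frame is universal), c = -1 from signs on S_2, b = 1 from
the triple (id, diag(i,-i), diag(-i,i)) of S_2, and D = v from the triple of S_8 with components
-c z c, -z c, -c z up to sign, where c = X_v.
*)
theory Submission
  imports Defs
begin

section \<open>Symmetric composition algebras and triality\<close>

text \<open>The last column of the matrices comes from parity: the involution that is 1 on both
  triality algebras and on \<open>iota 0\<close>, and -1 on \<open>iota 1\<close> and
  \<open>iota 2\<close>, acts on each component as (-1)^level. A pair of related triples that
  commutes with one of the four involutions only up to this parity adds the level modulo 2 to the
  corresponding Z_2 coordinate; the triples for b and D are built to do exactly this. The level
  itself is kept or reversed according to the image of 1 (x) 1 in \<open>iota 0\<close>. The w_i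
  square to 1, whereas the standard octonion table has units of square -1, so they are multiplied by
  the square root of -1; the sign automorphisms do not notice. The signs of the table are shown to
  be independent of the frame, and this is what makes any two frames conjugate under an
  automorphism. The group \<open>Weyl_model\<close> is handled through its faithful action on
  \<open>G2\<close>, from which its group laws and the matrices are read off.\<close>

lemma UNIV_3_eq: "(UNIV :: 3 set) = {0, 1, 2}"
  using UNIV_3 by auto

lemma cases_3: "(i :: 3) = 0 \<or> i = 1 \<or> i = 2"
  using UNIV_3_eq by blast

lemma arith_3 [simp]: "(1::3) + 1 = 2" "(1::3) + 2 = 0" "(2::3) + 1 = 0" "(2::3) + 2 = 1"
  "- (1::3) = 2" "- (2::3) = 1" "(1::3) - 2 = 2" "(0::3) - 1 = 2" "(0::3) - 2 = 1" "(2::3) - 1 = 1"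
  "(3::3) = 0" "(4::3) = 1"
  by simp_all

lemma sum_UNIV_3: "(\<Sum>i\<in>(UNIV :: 3 set). f i) = f 0 + f 1 + (f 2 :: 'b::ab_group_add)"
  unfolding UNIV_3_eq by (simp add: add.assoc)

lemma polar_commute: "polar q x y = polar q y x"
  by (simp add: polar_def algebra_simps)

text \<open>The axioms are polarised: \<open>comp_left\<close> and \<open>comp_right\<close>
  linearise (x*y)*x = q(x) y = x*(y*x), and \<open>polar_assoc\<close> makes the form associative.
  Both S_8 and S_2 satisfy them, so triality is treated once for the two factors.\<close>

locale sym_comp = vector_space s
  for s :: "'a::field_char_0 \<Rightarrow> 'b::ab_group_add \<Rightarrow> 'b" +
  fixes q :: "'b \<Rightarrow> 'a" and m :: "'b \<Rightarrow> 'b \<Rightarrow> 'b" (infixl \<open>\<star>\<close> 70)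
  assumes polar_add: "polar q (x + y) z = polar q x z + polar q y z"
    and polar_scale: "polar q (s c x) z = c * polar q x z"
    and m_add_left: "(x + y) \<star> z = x \<star> z + y \<star> z"
    and m_add_right: "z \<star> (x + y) = z \<star> x + z \<star> y"
    and m_scale_left: "s c x \<star> z = s c (x \<star> z)"
    and m_scale_right: "z \<star> s c x = s c (z \<star> x)"
    and comp_left: "x \<star> y \<star> z + z \<star> y \<star> x = s (polar q x z) y"
    and comp_right: "x \<star> (y \<star> z) + z \<star> (y \<star> x) = s (polar q x z) y"
    and polar_assoc: "polar q (x \<star> y) z = polar q x (y \<star> z)"
    and nondegenerate: "(\<And>y. polar q x y = 0) \<Longrightarrow> x = 0"
begin

abbreviation B where "B \<equiv> polar q"

lemma B_linear:
  "B (x + y) z = B x z + B y z" "B z (x + y) = B z x + B z y"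
  "B (x - y) z = B x z - B y z" "B z (x - y) = B z x - B z y"
  "B (- x) z = - B x z" "B z (- x) = - B z x" "B 0 z = 0" "B z 0 = 0"
  "B (s c x) z = c * B x z" "B z (s c x) = c * B z x"
proof -
  have scale: "B (s c x) z = c * B x z" for c x z by (rule polar_scale)
  have minus: "B (- x) z = - B x z" for x z using scale[of "-1" x z] by simp
  have diff: "B (x - y) z = B x z - B y z" for x y z
    using polar_add[of x "- y" z] minus[of y z] by simp
  have zero: "B 0 z = 0" for z using scale[of 0 0 z] by simp
  show "B (x + y) z = B x z + B y z" "B z (x + y) = B z x + B z y"
    "B (x - y) z = B x z - B y z" "B z (x - y) = B z x - B z y"
    "B (- x) z = - B x z" "B z (- x) = - B z x" "B 0 z = 0" "B z 0 = 0"
    "B (s c x) z = c * B x z" "B z (s c x) = c * B z x"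
    using polar_add scale minus diff zero by (simp_all add: polar_commute[of q z])
qed

lemma B_eqI: "(\<And>z. B x z = B y z) \<Longrightarrow> x = y"
  using nondegenerate[of "x - y"] by (simp add: B_linear)

lemma m_linear:
  "(x + y) \<star> z = x \<star> z + y \<star> z" "z \<star> (x + y) = z \<star> x + z \<star> y"
  "(x - y) \<star> z = x \<star> z - y \<star> z" "z \<star> (x - y) = z \<star> x - z \<star> y"
  "(- x) \<star> z = - (x \<star> z)" "z \<star> (- x) = - (z \<star> x)" "0 \<star> z = 0" "z \<star> 0 = 0"
  "s c x \<star> z = s c (x \<star> z)" "z \<star> s c x = s c (z \<star> x)"
proof -
  have minus: "(- x) \<star> z = - (x \<star> z)" "z \<star> (- x) = - (z \<star> x)" for x z
    using m_scale_left[of "-1" x z] m_scale_right[of z "-1" x] by simp_all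
  show "(x + y) \<star> z = x \<star> z + y \<star> z" "z \<star> (x + y) = z \<star> x + z \<star> y"
    "(x - y) \<star> z = x \<star> z - y \<star> z" "z \<star> (x - y) = z \<star> x - z \<star> y"
    "(- x) \<star> z = - (x \<star> z)" "z \<star> (- x) = - (z \<star> x)" "0 \<star> z = 0" "z \<star> 0 = 0"
    "s c x \<star> z = s c (x \<star> z)" "z \<star> s c x = s c (z \<star> x)"
    using m_add_left[of x y z] m_add_right[of z x y] m_add_left[of x "- y" z]
      m_add_right[of z x "- y"] minus m_scale_left m_scale_right m_add_left[of 0 0 z]
      m_add_right[of z 0 0]
    by simp_all
qed

lemma scale_half: "s (c / 2) x + s (c / 2) x = s c x"
  by (simp add: scale_left_distrib[symmetric])

lemma comp_left_eq: "x \<star> y \<star> z = s (B x z) y - z \<star> y \<star> x"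
  using comp_left[of x y z] by (simp add: eq_diff_eq)

lemma comp_right_eq: "x \<star> (y \<star> z) = s (B x z) y - z \<star> (y \<star> x)"
  using comp_right[of x y z] by (simp add: eq_diff_eq)

lemma B_rotate: "B (x \<star> y) z = B (y \<star> z) x"
  by (subst polar_assoc) (rule polar_commute)

text \<open>Applying \<open>comp_right\<close> to the outer product and again to the inner one
  produces u*(x*(v*y)) with opposite signs in the two summands, so it cancels. This identity drives
  local triality (\<open>t_tri\<close>, \<open>t_cyclic\<close>) as well as its group version for
  reflections.\<close>

lemma comp_four:
  "v \<star> x \<star> (y \<star> u) + v \<star> y \<star> (x \<star> u) =
     s (B x (u \<star> v)) y + s (B y (u \<star> v)) x - s (B x y) (u \<star> v)"
proof -
  have 1: "v \<star> x \<star> (y \<star> u) = s (B (v \<star> x) u) y - u \<star> (y \<star> (v \<star> x))"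
    by (rule comp_right_eq)
  have 2: "y \<star> (v \<star> x) = s (B y x) v - x \<star> (v \<star> y)"
    by (rule comp_right_eq)
  have 3: "v \<star> y \<star> (x \<star> u) = s (B (v \<star> y) u) x - u \<star> (x \<star> (v \<star> y))"
    by (rule comp_right_eq)
  have "B (v \<star> x) u = B x (u \<star> v)" "B (v \<star> y) u = B y (u \<star> v)"
    by (metis B_rotate polar_commute)+
  then show ?thesis
    unfolding 1 3 unfolding 2 by (simp add: m_linear polar_commute algebra_simps)
qed

lemma orth_LieI:
  assumes "\<And>x y. d (x + y) = d x + d y" "\<And>c x. d (s c x) = s c (d x)"
    "\<And>x y. B (d x) y = - B (d y) x"
  shows "d \<in> orth_Lie s q"
  unfolding orth_Lie_def mem_Collect_eq
proof (intro conjI allI)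
  show "Vector_Spaces.linear s s d"
    by unfold_locales (use assms in auto)
  show "B (d x) y + B x (d y) = 0" for x y
    using assms(3)[of x y] by (simp add: polar_commute)
qed

lemma orth_LieD:
  assumes "d \<in> orth_Lie s q"
  shows "d (x + y) = d x + d y" "d (x - y) = d x - d y" "d (- x) = - d x" "d 0 = 0"
    "d (s c x) = s c (d x)" "B (d x) y = - B x (d y)" "B (d x) y = - B (d y) x"
proof -
  interpret Vector_Spaces.linear s s d using assms by (simp add: orth_Lie_def)
  show "d (x + y) = d x + d y" "d (x - y) = d x - d y" "d (- x) = - d x" "d 0 = 0"
    "d (s c x) = s c (d x)" by (rule add diff neg zero scale)+
  have "B (d x) y + B x (d y) = 0" for x y using assms by (simp add: orth_Lie_def)
  then show "B (d x) y = - B x (d y)" "B (d x) y = - B (d y) x"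
    by (simp_all add: eq_neg_iff_add_eq_0 polar_commute[of q "d y"])
qed

text \<open>The definition of \<open>tri\<close> asks for the Leibniz rule at index 0 only. Pairing
  with z, moving the skew maps across the form and rotating the form by \<open>B_rotate\<close>
  turns it into the rule at index 1; iterating gives the cyclic symmetry of local triality.\<close>

lemma triD:
  assumes "d \<in> tri s q m"
  shows "d i \<in> orth_Lie s q" "d i (x \<star> y) = d (i + 1) x \<star> y + x \<star> d (i + 2) y"
proof -
  show o: "d i \<in> orth_Lie s q" for i using assms by (simp add: tri_def)
  \<comment> \<open>Stated for an arbitrary triple so that it also applies to the shifted triple,
    which yields index 2.\<close>
  have step: "e 1 (x \<star> y) = e 2 x \<star> y + x \<star> e 0 y"
    if e: "\<And>i. e i \<in> orth_Lie s q" "\<And>x y. e 0 (x \<star> y) = e 1 x \<star> y + x \<star> e 2 y"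
    for e :: "3 \<Rightarrow> 'b \<Rightarrow> 'b" and x y
  proof (rule B_eqI)
    fix z
    have "B (e 1 (x \<star> y)) z = - B (x \<star> y) (e 1 z)" by (rule orth_LieD(6)[OF e(1)])
    also have "B (x \<star> y) (e 1 z) = B (e 1 z \<star> x) y" by (metis B_rotate)
    also have "e 1 z \<star> x = e 0 (z \<star> x) - z \<star> e 2 x" using e(2)[of z x] by simp
    also have "- B (e 0 (z \<star> x) - z \<star> e 2 x) y = B (z \<star> x) (e 0 y) + B (z \<star> e 2 x) y"
      by (simp add: B_linear orth_LieD(6)[OF e(1)])
    also have "\<dots> = B (e 2 x \<star> y + x \<star> e 0 y) z" by (simp add: B_linear B_rotate[of z])
    finally show "B (e 1 (x \<star> y)) z = B (e 2 x \<star> y + x \<star> e 0 y) z" .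
  qed
  have 0: "d 0 (x \<star> y) = d 1 x \<star> y + x \<star> d 2 y" for x y using assms by (simp add: tri_def)
  have 1: "d 1 (x \<star> y) = d 2 x \<star> y + x \<star> d 0 y" for x y by (rule step[OF o 0])
  have 2: "d 2 (x \<star> y) = d 0 x \<star> y + x \<star> d 1 y" for x y
    using step[of "\<lambda>i. d (i + 1)" x y] o 1 by simp
  show "d i (x \<star> y) = d (i + 1) x \<star> y + x \<star> d (i + 2) y"
    using cases_3[of i] 0 1 2 by auto
qed

lemmas tri_linear = orth_LieD[OF triD(1)]

lemma triI:
  "(\<And>i. d i \<in> orth_Lie s q) \<Longrightarrow>
   (\<And>x y. d 0 (x \<star> y) = d 1 x \<star> y + x \<star> d 2 y) \<Longrightarrow> d \<in> tri s q m"
  by (simp add: tri_def)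

lemma theta_pow_tri:
  assumes "d \<in> tri s q m" shows "theta_pow i d \<in> tri s q m"
proof (rule triI)
  show "theta_pow i d j \<in> orth_Lie s q" for j
    using triD(1)[OF assms] by (simp add: theta_pow_def)
  show "theta_pow i d 0 (x \<star> y) = theta_pow i d 1 x \<star> y + x \<star> theta_pow i d 2 y" for x y
    using triD(2)[OF assms, of "-i" x y] by (simp add: theta_pow_def add.commute)
qed

section \<open>The inner triples t_{x,y} and their bracket relations\<close>

abbreviation t where "t \<equiv> tri_t s q m"

lemma t_simps:
  "t x y 0 z = s (B x z) y - s (B y z) x"
  "t x y 1 z = s (B x y / 2) z - y \<star> z \<star> x"
  "t x y 2 z = s (B x y / 2) z - x \<star> (z \<star> y)"
  by (simp_all add: tri_t_def)

text \<open>The summand q(x,y)/2 is what makes components 1 and 2 skew: by the composition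
  identities B(y*u*x, v) + B(y*v*x, u) equals B(u,v) B(x,y), and similarly for index 2. The triality
  rule is then a form of \<open>comp_four\<close>.\<close>

lemma t_tri: "t x y \<in> tri s q m"
proof (rule triI)
  fix i :: 3
  have lin: "t x y i (u + v) = t x y i u + t x y i v" "t x y i (s c u) = s c (t x y i u)" for u v c
    using cases_3[of i]
    by (auto simp: t_simps B_linear m_linear scale_left_distrib scale_right_distrib
        scale_right_diff_distrib mult.commute)
  have 0: "B (t x y 0 u) v = - B (t x y 0 v) u" for u v
    by (simp add: t_simps B_linear)
  have 1: "B (t x y 1 u) v = - B (t x y 1 v) u" for u v
  proof -
    have e: "B (y \<star> a \<star> x) b = B y (a \<star> (x \<star> b))" for a b by (simp add: polar_assoc)
    have "B y (u \<star> (x \<star> v)) + B y (v \<star> (x \<star> u)) = B u v * B x y"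
      using arg_cong[OF comp_right[of u x v], of "B y"] by (simp add: B_linear polar_commute)
    then have "B (y \<star> u \<star> x) v + B (y \<star> v \<star> x) u = B u v * B x y" unfolding e .
    moreover have "B v u = B u v" by (rule polar_commute)
    ultimately show ?thesis by (simp add: t_simps B_linear algebra_simps)
  qed
  have 2: "B (t x y 2 u) v = - B (t x y 2 v) u" for u v
  proof -
    have e: "B (x \<star> (a \<star> y)) b = B (b \<star> x \<star> a) y" for a b by (metis polar_assoc polar_commute)
    have "B (v \<star> x \<star> u) y + B (u \<star> x \<star> v) y = B u v * B x y"
      using arg_cong[OF comp_left[of v x u], of "\<lambda>z. B z y"]
      by (simp add: B_linear polar_commute)
    then have "B (x \<star> (u \<star> y)) v + B (x \<star> (v \<star> y)) u = B u v * B x y" unfolding e .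
    moreover have "B v u = B u v" by (rule polar_commute)
    ultimately show ?thesis by (simp add: t_simps B_linear algebra_simps)
  qed
  show "t x y i \<in> orth_Lie s q"
  proof (rule orth_LieI[OF lin])
    show "B (t x y i u) v = - B (t x y i v) u" for u v
      using cases_3[of i] 0[of u v] 1[of u v] 2[of u v] by blast
  qed
next
  fix u v
  have 1: "y \<star> u \<star> x \<star> v = s (B (y \<star> u) v) x - v \<star> x \<star> (y \<star> u)"
    by (rule comp_left_eq)
  have 2: "u \<star> (x \<star> (v \<star> y)) = s (B u (v \<star> y)) x - v \<star> y \<star> (x \<star> u)"
    by (rule comp_right_eq)
  have 3: "v \<star> x \<star> (y \<star> u) = s (B x (u \<star> v)) y + s (B y (u \<star> v)) x - s (B x y) (u \<star> v)
      - v \<star> y \<star> (x \<star> u)"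
    using comp_four[of v x y u] by (simp add: eq_diff_eq)
  have 4: "B (y \<star> u) v = B y (u \<star> v)" "B u (v \<star> y) = B y (u \<star> v)"
    by (metis polar_assoc polar_commute)+
  show "t x y 0 (u \<star> v) = t x y 1 u \<star> v + u \<star> t x y 2 v"
    \<comment> \<open>All fourfold products are brought to the form (v*y)*(x*u), which occurs twice
      with opposite signs.\<close>
    unfolding t_simps m_linear unfolding 1 2 unfolding 3 4
    by (simp add: algebra_simps scale_half[of "B x y" "u \<star> v", symmetric])
qed

text \<open>t_{x,y} is built from the form and the product alone, so bracketing with d
  differentiates it: component 0 uses skewness, components 1 and 2 the Leibniz rules of
  \<open>triD\<close>. In all three components it is d_0 that reaches x and y.\<close>

lemma t_bracket:
  assumes d: "d \<in> tri s q m"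
  shows "d i (t x y i z) - t x y i (d i z) = t (d 0 x) y i z + t x (d 0 y) i z"
proof -
  note lin = tri_linear[OF d]
  have sk: "B (d 0 x) y = - B x (d 0 y)" "B (d 0 x) z = - B x (d 0 z)" "B (d 0 y) z = - B y (d 0 z)"
    by (rule lin(6))+
  have 0: ?thesis if "i = 0"
    unfolding that t_simps sk by (simp add: lin algebra_simps scale_minus_left)
  have 1: ?thesis if "i = 1"
    unfolding that t_simps sk using triD(2)[OF d]
    by (simp add: lin(1-5) m_linear algebra_simps scale_minus_left)
  have 2: ?thesis if "i = 2"
    unfolding that t_simps sk using triD(2)[OF d]
    by (simp add: lin(1-5) m_linear algebra_simps scale_minus_left)
  show ?thesis using cases_3[of i] 0 1 2 by blast
qed

lemma tri_bracket_theta_t: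
  assumes d: "d \<in> tri s q m"
  shows "tri_bracket d (theta_pow i (t x y)) = theta_pow i (t (d i x) y) + theta_pow i (t x (d i
      y))"
proof (intro ext)
  fix j z
  have "theta_pow (- i) d \<in> tri s q m" by (rule theta_pow_tri[OF d])
  from t_bracket[OF this, of "j - i" x y z]
  show "tri_bracket d (theta_pow i (t x y)) j z =
    (theta_pow i (t (d i x) y) + theta_pow i (t x (d i y))) j z"
    by (simp add: tri_bracket_def theta_pow_def)
qed

text \<open>This is the source of the Jacobi identity for one element in each of the three
  \<open>iota i\<close>. Component 0 is \<open>comp_four\<close> after rewriting the values of the
  form in terms of x*y; the other components are its rotations.\<close>

lemma t_cyclic:
  "t (x \<star> y) z + theta_pow 1 (t (y \<star> z) x) + theta_pow 2 (t (z \<star> x) y) = 0"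
proof (intro ext)
  have 0: "t (x \<star> y) z 0 w + t (y \<star> z) x 2 w + t (z \<star> x) y 1 w = 0" for x y z w
  proof -
    have 4: "B z (x \<star> y) = B (x \<star> y) z" "B (y \<star> z) x = B (x \<star> y) z" "B (z \<star> x) y = B (x \<star> y) z"
      "B w (x \<star> y) = B (x \<star> y) w"
      by (metis B_rotate polar_commute)+
    have 5: "y \<star> z \<star> (w \<star> x) = s (B (x \<star> y) z) w + s (B (x \<star> y) w) z - s (B z w) (x \<star> y)
      - y \<star> w \<star> (z \<star> x)"
      using comp_four[of y z w x] unfolding 4 by (simp add: eq_diff_eq)
    show ?thesis
      unfolding t_simps 5 4
      by (simp add: algebra_simps scale_half[of "B (x \<star> y) z" w, symmetric])
  qed
  fix i w
  show "(t (x \<star> y) z + theta_pow 1 (t (y \<star> z) x) + theta_pow 2 (t (z \<star> x) y)) i w = 0 i w"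
    using cases_3[of i] 0[of x y z w] 0[of y z x w] 0[of z x y w]
    by (auto simp: theta_pow_def algebra_simps)
qed

lemma tri_bracket_tri:
  assumes d: "d \<in> tri s q m" and e: "e \<in> tri s q m"
  shows "tri_bracket d e \<in> tri s q m"
proof (rule triI)
  note ld = tri_linear[OF d] and le = tri_linear[OF e]
  show "tri_bracket d e i \<in> orth_Lie s q" for i
  proof (rule orth_LieI)
    fix x y
    have "B (d i (e i x)) y = B x (e i (d i y))" "B (e i (d i x)) y = B x (d i (e i y))"
      by (simp_all add: ld(6) le(6))
    then show "B (tri_bracket d e i x) y = - B (tri_bracket d e i y) x"
      by (simp add: tri_bracket_def B_linear polar_commute[of q x])
  qed (simp_all add: tri_bracket_def ld(1-5) le(1-5) scale_right_diff_distrib)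
  show "tri_bracket d e 0 (x \<star> y) = tri_bracket d e 1 x \<star> y + x \<star> tri_bracket d e 2 y" for x y
    using triD(2)[OF d] triD(2)[OF e]
    by (simp add: tri_bracket_def ld(1-5) le(1-5) m_linear algebra_simps)
qed

lemma tri_add:
  assumes d: "d \<in> tri s q m" and e: "e \<in> tri s q m"
  shows "d + e \<in> tri s q m"
proof (rule triI)
  show "(d + e) i \<in> orth_Lie s q" for i
  proof (rule orth_LieI)
    fix x y
    have "B (d i x) y = - B (d i y) x" "B (e i x) y = - B (e i y) x"
      by (rule tri_linear(7)[OF d] tri_linear(7)[OF e])+
    then show "B ((d + e) i x) y = - B ((d + e) i y) x"
      by (simp add: B_linear)
  qed (simp_all add: tri_linear(1-5)[OF d] tri_linear(1-5)[OF e] scale_right_distrib)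
  show "(d + e) 0 (x \<star> y) = (d + e) 1 x \<star> y + x \<star> (d + e) 2 y" for x y
    using triD(2)[OF d] triD(2)[OF e] by (simp add: m_linear)
qed

lemma tri_tri_scale:
  assumes d: "d \<in> tri s q m" shows "tri_scale s c d \<in> tri s q m"
proof (rule triI)
  show "tri_scale s c d i \<in> orth_Lie s q" for i
  proof (rule orth_LieI)
    fix x y
    have "B (d i x) y = - B (d i y) x" by (rule tri_linear(7)[OF d])
    then show "B (tri_scale s c d i x) y = - B (tri_scale s c d i y) x"
      by (simp add: tri_scale_def B_linear)
  qed (simp_all add: tri_scale_def tri_linear(1-5)[OF d] scale_right_distrib mult.commute)
  show "tri_scale s c d 0 (x \<star> y) = tri_scale s c d 1 x \<star> y + x \<star> tri_scale s c d 2 y" for x y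
    using triD(2)[OF d, of 0 x y] by (simp add: m_linear tri_scale_def scale_right_distrib)
qed

lemma tri_zero: "0 \<in> tri s q m"
  by (rule triI, rule orth_LieI) (simp_all add: B_linear m_linear)

end

section \<open>Octonions in coordinates\<close>

lemma vec3_eq_iff: "u = v \<longleftrightarrow> u $ 0 = v $ 0 \<and> u $ 1 = v $ 1 \<and> u $ 2 = (v :: 'b ^ 3) $ 2"
  unfolding vec_eq_iff using cases_3 by metis

text \<open>In the numeral type \<open>3\<close> one has 3 = 0, so the third coordinate of a vector
  is the one indexed by 0.\<close>

lemma cross_nth [simp]:
  "cross u v $ 1 = u $ 2 * v $ 0 - u $ 0 * v $ 2"
  "cross u v $ 2 = u $ 0 * v $ 1 - u $ 1 * v $ 0"
  "cross u v $ 0 = u $ 1 * v $ 2 - u $ 2 * v $ 1"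
proof -
  have "cross u v $ 3 = u $ 1 * v $ 2 - u $ 2 * v $ 1"
    unfolding cross_def by (rule vector_3)
  then show "cross u v $ 0 = u $ 1 * v $ 2 - u $ 2 * v $ 1" by simp
  have "cross u v $ 1 = u $ 2 * v $ 3 - u $ 3 * v $ 2"
    "cross u v $ 2 = u $ 3 * v $ 1 - u $ 1 * v $ 3"
    unfolding cross_def by (rule vector_3)+
  then show "cross u v $ 1 = u $ 2 * v $ 0 - u $ 0 * v $ 2"
    "cross u v $ 2 = u $ 0 * v $ 1 - u $ 1 * v $ 0" by simp_all
qed

lemma dot_eq: "dot u v = u $ 0 * v $ 0 + u $ 1 * v $ 1 + u $ 2 * v $ 2"
  by (simp add: dot_def sum_UNIV_3)

lemma oct_polar_eq:
  "polar oct_norm (a, u, v, b) (a', u', v', b') = a * b' + a' * b - dot u v' - dot u' v"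
  by (simp add: polar_def oct_norm_def dot_eq algebra_simps)

lemma oct_conj_eq: "oct_conj (a, u, v, b) = (b, - u, - v, a)"
  by (simp add: oct_conj_def oct_one_def oct_scale_def oct_polar_eq dot_eq vec3_eq_iff)

lemma oct_mult_eq:
  "oct_mult (a, u, v, b) (a', u', v', b') =
     (a * a' + dot u v', a *s u' + b' *s u - cross v v',
      a' *s v + b *s v' + cross u u', b * b' + dot v u')"
  by (simp add: oct_mult_def)

lemma oct_scale_eq: "oct_scale c (a, u, v, b) = (c * a, c *s u, c *s v, c * b)"
  by (simp add: oct_scale_def)

lemma S8_mult_eq:
  "S8_mult (a, u, v, b) (a', u', v', b') =
     (b * b' + dot u v', - (b *s u' + a' *s u) - cross v v',
      - (b' *s v + a *s v') + cross u u', a * a' + dot v u')"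
  by (simp add: S8_mult_def oct_conj_eq oct_mult_eq vec3_eq_iff dot_eq algebra_simps)

interpretation oct: vector_space "oct_scale :: 'a::field \<Rightarrow> _"
  by unfold_locales (auto simp: oct_scale_def vec3_eq_iff algebra_simps)

interpretation s2: vector_space "s2_scale :: 'a::field \<Rightarrow> _"
  by unfold_locales (auto simp: s2_scale_def algebra_simps)

lemma oct_nondegenerate:
  assumes "\<And>y. polar oct_norm x y = 0" shows "x = (0 :: 'a::field oct)"
proof (cases x)
  case (fields a u v b)
  have B: "polar oct_norm (a, u, v, b) (c, p, r, d) = 0" for c p r d
    using assms by (simp add: fields)
  note B = B[unfolded oct_polar_eq dot_eq]
  have "a = 0" "b = 0"
    using B[where c = 0 and p = 0 and r = 0 and d = 1] B[where c = 1 and p = 0 and r = 0 and d = 0]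
    by simp_all
  moreover have "u $ i = 0" "v $ i = 0" for i
    using B[where c = 0 and p = 0 and r = "axis i 1" and d = 0]
      B[where c = 0 and p = "axis i 1" and r = 0 and d = 0] cases_3[of i]
    by (auto simp: axis_def)
  ultimately show ?thesis by (simp add: fields zero_prod_def vec_eq_iff)
qed

text \<open>The composition identities are verified here in Zorn coordinates; alternativity and the
  adjoint rules of the octonion product are afterwards deduced from them.\<close>

interpretation S8: sym_comp "oct_scale :: 'a::field_char_0 \<Rightarrow> _" oct_norm S8_mult
proof unfold_locales
  fix x y z :: "'a oct" and c :: 'a
  obtain a u v b where x: "x = (a, u, v, b)" by (cases x)
  obtain a' u' v' b' where y: "y = (a', u', v', b')" by (cases y)
  obtain a'' u'' v'' b'' where z: "z = (a'', u'', v'', b'')" by (cases z)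
  note eqs = oct_polar_eq S8_mult_eq oct_scale_eq dot_eq
  show "polar oct_norm (x + y) z = polar oct_norm x z + polar oct_norm y z"
    "polar oct_norm (oct_scale c x) z = c * polar oct_norm x z"
    by (simp_all add: x y z eqs algebra_simps)
  show "S8_mult (x + y) z = S8_mult x z + S8_mult y z"
    "S8_mult z (x + y) = S8_mult z x + S8_mult z y"
    "S8_mult (oct_scale c x) z = oct_scale c (S8_mult x z)"
    "S8_mult z (oct_scale c x) = oct_scale c (S8_mult z x)"
    by (simp_all add: x y z eqs vec3_eq_iff algebra_simps)
  show "S8_mult (S8_mult x y) z + S8_mult (S8_mult z y) x = oct_scale (polar oct_norm x z) y"
    by (simp add: x y z eqs vec3_eq_iff algebra_simps)
  show "S8_mult x (S8_mult y z) + S8_mult z (S8_mult y x) = oct_scale (polar oct_norm x z) y"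
    by (simp add: x y z eqs vec3_eq_iff algebra_simps)
  show "polar oct_norm (S8_mult x y) z = polar oct_norm x (S8_mult y z)"
    by (simp add: x y z eqs algebra_simps)
qed (rule oct_nondegenerate)

lemma s2_polar_eq: "polar s2_norm (a, b) (a', b') = a * b' + a' * b"
  by (simp add: polar_def s2_norm_def algebra_simps)

lemma S2_mult_eq: "S2_mult (a, b) (a', b') = (b * b', a * a')"
  by (simp add: S2_mult_def s2_swap_def)

lemma s2_scale_eq: "s2_scale c (a, b) = (c * a, c * b)"
  by (simp add: s2_scale_def)

interpretation S2: sym_comp "s2_scale :: 'a::field_char_0 \<Rightarrow> _" s2_norm S2_mult
proof unfold_locales
  fix x :: "'a s2" assume B: "\<And>y. polar s2_norm x y = 0"
  show "x = 0"
    using B[of "(1, 0)"] B[of "(0, 1)"] by (cases x) (simp add: s2_polar_eq zero_prod_def)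
next
  fix x y z :: "'a s2" and c :: 'a
  show "polar s2_norm (x + y) z = polar s2_norm x z + polar s2_norm y z"
    "polar s2_norm (s2_scale c x) z = c * polar s2_norm x z"
    "S2_mult (x + y) z = S2_mult x z + S2_mult y z"
    "S2_mult z (x + y) = S2_mult z x + S2_mult z y"
    "S2_mult (s2_scale c x) z = s2_scale c (S2_mult x z)"
    "S2_mult z (s2_scale c x) = s2_scale c (S2_mult z x)"
    "S2_mult (S2_mult x y) z + S2_mult (S2_mult z y) x = s2_scale (polar s2_norm x z) y"
    "S2_mult x (S2_mult y z) + S2_mult z (S2_mult y x) = s2_scale (polar s2_norm x z) y"
    "polar s2_norm (S2_mult x y) z = polar s2_norm x (S2_mult y z)"
    by (cases x; cases y; cases z;
        simp add: s2_polar_eq S2_mult_eq s2_scale_eq algebra_simps)+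
qed

subsection \<open>Composition identities\<close>

lemma oct_eqs:
  fixes x y z :: "'a::field_char_0 oct"
  shows oct_conj_conj: "oct_conj (oct_conj x) = x"
    and oct_conj_mult: "oct_conj (oct_mult x y) = oct_mult (oct_conj y) (oct_conj x)"
    and oct_conj_add: "oct_conj (x + y) = oct_conj x + oct_conj y"
    and oct_conj_scale: "oct_conj (oct_scale c x) = oct_scale c (oct_conj x)"
    and oct_conj_one: "oct_conj oct_one = (oct_one :: 'a oct)"
    and oct_polar_conj: "polar oct_norm (oct_conj x) (oct_conj y) = polar oct_norm x y"
    and oct_one_mult: "oct_mult oct_one x = x" "oct_mult x oct_one = x"
    and oct_one_S8: "S8_mult oct_one x = oct_conj x" "S8_mult x oct_one = oct_conj x"
    and oct_mult_eq_S8: "oct_mult x y = S8_mult (oct_conj x) (oct_conj y)"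
    and oct_polar_one_one: "polar oct_norm oct_one (oct_one :: 'a oct) = 2"
  by (cases x; cases y; simp add: oct_conj_eq oct_mult_eq oct_scale_eq oct_one_def oct_polar_eq
      S8_mult_eq dot_eq vec3_eq_iff algebra_simps)+

lemma oct_conj_diff: "oct_conj (x - y) = oct_conj x - oct_conj (y :: 'a::field_char_0 oct)"
  and oct_conj_minus: "oct_conj (- x) = - oct_conj (x :: 'a::field_char_0 oct)"
  and oct_conj_zero: "oct_conj 0 = (0 :: 'a::field_char_0 oct)"
proof -
  show m: "oct_conj (- x) = - oct_conj x" for x :: "'a oct"
    using oct_conj_scale[of "-1" x] by simp
  show "oct_conj 0 = (0 :: 'a oct)" using oct_conj_add[of "0 :: 'a oct" 0] by simp
  show "oct_conj (x - y) = oct_conj x - oct_conj y" for x y :: "'a oct"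
    using oct_conj_add[of x "- y"] m[of y] by simp
qed

lemma oct_conj_S8_mult:
  "oct_conj (S8_mult x y) = S8_mult (oct_conj y) (oct_conj (x :: 'a::field_char_0 oct))"
  by (simp add: S8_mult_def oct_conj_mult)

lemma oct_mult_linear:
  fixes x y z :: "'a::field_char_0 oct"
  shows "oct_mult (x + y) z = oct_mult x z + oct_mult y z"
    "oct_mult z (x + y) = oct_mult z x + oct_mult z y"
    "oct_mult (x - y) z = oct_mult x z - oct_mult y z"
    "oct_mult z (x - y) = oct_mult z x - oct_mult z y"
    "oct_mult (- x) z = - oct_mult x z" "oct_mult z (- x) = - oct_mult z x"
    "oct_mult 0 z = 0" "oct_mult z 0 = 0"
    "oct_mult (oct_scale c x) z = oct_scale c (oct_mult x z)"
    "oct_mult z (oct_scale c x) = oct_scale c (oct_mult z x)"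
  unfolding oct_mult_eq_S8
  by (simp_all add: oct_conj_add oct_conj_diff oct_conj_minus oct_conj_zero oct_conj_scale
      S8.m_linear)

lemma oct_conj_trace_zero:
  "polar oct_norm x oct_one = 0 \<Longrightarrow> oct_conj x = - x"
  by (simp add: oct_conj_def)

text \<open>Reading x*y = conj(x) conj(y) backwards, conj(x)(yz) is x*(z*y), so this is
  \<open>comp_right\<close>.\<close>

lemma oct_left_alt:
  fixes x y z :: "'a::field_char_0 oct"
  shows "oct_mult (oct_conj x) (oct_mult y z) + oct_mult (oct_conj y) (oct_mult x z) =
    oct_scale (polar oct_norm x y) z"
proof -
  have "oct_mult (oct_conj x) (oct_mult y z) = S8_mult x (S8_mult (oct_conj (oct_conj z)) y)"
    "oct_mult (oct_conj y) (oct_mult x z) = S8_mult y (S8_mult (oct_conj (oct_conj z)) x)"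
    by (simp_all add: oct_mult_eq_S8 oct_conj_S8_mult oct_conj_conj)
  then show ?thesis using S8.comp_right[of x z y] by (simp add: oct_conj_conj)
qed

lemma oct_right_alt:
  fixes x y z :: "'a::field_char_0 oct"
  shows "oct_mult (oct_mult z x) (oct_conj y) + oct_mult (oct_mult z y) (oct_conj x) =
    oct_scale (polar oct_norm x y) z"
proof -
  have "oct_mult (oct_mult z x) (oct_conj y) = S8_mult (S8_mult x z) y"
    "oct_mult (oct_mult z y) (oct_conj x) = S8_mult (S8_mult y z) x"
    by (simp_all add: oct_mult_eq_S8 oct_conj_S8_mult oct_conj_conj)
  then show ?thesis using S8.comp_left[of x z y] by simp
qed

lemma oct_polar_mult_left:
  fixes x y z :: "'a::field_char_0 oct"
  shows "polar oct_norm (oct_mult x y) z = polar oct_norm y (oct_mult (oct_conj x) z)"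
proof -
  have "polar oct_norm (oct_mult x y) z = polar oct_norm (S8_mult z (oct_conj x)) (oct_conj y)"
    unfolding oct_mult_eq_S8 by (metis S8.B_rotate)
  also have "\<dots> = polar oct_norm (oct_conj (S8_mult z (oct_conj x))) y"
    by (metis oct_polar_conj oct_conj_conj)
  finally show ?thesis
    by (simp add: oct_conj_S8_mult oct_mult_eq_S8 oct_conj_conj polar_commute)
qed

lemma oct_polar_mult_right:
  fixes x y z :: "'a::field_char_0 oct"
  shows "polar oct_norm (oct_mult x y) z = polar oct_norm x (oct_mult z (oct_conj y))"
proof -
  have "polar oct_norm (oct_mult x y) z = polar oct_norm (oct_conj x) (S8_mult (oct_conj y) z)"
    unfolding oct_mult_eq_S8 by (rule S8.polar_assoc)
  also have "\<dots> = polar oct_norm x (oct_conj (S8_mult (oct_conj y) z))"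
    by (metis oct_polar_conj oct_conj_conj)
  finally show ?thesis
    by (simp add: oct_conj_S8_mult oct_mult_eq_S8 oct_conj_conj)
qed

section \<open>The tensor product and the bracket\<close>

lemma s2_basis: "s2_scale (fst x) (1, 0) + s2_scale (snd x) (0, 1) = (x :: 'a::field s2)"
  by (cases x) (simp add: s2_scale_def)

lemma tensor_linear:
  fixes x y :: "'a::field oct"
  shows "tensor (x + y) x' = tensor x x' + tensor y x'"
    "tensor x (x' + y') = tensor x x' + tensor x y'"
    "tensor (x - y) x' = tensor x x' - tensor y x'"
    "tensor x (x' - y') = tensor x x' - tensor x y'"
    "tensor (- x) x' = - tensor x x'" "tensor x (- x') = - tensor x x'"
    "tensor 0 x' = 0" "tensor x 0 = 0"
    "tensor (oct_scale c x) x' = tensor x (s2_scale c x')"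
  by (simp_all add: tensor_def s2_scale_def oct.scale_right_distrib oct.scale_left_distrib
      oct.scale_right_diff_distrib oct.scale_left_diff_distrib zero_prod_def[symmetric]
      case_prod_beta mult.commute)

lemma tensor_scale:
  "(oct_scale c (fst (tensor x x')), oct_scale c (snd (tensor x x'))) = tensor (oct_scale c x) x'"
  by (simp add: tensor_def mult.commute)

lemma tens_eq: "v = tensor (fst v) (1, 0) + tensor (snd v) (0, 1)"
  by (simp add: tensor_def)

lemma tens_map_add:
  assumes "\<And>x y. f (x + y) = f x + f y"
  shows "tens_map f f' (v + w) = tens_map f f' v + tens_map f f' w"
  using assms by (simp add: tens_map_def tensor_linear)

lemma tens_map_tensor:
  assumes "\<And>c x. f (oct_scale c x) = oct_scale c (f x)"
    and "\<And>x y. f' (x + y) = f' x + f' y" "\<And>c x. f' (s2_scale c x) = s2_scale c (f' x)"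
  shows "tens_map f f' (tensor x x') = tensor (f x) (f' x')"
proof -
  have "tens_map f f' (tensor x x') =
      tensor (f x) (f' (s2_scale (fst x') (1, 0)) + f' (s2_scale (snd x') (0, 1)))"
    by (simp add: tens_map_def tensor_def[of x] assms(1) tensor_linear assms(3))
  then show ?thesis by (simp add: assms(2)[symmetric] s2_basis)
qed

lemma tens_lift_add:
  assumes "\<And>x z x' y y'. B (x + z) x' y y' = B x x' y y' + B z x' y y'"
    and "\<And>x x' y z y'. B x x' (y + z) y' = B x x' y y' + B x x' z y'"
  shows "tens_lift B (v + v2) w = tens_lift B v w + tens_lift B v2 w"
    "tens_lift B v (w + w2) = tens_lift B v w + tens_lift B v w2"
  by (simp_all add: tens_lift_def assms)

text \<open>\<open>tens_lift\<close> sees only the coordinates of the second factor along (1,0) and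
  (0,1). Expanding x' and y' in this basis and moving the coefficients across by the two balancing
  hypotheses recovers the value on pure tensors.\<close>

lemma tens_lift_tensor:
  assumes x': "\<And>x x' z' y y'. B x (x' + z') y y' = B x x' y y' + B x z' y y'"
    and y': "\<And>x x' y y' z'. B x x' y (y' + z') = B x x' y y' + B x x' y z'"
    and balx: "\<And>c x x' y y'. B (oct_scale c x) x' y y' = B x (s2_scale c x') y y'"
    and baly: "\<And>c x x' y y'. B x x' (oct_scale c y) y' = B x x' y (s2_scale c y')"
  shows "tens_lift B (tensor x x') (tensor y y') = B x x' y y'"
proof -
  define X1 X2 Y1 Y2 where "X1 = s2_scale (fst x') (1, 0)" and "X2 = s2_scale (snd x') (0, 1)"
    and "Y1 = s2_scale (fst y') (1, 0)" and "Y2 = s2_scale (snd y') (0, 1)"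
  note defs = X1_def X2_def Y1_def Y2_def
  have "B x x' y y' = B x X1 y y' + B x X2 y y'"
    by (simp add: defs x'[symmetric] s2_basis)
  moreover have "B x z' y y' = B x z' y Y1 + B x z' y Y2" for z'
    by (simp add: defs y'[symmetric] s2_basis)
  from this[of X1] this[of X2]
  have "B x X1 y y' = B x X1 y Y1 + B x X1 y Y2" "B x X2 y y' = B x X2 y Y1 + B x X2 y Y2" .
  ultimately show ?thesis
    by (simp add: defs tens_lift_def tensor_def balx baly add.assoc)
qed

text \<open>By \<open>tens_eq\<close> every element is a sum of two pure tensors.\<close>

lemma tens_induct [case_names add tensor]:
  assumes "\<And>v w. P v \<Longrightarrow> P w \<Longrightarrow> P (v + w)" and "\<And>x x'. P (tensor x x')"
  shows "P v"
  using assms by (subst tens_eq) blast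

section \<open>Bilinearity of the bracket and reduction to generators\<close>

abbreviation tri8 :: "(3 \<Rightarrow> 'a::field oct \<Rightarrow> 'a oct) set" where
  "tri8 \<equiv> tri oct_scale oct_norm S8_mult"

abbreviation tri2 :: "(3 \<Rightarrow> 'a::field s2 \<Rightarrow> 'a s2) set" where
  "tri2 \<equiv> tri s2_scale s2_norm S2_mult"

abbreviation tens_scale :: "'a::field \<Rightarrow> 'a tens \<Rightarrow> 'a tens" where
  "tens_scale c v \<equiv> (oct_scale c (fst v), oct_scale c (snd v))"

text \<open>\<open>T8 i\<close> and \<open>T2 i\<close> are the \<open>tri8\<close> and
  \<open>tri2\<close> parts of the bracket of two elements of the same
  \<open>iota i\<close>.\<close>

definition T8 :: "3 \<Rightarrow> 'a::field tens \<Rightarrow> 'a tens \<Rightarrow> 3 \<Rightarrow> 'a oct \<Rightarrow> 'a oct" where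
  "T8 i = tens_lift (\<lambda>x x' y y'. tri_scale oct_scale (polar s2_norm x' y')
            (theta_pow i (tri_t oct_scale oct_norm S8_mult x y)))"

definition T2 :: "3 \<Rightarrow> 'a::field tens \<Rightarrow> 'a tens \<Rightarrow> 3 \<Rightarrow> 'a s2 \<Rightarrow> 'a s2" where
  "T2 i = tens_lift (\<lambda>x x' y y'. tri_scale s2_scale (polar oct_norm x y)
            (theta_pow i (tri_t s2_scale s2_norm S2_mult x' y')))"

lemma g_bracket_eq:
  "g_bracket (d, d', v) (e, e', w) =
     (tri_bracket d e + (\<Sum>i\<in>UNIV. T8 i (v i) (w i)),
      tri_bracket d' e' + (\<Sum>i\<in>UNIV. T2 i (v i) (w i)),
      \<lambda>i. tens_map (d i) id (w i) + tens_map id (d' i) (w i)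
          - tens_map (e i) id (v i) - tens_map id (e' i) (v i)
          + tens_mult (v (i + 1)) (w (i + 2)) - tens_mult (w (i + 1)) (v (i + 2)))"
  by (simp add: g_bracket_def T8_def T2_def)

context sym_comp
begin

lemma t_linear:
  "t (x + y) z = t x z + t y z" "t x (y + z) = t x y + t x z"
  "t (s c x) y = tri_scale s c (t x y)" "t x (s c y) = tri_scale s c (t x y)"
  by (intro ext, simp add: tri_t_def tri_scale_def B_linear m_linear scale_left_distrib
      scale_right_distrib scale_right_diff_distrib add_divide_distrib mult.commute)+

lemma theta_tri_scale_linear:
  "theta_pow i (d + e) = theta_pow i d + theta_pow i e"
  "theta_pow i (tri_scale s c d) = tri_scale s c (theta_pow i d)"
  "tri_scale s c (d + e) = tri_scale s c d + tri_scale s c e"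
  "tri_scale s (a + b) d = tri_scale s a d + tri_scale s b d"
  "tri_scale s a (tri_scale s b d) = tri_scale s (a * b) d"
  "tri_scale s 1 d = d" "tri_scale s 0 d = 0" "tri_scale s c 0 = 0"
  by (intro ext, simp add: tri_scale_def theta_pow_def scale_left_distrib scale_right_distrib)+

end

lemma T8_tensor:
  "T8 i (tensor x x') (tensor y (y' :: 'a::field_char_0 s2)) =
     tri_scale oct_scale (polar s2_norm x' y') (theta_pow i (S8.t x y))"
  unfolding T8_def
  by (rule tens_lift_tensor)
    (simp_all add: S2.B_linear S8.t_linear S8.theta_tri_scale_linear mult.commute)

lemma T2_tensor:
  "T2 i (tensor x x') (tensor y (y' :: 'a::field_char_0 s2)) =
     tri_scale s2_scale (polar oct_norm x y) (theta_pow i (S2.t x' y'))"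
  unfolding T2_def
  by (rule tens_lift_tensor)
    (simp_all add: S8.B_linear S2.t_linear S2.theta_tri_scale_linear mult.commute)

lemma tens_mult_tensor:
  "tens_mult (tensor x x') (tensor y (y' :: 'a::field_char_0 s2)) =
     tensor (S8_mult x y) (S2_mult x' y')"
  unfolding tens_mult_def
  by (rule tens_lift_tensor) (simp_all add: S8.m_linear S2.m_linear tensor_linear)

lemma T8_add:
  fixes u v w :: "'a::field_char_0 tens"
  shows "T8 i (u + v) w = T8 i u w + T8 i v w" "T8 i u (v + w) = T8 i u v + T8 i u w"
  unfolding T8_def
  by (rule tens_lift_add; simp add: S8.t_linear S8.theta_tri_scale_linear)+

lemma T2_add:
  fixes u v w :: "'a::field_char_0 tens"
  shows "T2 i (u + v) w = T2 i u w + T2 i v w" "T2 i u (v + w) = T2 i u v + T2 i u w"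
  unfolding T2_def
  by (rule tens_lift_add; simp add: S8.B_linear S2.theta_tri_scale_linear)+

lemma tens_mult_add:
  fixes u v w :: "'a::field_char_0 tens"
  shows "tens_mult (u + v) w = tens_mult u w + tens_mult v w"
    "tens_mult u (v + w) = tens_mult u v + tens_mult u w"
  unfolding tens_mult_def
  by (rule tens_lift_add; simp add: S8.m_linear tensor_linear)+

lemma add_imp_zero: "(\<And>x y. f (x + y) = f x + f y) \<Longrightarrow> f 0 = 0"
  for f :: "'x::monoid_add \<Rightarrow> 'y::ab_group_add"
  by (metis add_0 add_cancel_right_right)

lemma tens_zero [simp]:
  fixes u :: "'a::field_char_0 tens"
  shows "T8 i 0 u = 0" "T8 i u 0 = 0" "T2 i 0 u = 0" "T2 i u 0 = 0"
    "tens_mult 0 u = 0" "tens_mult u 0 = 0" "tens_map 0 id u = 0" "tens_map id 0 u = 0"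
proof -
  show "T8 i 0 u = 0" by (rule add_imp_zero[of "\<lambda>x. T8 i x u"]) (rule T8_add)
  show "T8 i u 0 = 0" by (rule add_imp_zero[of "\<lambda>x. T8 i u x"]) (rule T8_add)
  show "T2 i 0 u = 0" by (rule add_imp_zero[of "\<lambda>x. T2 i x u"]) (rule T2_add)
  show "T2 i u 0 = 0" by (rule add_imp_zero[of "\<lambda>x. T2 i u x"]) (rule T2_add)
  show "tens_mult 0 u = 0" by (rule add_imp_zero[of "\<lambda>x. tens_mult x u"]) (rule tens_mult_add)
  show "tens_mult u 0 = 0" by (rule add_imp_zero[of "\<lambda>x. tens_mult u x"]) (rule tens_mult_add)
  show "tens_map 0 id u = 0" "tens_map id 0 u = 0" by (simp_all add: tens_map_def tensor_linear)
qed

lemma tens_scale_add: "tens_scale c (v + w) = tens_scale c v + tens_scale c w"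
  by (simp add: oct.scale_right_distrib)

lemma tens_scale_bilinear:
  fixes v w :: "'a::field_char_0 tens"
  shows "T8 i (tens_scale c v) w = tri_scale oct_scale c (T8 i v w)"
    "T2 i (tens_scale c v) w = tri_scale s2_scale c (T2 i v w)"
    "tens_mult (tens_scale c v) w = tens_scale c (tens_mult v w)"
    "T8 i v (tens_scale c w) = tri_scale oct_scale c (T8 i v w)"
    "T2 i v (tens_scale c w) = tri_scale s2_scale c (T2 i v w)"
    "tens_mult v (tens_scale c w) = tens_scale c (tens_mult v w)"
proof (induction v rule: tens_induct)
  case (tensor x x')
  {
    case 1 show ?case by (induction w rule: tens_induct)
      (simp_all only: T8_add tens_scale_add T8_tensor tensor_scale S8.t_linear
        S8.theta_tri_scale_linear mult.commute)
  next
    case 2 show ?case by (induction w rule: tens_induct)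
      (simp_all only: T2_add tens_scale_add T2_tensor tensor_scale S8.B_linear
        S2.theta_tri_scale_linear)
  next
    case 3 show ?case by (induction w rule: tens_induct)
      (simp_all only: tens_mult_add tens_scale_add tens_mult_tensor tensor_scale S8.m_linear)
  next
    case 4 show ?case by (induction w rule: tens_induct)
      (simp_all only: T8_add tens_scale_add T8_tensor tensor_scale S8.t_linear
        S8.theta_tri_scale_linear mult.commute)
  next
    case 5 show ?case by (induction w rule: tens_induct)
      (simp_all only: T2_add tens_scale_add T2_tensor tensor_scale S8.B_linear
        S2.theta_tri_scale_linear)
  next
    case 6 show ?case by (induction w rule: tens_induct)
      (simp_all only: tens_mult_add tens_scale_add tens_mult_tensor tensor_scale S8.m_linear)
  }
qed (simp_all only: tens_scale_add T8_add T2_add tens_mult_add S8.theta_tri_scale_linear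
    S2.theta_tri_scale_linear)

interpretation g: vector_space "g_scale :: 'a::field_char_0 \<Rightarrow> _"
  by unfold_locales
    (auto simp: g_scale_def S8.theta_tri_scale_linear S2.theta_tri_scale_linear fun_eq_iff
      oct.scale_right_distrib oct.scale_left_distrib)

lemma g_carrier_iff: "(d, d', v) \<in> g_carrier \<longleftrightarrow> d \<in> tri8 \<and> d' \<in> tri2"
  by (simp add: g_carrier_def)

lemma tens_map_tri8_linear:
  fixes v w :: "'a::field_char_0 tens"
  assumes "d \<in> tri8"
  shows "tens_map (d i) id (v + w) = tens_map (d i) id v + tens_map (d i) id w"
    "tens_map (d i) id (tens_scale c v) = tens_scale c (tens_map (d i) id v)"
    "tens_map (d i) id (tensor x x') = tensor (d i x) x'"
    "tens_map (d i) id 0 = 0"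
proof -
  note lin = S8.tri_linear[OF assms]
  show 1: "tens_map (d i) id (v + w) = tens_map (d i) id v + tens_map (d i) id w" for v w
    by (rule tens_map_add) (rule lin)
  show "tens_map (d i) id (tensor x x') = tensor (d i x) x'"
    by (subst tens_map_tensor) (simp_all add: lin)
  show "tens_map (d i) id (tens_scale c v) = tens_scale c (tens_map (d i) id v)"
    by (simp add: tens_map_def lin tensor_def oct.scale_right_distrib mult.commute)
  show "tens_map (d i) id 0 = 0" by (rule add_imp_zero) (rule 1)
qed

lemma tens_map_tri2_linear:
  fixes v w :: "'a::field_char_0 tens"
  assumes "d \<in> tri2"
  shows "tens_map id (d i) (v + w) = tens_map id (d i) v + tens_map id (d i) w"
    "tens_map id (d i) (tens_scale c v) = tens_scale c (tens_map id (d i) v)"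
    "tens_map id (d i) (tensor x x') = tensor x (d i x')"
    "tens_map id (d i) 0 = 0"
proof -
  note lin = S2.tri_linear[OF assms]
  show 1: "tens_map id (d i) (v + w) = tens_map id (d i) v + tens_map id (d i) w" for v w
    by (rule tens_map_add) simp
  show "tens_map id (d i) (tensor x x') = tensor x (d i x')"
    by (subst tens_map_tensor) (simp_all add: lin)
  show "tens_map id (d i) (tens_scale c v) = tens_scale c (tens_map id (d i) v)"
    by (simp add: tens_map_def tensor_def oct.scale_right_distrib mult.commute)
  show "tens_map id (d i) 0 = 0" by (rule add_imp_zero) (rule 1)
qed

lemma tens_map_pointwise:
  "tens_map (\<lambda>x. f x + g x) id v = tens_map f id v + tens_map g id v"
  "tens_map id (\<lambda>x. f' x + g' x) v = tens_map id f' v + tens_map id g' v"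
  "tens_map (\<lambda>x. oct_scale c (f x)) id v = tens_scale c (tens_map f id v)"
  "tens_map id (\<lambda>x. s2_scale c (f' x)) v = tens_scale c (tens_map id f' v)"
  by (simp_all add: tens_map_def tensor_def s2_scale_def case_prod_beta oct.scale_right_distrib
      oct.scale_left_distrib mult.commute)

lemma g_bracket_add:
  fixes x y z :: "'a::field_char_0 g_elem"
  assumes "x \<in> g_carrier" "y \<in> g_carrier" "z \<in> g_carrier"
  shows "g_bracket (x + y) z = g_bracket x z + g_bracket y z"
    and "g_bracket z (x + y) = g_bracket z x + g_bracket z y"
proof -
  obtain d d' u where x: "x = (d, d', u)" by (cases x)
  obtain e e' v where y: "y = (e, e', v)" by (cases y)
  obtain f f' w where z: "z = (f, f', w)" by (cases z)
  have mem: "d \<in> tri8" "d' \<in> tri2" "e \<in> tri8" "e' \<in> tri2" "f \<in> tri8" "f' \<in> tri2"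
    using assms by (simp_all add: x y z g_carrier_iff)
  have tb: "tri_bracket (d + e) f = tri_bracket d f + tri_bracket e f"
    "tri_bracket f (d + e) = tri_bracket f d + tri_bracket f e"
    "tri_bracket (d' + e') f' = tri_bracket d' f' + tri_bracket e' f'"
    "tri_bracket f' (d' + e') = tri_bracket f' d' + tri_bracket f' e'"
    by (simp_all add: tri_bracket_def fun_eq_iff S8.tri_linear[OF mem(5)] S2.tri_linear[OF mem(6)])
  note lin = tens_map_tri8_linear(1)[OF mem(1)] tens_map_tri2_linear(1)[OF mem(2)]
    tens_map_tri8_linear(1)[OF mem(3)] tens_map_tri2_linear(1)[OF mem(4)]
    tens_map_tri8_linear(1)[OF mem(5)] tens_map_tri2_linear(1)[OF mem(6)]
    tens_map_pointwise
  have pw: "tens_map ((d + e) i) id a = tens_map (d i) id a + tens_map (e i) id a"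
    "tens_map id ((d' + e') i) a = tens_map id (d' i) a + tens_map id (e' i) a" for i a
    by (simp_all add: plus_fun_def tens_map_pointwise)
  show "g_bracket (x + y) z = g_bracket x z + g_bracket y z"
    unfolding x y z add_Pair g_bracket_eq tb pw plus_fun_apply T8_add T2_add tens_mult_add lin
      sum.distrib
    by (auto simp: fun_eq_iff algebra_simps)
  show "g_bracket z (x + y) = g_bracket z x + g_bracket z y"
    unfolding x y z add_Pair g_bracket_eq tb pw plus_fun_apply T8_add T2_add tens_mult_add lin
      sum.distrib
    by (auto simp: fun_eq_iff algebra_simps)
qed

lemma tri_scale_sum:
  "(\<Sum>i\<in>I. tri_scale oct_scale c (f i)) = tri_scale oct_scale c (\<Sum>i\<in>I. f i)"
  "(\<Sum>i\<in>I. tri_scale s2_scale c (f' i)) = tri_scale s2_scale c (\<Sum>i\<in>I. f' i :: 3 \<Rightarrow> 'a::field_char_0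
      s2 \<Rightarrow> 'a s2)"
  for c :: "'a::field_char_0"
proof -
  show "(\<Sum>i\<in>I. tri_scale oct_scale c (f i)) = tri_scale oct_scale c (\<Sum>i\<in>I. f i)"
    by (induction I rule: infinite_finite_induct)
      (simp_all only: sum.infinite sum.empty sum.insert S8.theta_tri_scale_linear not_False_eq_True)
  show "(\<Sum>i\<in>I. tri_scale s2_scale c (f' i)) = tri_scale s2_scale c (\<Sum>i\<in>I. f' i)"
    by (induction I rule: infinite_finite_induct)
      (simp_all only: sum.infinite sum.empty sum.insert S2.theta_tri_scale_linear not_False_eq_True)
qed

lemma g_bracket_scale:
  fixes x y :: "'a::field_char_0 g_elem"
  assumes "x \<in> g_carrier" "y \<in> g_carrier"
  shows "g_bracket (g_scale c x) y = g_scale c (g_bracket x y)"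
    and "g_bracket x (g_scale c y) = g_scale c (g_bracket x y)"
proof -
  obtain d d' u where x: "x = (d, d', u)" by (cases x)
  obtain e e' v where y: "y = (e, e', v)" by (cases y)
  have mem: "d \<in> tri8" "d' \<in> tri2" "e \<in> tri8" "e' \<in> tri2"
    using assms by (simp_all add: x y g_carrier_iff)
  have tb: "tri_bracket (tri_scale oct_scale c d) e = tri_scale oct_scale c (tri_bracket d e)"
    "tri_bracket d (tri_scale oct_scale c e) = tri_scale oct_scale c (tri_bracket d e)"
    "tri_bracket (tri_scale s2_scale c d') e' = tri_scale s2_scale c (tri_bracket d' e')"
    "tri_bracket d' (tri_scale s2_scale c e') = tri_scale s2_scale c (tri_bracket d' e')"
    by (simp_all add: tri_bracket_def tri_scale_def fun_eq_iff S8.tri_linear[OF mem(1)]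
        S2.tri_linear[OF mem(2)] S8.tri_linear[OF mem(3)] S2.tri_linear[OF mem(4)]
        oct.scale_right_diff_distrib s2.scale_right_diff_distrib)
  note lin = tens_map_tri8_linear(2)[OF mem(1)] tens_map_tri2_linear(2)[OF mem(2)]
    tens_map_tri8_linear(2)[OF mem(3)] tens_map_tri2_linear(2)[OF mem(4)]
  have pw: "tens_map (tri_scale oct_scale c f i) id a = tens_scale c (tens_map (f i) id a)"
    "tens_map id (tri_scale s2_scale c f' i) a = tens_scale c (tens_map id (f' i) a)" for i f f' a
    by (simp_all only: tri_scale_def tens_map_pointwise)
  have ts: "tens_scale c (a + b) = tens_scale c a + tens_scale c b"
    "tens_scale c (a - b) = tens_scale c a - tens_scale c b" for a b :: "'a tens"
    by (simp_all add: oct.scale_right_distrib oct.scale_right_diff_distrib)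
  show "g_bracket (g_scale c x) y = g_scale c (g_bracket x y)"
    unfolding x y g_scale_def split g_bracket_eq tb pw lin tens_scale_bilinear tri_scale_sum ts
      S8.theta_tri_scale_linear(3) S2.theta_tri_scale_linear(3) ..
  show "g_bracket x (g_scale c y) = g_scale c (g_bracket x y)"
    unfolding x y g_scale_def split g_bracket_eq tb pw lin tens_scale_bilinear tri_scale_sum ts
      S8.theta_tri_scale_linear(3) S2.theta_tri_scale_linear(3) ..
qed

lemma g_carrier_closed:
  fixes x y :: "'a::field_char_0 g_elem"
  shows "x \<in> g_carrier \<Longrightarrow> y \<in> g_carrier \<Longrightarrow> x + y \<in> g_carrier"
    "x \<in> g_carrier \<Longrightarrow> g_scale c x \<in> g_carrier" "0 \<in> (g_carrier :: 'a g_elem set)"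
    "x \<in> g_carrier \<Longrightarrow> y \<in> g_carrier \<Longrightarrow> x - y \<in> g_carrier"
    "x \<in> g_carrier \<Longrightarrow> - x \<in> g_carrier"
proof -
  show 1: "x + y \<in> g_carrier" if "x \<in> g_carrier" "y \<in> g_carrier" for x y :: "'a g_elem"
    using that by (cases x; cases y) (simp add: g_carrier_iff S8.tri_add S2.tri_add)
  show 2: "g_scale c x \<in> g_carrier" if "x \<in> g_carrier" for x :: "'a g_elem" and c
    using that by (cases x) (simp add: g_carrier_iff S8.tri_tri_scale S2.tri_tri_scale g_scale_def)
  show "0 \<in> (g_carrier :: 'a g_elem set)"
    by (simp add: zero_prod_def g_carrier_iff S8.tri_zero S2.tri_zero)
  show 3: "- x \<in> g_carrier" if "x \<in> g_carrier" for x :: "'a g_elem"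
    using 2[OF that, of "-1"] by simp
  show "x - y \<in> g_carrier" if "x \<in> g_carrier" "y \<in> g_carrier" for x y :: "'a g_elem"
    using 1[OF that(1) 3[OF that(2)]] by simp
qed

lemma g_subspace: "g.subspace (g_carrier :: 'a::field_char_0 g_elem set)"
  by (intro g.subspaceI g_carrier_closed)

lemma iota_add: "iota i (v + w) = iota i v + iota i (w :: 'a::field tens)"
  by (auto simp: iota_def)

lemma iota_minus: "iota i (- v) = - iota i (v :: 'a::field tens)"
  by (auto simp: iota_def)

lemma iota_diff: "iota i (v - w) = iota i v - iota i (w :: 'a::field tens)"
  by (auto simp: iota_def)

lemma iota_zero: "iota i (0 :: 'a::field tens) = 0"
  by (auto simp: iota_def zero_prod_def)

lemma iota_scale: "g_scale c (iota i v) = iota i (tens_scale c (v :: 'a::field_char_0 tens))"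
  by (auto simp: iota_def g_scale_def S8.theta_tri_scale_linear S2.theta_tri_scale_linear
      fun_eq_iff zero_prod_def[symmetric])

lemma iota_carrier [simp]: "iota i v \<in> (g_carrier :: 'a::field_char_0 g_elem set)"
  by (simp add: iota_def g_carrier_iff S8.tri_zero S2.tri_zero)

lemma g_elem_eq:
  "(d, d', v) = (d, 0, 0) + (0, d', 0) + iota 0 (v 0) + iota 1 (v 1) + iota 2 (v 2 :: 'a::field
      tens)"
proof -
  have "v j = 0 j + 0 j + (if j = 0 then v 0 else 0) + (if j = 1 then v 1 else 0) +
    (if j = 2 then v 2 else 0)" for j
    using cases_3[of j] by auto
  then show ?thesis
    unfolding iota_def add_Pair prod.inject plus_fun_def by (intro conjI ext) simp_all
qed

lemma g_induct [consumes 1, case_names add tri8 tri2 iota]: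
  fixes z :: "'a::field_char_0 g_elem"
  assumes "z \<in> g_carrier"
    and add: "\<And>x y. x \<in> g_carrier \<Longrightarrow> y \<in> g_carrier \<Longrightarrow> P x \<Longrightarrow> P y \<Longrightarrow> P (x + y)"
    and 8: "\<And>d. d \<in> tri8 \<Longrightarrow> P (d, 0, 0)" and 2: "\<And>d'. d' \<in> tri2 \<Longrightarrow> P (0, d', 0)"
    and iota: "\<And>i x x'. P (iota i (tensor x x'))"
  shows "P z"
proof -
  obtain d d' v where z: "z = (d, d', v)" by (cases z)
  have mem: "d \<in> tri8" "d' \<in> tri2" using assms(1) by (simp_all add: z g_carrier_iff)
  have i: "P (iota i w)" for i w
    by (induction w rule: tens_induct) (simp_all add: iota iota_add add)
  show ?thesis
    unfolding z g_elem_eq[of d d' v]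
    by (intro add g_carrier_closed iota_carrier i 8 2 mem)
      (simp_all add: g_carrier_iff mem S8.tri_zero S2.tri_zero)
qed

section \<open>Brackets of generators\<close>

lemma tri_bracket_zero [simp]:
  "d \<in> tri8 \<Longrightarrow> tri_bracket d 0 = 0" "d \<in> tri8 \<Longrightarrow> tri_bracket 0 d = 0"
  "d' \<in> tri2 \<Longrightarrow> tri_bracket d' 0 = 0" "d' \<in> tri2 \<Longrightarrow> tri_bracket 0 d' = 0"
  "tri_bracket (0 :: 3 \<Rightarrow> 'c \<Rightarrow> 'c::ab_group_add) 0 = 0"
  for d :: "3 \<Rightarrow> 'a::field_char_0 oct \<Rightarrow> 'a oct" and d' :: "3 \<Rightarrow> 'a s2 \<Rightarrow> 'a s2"
  by (simp_all add: tri_bracket_def fun_eq_iff S8.tri_linear S2.tri_linear)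

lemma g_elem_eqI:
  "d = e \<Longrightarrow> d' = e' \<Longrightarrow> v 0 = w 0 \<Longrightarrow> v 1 = w 1 \<Longrightarrow> v 2 = w 2 \<Longrightarrow>
    (d, d', v) = (e, e', w :: 3 \<Rightarrow> 'b)"
  using cases_3 unfolding prod.inject fun_eq_iff by metis

lemma if_eq_3 [simp]: "(0::3) \<noteq> 1" "(0::3) \<noteq> 2" "(1::3) \<noteq> 2" "(1::3) \<noteq> 0" "(2::3) \<noteq> 0" "(2::3) \<noteq> 1"
  by simp_all

lemma g_bracket_generators:
  fixes d e :: "3 \<Rightarrow> 'a::field_char_0 oct \<Rightarrow> 'a oct" and d' e' :: "3 \<Rightarrow> 'a s2 \<Rightarrow> 'a s2"
  assumes d: "d \<in> tri8" and e: "e \<in> tri8" and d': "d' \<in> tri2" and e': "e' \<in> tri2"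
  shows "g_bracket (d, 0, 0) (e, 0, 0) = (tri_bracket d e, 0, 0)"
    "g_bracket (d, 0, 0) (0, e', 0) = 0" "g_bracket (0, d', 0) (e, 0, 0) = 0"
    "g_bracket (0, d', 0) (0, e', 0) = (0, tri_bracket d' e', 0)"
    "g_bracket (d, 0, 0) (iota i v) = iota i (tens_map (d i) id v)"
    "g_bracket (iota i v) (d, 0, 0) = - iota i (tens_map (d i) id v)"
    "g_bracket (0, d', 0) (iota i v) = iota i (tens_map id (d' i) v)"
    "g_bracket (iota i v) (0, d', 0) = - iota i (tens_map id (d' i) v)"
    "g_bracket (d, 0, 0) (iota i (tensor x x')) = iota i (tensor (d i x) x')"
    "g_bracket (iota i (tensor x x')) (d, 0, 0) = - iota i (tensor (d i x) x')"
    "g_bracket (0, d', 0) (iota i (tensor x x')) = iota i (tensor x (d' i x'))"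
    "g_bracket (iota i (tensor x x')) (0, d', 0) = - iota i (tensor x (d' i x'))"
proof -
  note mem = tens_map_tri8_linear[OF d] tens_map_tri8_linear[OF e] tens_map_tri2_linear[OF d']
    tens_map_tri2_linear[OF e']
  have [simp]: "tens_map (\<lambda>_. 0) id = (0 :: 'a tens \<Rightarrow> 'a tens)"
    "tens_map id (\<lambda>_. 0) = (0 :: 'a tens \<Rightarrow> 'a tens)"
    by (simp_all add: fun_eq_iff tens_map_def tensor_linear)
  have zero: "(0 :: 'a g_elem) = (0, 0, 0)" by (simp add: zero_prod_def)
  have br: "g_bracket (d, 0, 0) (iota i v) = iota i (tens_map (d i) id v)"
    "g_bracket (iota i v) (d, 0, 0) = - iota i (tens_map (d i) id v)"
    "g_bracket (0, d', 0) (iota i v) = iota i (tens_map id (d' i) v)"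
    "g_bracket (iota i v) (0, d', 0) = - iota i (tens_map id (d' i) v)" for v
    unfolding iota_minus[symmetric]
    by (simp_all only: g_bracket_eq iota_def) (rule g_elem_eqI; simp add: mem d d' e e')+
  then show "g_bracket (d, 0, 0) (iota i v) = iota i (tens_map (d i) id v)"
    "g_bracket (iota i v) (d, 0, 0) = - iota i (tens_map (d i) id v)"
    "g_bracket (0, d', 0) (iota i v) = iota i (tens_map id (d' i) v)"
    "g_bracket (iota i v) (0, d', 0) = - iota i (tens_map id (d' i) v)"
    by blast+
  show "g_bracket (d, 0, 0) (e, 0, 0) = (tri_bracket d e, 0, 0)"
    "g_bracket (d, 0, 0) (0, e', 0) = 0" "g_bracket (0, d', 0) (e, 0, 0) = 0"
    "g_bracket (0, d', 0) (0, e', 0) = (0, tri_bracket d' e', 0)"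
    unfolding zero
    by (simp_all only: g_bracket_eq) (rule g_elem_eqI; simp add: mem d d' e e')+
  show "g_bracket (d, 0, 0) (iota i (tensor x x')) = iota i (tensor (d i x) x')"
    "g_bracket (iota i (tensor x x')) (d, 0, 0) = - iota i (tensor (d i x) x')"
    "g_bracket (0, d', 0) (iota i (tensor x x')) = iota i (tensor x (d' i x'))"
    "g_bracket (iota i (tensor x x')) (0, d', 0) = - iota i (tensor x (d' i x'))"
    by (simp_all only: br tens_map_tri8_linear(3)[OF d] tens_map_tri2_linear(3)[OF d'])
qed

lemma g_bracket_iota_iota:
  fixes v w :: "'a::field_char_0 tens"
  shows "g_bracket (iota i v) (iota i w) = (T8 i v w, T2 i v w, 0)"
    "g_bracket (iota i v) (iota (i + 1) w) = iota (i + 2) (tens_mult v w)"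
    "g_bracket (iota i v) (iota (i + 2) w) = - iota (i + 1) (tens_mult w v)"
proof -
  have [simp]: "tens_map (\<lambda>_. 0) id = (0 :: 'a tens \<Rightarrow> 'a tens)"
    "tens_map id (\<lambda>_. 0) = (0 :: 'a tens \<Rightarrow> 'a tens)"
    by (simp_all add: fun_eq_iff tens_map_def tensor_linear)
  show "g_bracket (iota i v) (iota i w) = (T8 i v w, T2 i v w, 0)"
    "g_bracket (iota i v) (iota (i + 1) w) = iota (i + 2) (tens_mult v w)"
    "g_bracket (iota i v) (iota (i + 2) w) = - iota (i + 1) (tens_mult w v)"
    using cases_3[of i]
    unfolding iota_minus[symmetric]
    by (elim disjE; simp only: g_bracket_eq iota_def; intro g_elem_eqI; simp add: sum_UNIV_3)+
qed

lemma g_bracket_tensors: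
  fixes x y :: "'a::field_char_0 oct" and x' y' :: "'a s2"
  shows "g_bracket (iota i (tensor x x')) (iota i (tensor y y')) =
      (tri_scale oct_scale (polar s2_norm x' y') (theta_pow i (S8.t x y)), 0, 0) +
      (0, tri_scale s2_scale (polar oct_norm x y) (theta_pow i (S2.t x' y')), 0)"
    "g_bracket (iota 0 (tensor x x')) (iota 1 (tensor y y')) =
      iota 2 (tensor (S8_mult x y) (S2_mult x' y'))"
    "g_bracket (iota 1 (tensor x x')) (iota 2 (tensor y y')) =
      iota 0 (tensor (S8_mult x y) (S2_mult x' y'))"
    "g_bracket (iota 2 (tensor x x')) (iota 0 (tensor y y')) =
      iota 1 (tensor (S8_mult x y) (S2_mult x' y'))"
    "g_bracket (iota 1 (tensor x x')) (iota 0 (tensor y y')) =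
      - iota 2 (tensor (S8_mult y x) (S2_mult y' x'))"
    "g_bracket (iota 2 (tensor x x')) (iota 1 (tensor y y')) =
      - iota 0 (tensor (S8_mult y x) (S2_mult y' x'))"
    "g_bracket (iota 0 (tensor x x')) (iota 2 (tensor y y')) =
      - iota 1 (tensor (S8_mult y x) (S2_mult y' x'))"
  using g_bracket_iota_iota(1)[of i "tensor x x'" "tensor y y'"]
    g_bracket_iota_iota(2)[of 0 "tensor x x'" "tensor y y'"]
    g_bracket_iota_iota(2)[of 1 "tensor x x'" "tensor y y'"]
    g_bracket_iota_iota(2)[of 2 "tensor x x'" "tensor y y'"]
    g_bracket_iota_iota(3)[of 0 "tensor x x'" "tensor y y'"]
    g_bracket_iota_iota(3)[of 1 "tensor x x'" "tensor y y'"]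
    g_bracket_iota_iota(3)[of 2 "tensor x x'" "tensor y y'"]
  by (simp_all add: T8_tensor T2_tensor tens_mult_tensor)

section \<open>Antisymmetry, closure, and derivations coming from \<open>iota 0\<close>\<close>

context sym_comp
begin

lemma scaled_t_tri: "tri_scale s c (theta_pow i (t x y)) \<in> tri s q m"
  by (intro tri_tri_scale theta_pow_tri t_tri)

lemma t_antisym: "t y x = - t x y"
proof (intro ext)
  fix i z
  have "y \<star> z \<star> x = s (B x y) z - x \<star> z \<star> y" "x \<star> (z \<star> y) = s (B x y) z - y \<star> (z \<star> x)"
    using comp_left_eq[of y z x] comp_right_eq[of x z y] by (simp_all add: polar_commute)
  moreover have "B y x = B x y" by (rule polar_commute)
  ultimately show "t y x i z = (- t x y) i z"
    using cases_3[of i] scale_half[of "B x y" z] by (auto simp: t_simps algebra_simps)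
qed

lemma theta_tri_scale_minus:
  "theta_pow i (- d) = - theta_pow i d" "tri_scale s c (- d) = - tri_scale s c d"
  by (intro ext, simp add: tri_scale_def theta_pow_def)+

lemma tri_bracket_antisym: "tri_bracket e d = - tri_bracket d (e :: 3 \<Rightarrow> 'b \<Rightarrow> 'b)"
  by (intro ext) (simp add: tri_bracket_def)

lemma tri_bracket_scale_right:
  "d \<in> tri s q m \<Longrightarrow> tri_bracket d (tri_scale s c e) = tri_scale s c (tri_bracket d e)"
  by (intro ext) (simp add: tri_bracket_def tri_scale_def tri_linear scale_right_diff_distrib)

end

lemma g_carrier_gen [simp]:
  "d \<in> tri8 \<Longrightarrow> (d, 0, 0) \<in> g_carrier" "d' \<in> tri2 \<Longrightarrow> (0, d', 0) \<in> g_carrier"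
  for d :: "3 \<Rightarrow> 'a::field_char_0 oct \<Rightarrow> 'a oct" and d' :: "3 \<Rightarrow> 'a s2 \<Rightarrow> 'a s2"
  by (simp_all add: g_carrier_iff S8.tri_zero S2.tri_zero)

text \<open>Two distinct indices modulo 3 are consecutive in one of the two orders, so
  \<open>sym\<close> leaves only i followed by i + 1; it also transfers additivity from the first
  argument to the second.\<close>

lemma g_induct2 [consumes 2, case_names sym add tri88 tri82 tri22 tri8i tri2i same succ]:
  fixes y z :: "'a::field_char_0 g_elem"
  assumes y: "y \<in> g_carrier" and z: "z \<in> g_carrier"
    and sym: "\<And>x y. x \<in> g_carrier \<Longrightarrow> y \<in> g_carrier \<Longrightarrow> P x y \<Longrightarrow> P y x"
    and add: "\<And>x y z. x \<in> g_carrier \<Longrightarrow> y \<in> g_carrier \<Longrightarrow> z \<in> g_carrier \<Longrightarrow>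
      P x z \<Longrightarrow> P y z \<Longrightarrow> P (x + y) z"
    and 88: "\<And>d e. d \<in> tri8 \<Longrightarrow> e \<in> tri8 \<Longrightarrow> P (d, 0, 0) (e, 0, 0)"
    and 82: "\<And>d e'. d \<in> tri8 \<Longrightarrow> e' \<in> tri2 \<Longrightarrow> P (d, 0, 0) (0, e', 0)"
    and 22: "\<And>d' e'. d' \<in> tri2 \<Longrightarrow> e' \<in> tri2 \<Longrightarrow> P (0, d', 0) (0, e', 0)"
    and 8: "\<And>d i x x'. d \<in> tri8 \<Longrightarrow> P (d, 0, 0) (iota i (tensor x x'))"
    and 2: "\<And>d' i x x'. d' \<in> tri2 \<Longrightarrow> P (0, d', 0) (iota i (tensor x x'))"
    and ii: "\<And>i x x' y y'. P (iota i (tensor x x')) (iota i (tensor y y'))"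
    and ij: "\<And>i x x' y y'. P (iota i (tensor x x')) (iota (i + 1) (tensor y y'))"
  shows "P y z"
  using y z
proof (induction y arbitrary: z rule: g_induct)
  case (add x y)
  then show ?case using assms(4) by blast
next
  case (tri8 d)
  note d = g_carrier_gen(1)[OF tri8(1)]
  show ?case
    using tri8(2)
  proof (induction z rule: g_induct)
    case (add x y)
    then show ?case using assms(4)[of x y "(d, 0, 0)"] sym d g_carrier_closed(1) by blast
  qed (blast intro: 88 82 8 tri8(1))+
next
  case (tri2 d')
  note d = g_carrier_gen(2)[OF tri2(1)]
  show ?case
    using tri2(2)
  proof (induction z rule: g_induct)
    case (add x y)
    then show ?case using assms(4)[of x y "(0, d', 0)"] sym d g_carrier_closed(1) by blast
  next
    case (tri8 e)
    then show ?case using sym[OF g_carrier_gen(1) d] 82 tri2(1) by blast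
  qed (blast intro: 22 2 tri2(1))+
next
  case (iota i x x')
  show ?case
    using iota
  proof (induction z rule: g_induct)
    case (add y z)
    then show ?case using assms(4)[of y z "iota i (tensor x x')"] sym iota_carrier
        g_carrier_closed(1)
      by blast
  next
    case (tri8 d)
    then show ?case using sym[OF g_carrier_gen(1) iota_carrier] 8 by blast
  next
    case (tri2 d)
    then show ?case using sym[OF g_carrier_gen(2) iota_carrier] 2 by blast
  next
    case (iota j y y')
    have "j = i \<or> j = i + 1 \<or> i = j + 1"
      using cases_3[of i] cases_3[of j] by auto
    then show ?case
      using ii ij[of i x x' y y'] ij[of j y y' x x'] sym iota_carrier by metis
  qed
qed

lemma
  fixes x y :: "'a::field_char_0 g_elem"
  assumes "x \<in> g_carrier" "y \<in> g_carrier"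
  shows g_bracket_closed: "g_bracket x y \<in> g_carrier" and g_bracket_antisym: "g_bracket y x = -
      g_bracket x y"
proof -
  have "g_bracket x y \<in> g_carrier \<and> g_bracket y x = - g_bracket x y"
    using assms
  proof (induction x y rule: g_induct2)
    case (sym x y)
    then show ?case using g_carrier_closed(5) by fastforce
  next
    case (add x y z)
    then show ?case by (simp add: g_bracket_add g_carrier_closed)
  next
    case (tri88 d e)
    have "tri_bracket e d = - tri_bracket d e" "tri_bracket d e \<in> tri8"
      by (rule S8.tri_bracket_antisym, rule S8.tri_bracket_tri[OF tri88])
    then show ?case
      by (simp add: g_bracket_generators[OF tri88 S2.tri_zero S2.tri_zero]
          g_bracket_generators[OF tri88(2,1) S2.tri_zero S2.tri_zero])
  next
    case (tri82 d e')
    show ?case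
      by (simp add: g_bracket_generators[OF tri82(1) S8.tri_zero S2.tri_zero tri82(2)]
          g_bracket_generators[OF S8.tri_zero tri82(1) tri82(2) S2.tri_zero] g_carrier_closed)
  next
    case (tri22 d e)
    have "tri_bracket e d = - tri_bracket d e" "tri_bracket d e \<in> tri2"
      by (rule S2.tri_bracket_antisym, rule S2.tri_bracket_tri[OF tri22])
    then show ?case
      by (simp add: g_bracket_generators[OF S8.tri_zero S8.tri_zero tri22]
          g_bracket_generators[OF S8.tri_zero S8.tri_zero tri22(2,1)])
  next
    case (tri8i d i x x')
    show ?case
      by (simp add: g_bracket_generators[OF tri8i S8.tri_zero S2.tri_zero S2.tri_zero])
  next
    case (tri2i d i x x')
    show ?case
      by (simp add: g_bracket_generators[OF S8.tri_zero S8.tri_zero tri2i S2.tri_zero])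
  next
    case (same i x x' y y')
    show ?case
      unfolding g_bracket_tensors S8.t_antisym[of y x] S2.t_antisym[of y' x']
        polar_commute[of _ y x] polar_commute[of _ y' x']
      by (simp add: S8.theta_tri_scale_minus S2.theta_tri_scale_minus g_carrier_iff
          S8.scaled_t_tri S2.scaled_t_tri)
  next
    case (succ i x x' y y')
    then show ?case
      using cases_3[of i] by (auto simp: g_bracket_tensors)
  qed
  then show "g_bracket x y \<in> g_carrier" "g_bracket y x = - g_bracket x y" by auto
qed

text \<open>On \<open>iota j\<close> the two triality parts of a bracket contribute one half each of
  b b' y (x) y'; together they complete (b y - a) (x) (b' y' - a') up to a (x) a'. The composition
  identities recognise b y - a as a second double product.\<close>

lemma tens_identity:
  fixes a y :: "'a::field_char_0 oct"
  shows "tensor (oct_scale b' (oct_scale (b / 2) y - a)) y' +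
      tensor y (s2_scale b (s2_scale (b' / 2) y' - a')) =
    tensor (oct_scale b y - a) (s2_scale b' y' - a') - tensor a a'"
proof -
  have "tensor y (s2_scale (b * b') y') =
      tensor y (s2_scale (b * b' / 2) y') + tensor y (s2_scale (b * b' / 2) y')"
    by (simp add: tensor_linear(2)[symmetric] s2.scale_left_distrib[symmetric])
  then show ?thesis
    by (simp add: tensor_linear s2.scale_right_diff_distrib oct.scale_right_diff_distrib
        algebra_simps)
qed

lemma g_bracket_same_iota:
  fixes x y z :: "'a::field_char_0 oct" and x' y' z' :: "'a s2"
  shows "g_bracket (g_bracket (iota i (tensor x x')) (iota i (tensor y y'))) (iota j (tensor z
      z')) =
    iota j (tensor (oct_scale (polar s2_norm x' y') (S8.t x y (j - i) z)) z' +
            tensor z (s2_scale (polar oct_norm x y) (S2.t x' y' (j - i) z')))"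
    "g_bracket (iota j (tensor z z')) (g_bracket (iota i (tensor x x')) (iota i (tensor y y'))) =
    - iota j (tensor (oct_scale (polar s2_norm x' y') (S8.t x y (j - i) z)) z' +
            tensor z (s2_scale (polar oct_norm x y) (S2.t x' y' (j - i) z')))"
proof -
  have mem: "tri_scale oct_scale c (theta_pow i (S8.t x y)) \<in> tri8"
    "tri_scale s2_scale c (theta_pow i (S2.t x' y')) \<in> tri2" for c
    by (rule S8.scaled_t_tri S2.scaled_t_tri)+
  show 1: "g_bracket (g_bracket (iota i (tensor x x')) (iota i (tensor y y'))) (iota j (tensor z
      z')) =
    iota j (tensor (oct_scale (polar s2_norm x' y') (S8.t x y (j - i) z)) z' +
            tensor z (s2_scale (polar oct_norm x y) (S2.t x' y' (j - i) z')))"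
    unfolding g_bracket_tensors
      g_bracket_add(1)[OF g_carrier_gen(1)[OF mem(1)] g_carrier_gen(2)[OF mem(2)] iota_carrier]
      g_bracket_generators(9)[OF mem(1) S8.tri_zero S2.tri_zero S2.tri_zero]
      g_bracket_generators(11)[OF S8.tri_zero S8.tri_zero mem(2) S2.tri_zero]
    by (simp add: iota_add tri_scale_def theta_pow_def)
  show "g_bracket (iota j (tensor z z')) (g_bracket (iota i (tensor x x')) (iota i (tensor y y'))) =
    - iota j (tensor (oct_scale (polar s2_norm x' y') (S8.t x y (j - i) z)) z' +
            tensor z (s2_scale (polar oct_norm x y) (S2.t x' y' (j - i) z')))"
    unfolding 1[symmetric] by (rule g_bracket_antisym) (simp_all add: g_bracket_closed)
qed

text \<open>The Jacobi identity is only needed when one of the three elements lies in \<open>\<iota>\<^sub>0\<close>.\<close>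

lemma ad_iota0_derivation:
  fixes y z :: "'a::field_char_0 g_elem" and u :: "'a oct" and u' :: "'a s2"
  defines "X \<equiv> iota 0 (tensor u u')"
  assumes "y \<in> g_carrier" "z \<in> g_carrier"
  shows "g_bracket X (g_bracket y z) =
    g_bracket (g_bracket X y) z + g_bracket y (g_bracket X z)"
  using assms(2,3)
proof (induction y z rule: g_induct2)
  have X: "X \<in> g_carrier" by (simp add: X_def)
  note br8 = g_bracket_generators[OF _ S8.tri_zero S2.tri_zero S2.tri_zero]
    and br2 = g_bracket_generators[OF S8.tri_zero S8.tri_zero _ S2.tri_zero]
  note minus = g_bracket_scale[where c = "-1", simplified]
  {
    case (sym x y)
    have mem: "g_bracket X x \<in> g_carrier" "g_bracket X y \<in> g_carrier" "g_bracket x y \<in> g_carrier"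
      using sym X by (simp_all add: g_bracket_closed)
    have "g_bracket X (g_bracket y x) = - g_bracket X (g_bracket x y)"
      unfolding g_bracket_antisym[OF sym(1,2)] by (rule minus(2)[OF X mem(3)])
    then show ?case
      unfolding sym(3) g_bracket_antisym[OF sym(1) mem(2)] g_bracket_antisym[OF mem(1) sym(2)]
      by simp
  next
    case (add x y z)
    have mem: "g_bracket X x \<in> g_carrier" "g_bracket X y \<in> g_carrier" "g_bracket X z \<in> g_carrier"
      "g_bracket x z \<in> g_carrier" "g_bracket y z \<in> g_carrier"
      using add X by (simp_all add: g_bracket_closed)
    show ?case
      unfolding g_bracket_add(1)[OF add(1-3)] g_bracket_add(2)[OF mem(4,5) X]
        g_bracket_add(2)[OF add(1,2) X] g_bracket_add(1)[OF mem(1,2) add(3)]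
        g_bracket_add(1)[OF add(1,2) mem(3)] add(4,5)
      by (simp add: algebra_simps)
  next
    case (tri88 d e)
    have de: "tri_bracket d e \<in> tri8" by (rule S8.tri_bracket_tri[OF tri88])
    have "tri_bracket d e 0 u = d 0 (e 0 u) - e 0 (d 0 u)" by (simp add: tri_bracket_def)
    then show ?case
      unfolding X_def
        g_bracket_generators(1)[OF tri88 S2.tri_zero S2.tri_zero]
      by (simp add: tri88 de br8(9,10) minus tensor_linear iota_diff)
  next
    case (tri82 d e')
    have 0: "g_bracket X 0 = 0"
      using g_bracket_scale(2)[OF X X, of 0] by simp
    show ?case
      unfolding g_bracket_generators(2)[OF tri82(1) S8.tri_zero S2.tri_zero tri82(2)] 0
      unfolding X_def
      by (simp add: tri82 br8(9,10) br2(11,12) minus)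
  next
    case (tri22 d e)
    have de: "tri_bracket d e \<in> tri2" by (rule S2.tri_bracket_tri[OF tri22])
    have "tri_bracket d e 0 u' = d 0 (e 0 u') - e 0 (d 0 u')" by (simp add: tri_bracket_def)
    then show ?case
      unfolding X_def g_bracket_generators(4)[OF S8.tri_zero S8.tri_zero tri22]
      by (simp add: tri22 de br2(11,12) minus tensor_linear iota_diff)
  next
    case (tri8i d i x x')
    note d = tri8i and lin = S8.triD(2)[OF tri8i]
    have 0: ?case if "i = 0"
    proof -
      have b: "g_bracket (d, 0, 0) (tri_scale oct_scale c (S8.t u x), 0, 0) =
        (tri_scale oct_scale c (S8.t (d 0 u) x), 0, 0) +
        (tri_scale oct_scale c (S8.t u (d 0 x)), 0, 0)" for c
        unfolding g_bracket_generators(1)[OF d S8.tri_tri_scale[OF S8.t_tri] S2.tri_zero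
            S2.tri_zero]
          S8.tri_bracket_scale_right[OF d]
        using S8.tri_bracket_theta_t[OF d, of 0 u x]
        by (simp add: theta_pow_def S8.theta_tri_scale_linear)
      have c: "g_bracket (d, 0, 0) (0, tri_scale s2_scale c (S2.t u' x'), 0) = 0" for c
        by (rule g_bracket_generators(2)[OF d S8.tri_zero S2.tri_zero S2.tri_tri_scale[OF
            S2.t_tri]])
      have [simp]: "theta_pow 0 e = e" for e :: "3 \<Rightarrow> 'c" by (simp add: theta_pow_def)
      have sk: "polar oct_norm (d 0 u) x = - polar oct_norm u (d 0 x)"
        by (rule S8.tri_linear(6)[OF d])
      have e: "tri_scale s2_scale (- c) (S2.t u' x') = - tri_scale s2_scale c (S2.t u' x')" for c
        by (simp add: tri_scale_def fun_eq_iff)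
      show ?thesis
        unfolding that X_def br8(9)[OF d] br8(10)[OF d] minus(1)[OF iota_carrier iota_carrier]
          g_bracket_tensors
        unfolding g_bracket_add(2)[OF g_carrier_gen(1)[OF S8.scaled_t_tri]
            g_carrier_gen(2)[OF S2.scaled_t_tri] g_carrier_gen(1)[OF d]]
        by (simp add: b c sk e)
    qed
    \<comment> \<open>With X in \<open>iota 0\<close> and the other tensor in \<open>iota 1\<close>
      all brackets land in \<open>iota 2\<close>, hence the Leibniz rule at index 2.\<close>
    have 1: ?case if "i = 1"
      using lin[of 2 u x] unfolding that X_def
      by (simp add: d br8(9,10) minus g_bracket_tensors tensor_linear iota_add)
    have 2: ?case if "i = 2"
      using lin[of 1 x u] unfolding that X_def
      by (simp add: d br8(9,10) minus g_bracket_tensors tensor_linear iota_add)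
    show ?case using cases_3[of i] 0 1 2 by blast
  next
    case (tri2i d i x x')
    note d = tri2i and lin = S2.triD(2)[OF tri2i]
    have 0: ?case if "i = 0"
    proof -
      have b: "g_bracket (0, d, 0) (0, tri_scale s2_scale c (S2.t u' x'), 0) =
        (0, tri_scale s2_scale c (S2.t (d 0 u') x'), 0) +
        (0, tri_scale s2_scale c (S2.t u' (d 0 x')), 0)" for c
        unfolding g_bracket_generators(4)[OF S8.tri_zero S8.tri_zero d S2.tri_tri_scale[OF
            S2.t_tri]]
          S2.tri_bracket_scale_right[OF d]
        using S2.tri_bracket_theta_t[OF d, of 0 u' x']
        by (simp add: theta_pow_def S2.theta_tri_scale_linear)
      have c: "g_bracket (0, d, 0) (tri_scale oct_scale c (S8.t u x), 0, 0) = 0" for c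
        by (rule g_bracket_generators(3)[OF S8.tri_zero S8.tri_tri_scale[OF S8.t_tri] d
            S2.tri_zero])
      have [simp]: "theta_pow 0 e = e" for e :: "3 \<Rightarrow> 'c" by (simp add: theta_pow_def)
      have sk: "polar s2_norm (d 0 u') x' = - polar s2_norm u' (d 0 x')"
        by (rule S2.tri_linear(6)[OF d])
      have e: "tri_scale oct_scale (- c) (S8.t u x) = - tri_scale oct_scale c (S8.t u x)" for c
        by (simp add: tri_scale_def fun_eq_iff)
      show ?thesis
        unfolding that X_def br2(11)[OF d] br2(12)[OF d] minus(1)[OF iota_carrier iota_carrier]
          g_bracket_tensors
        unfolding g_bracket_add(2)[OF g_carrier_gen(1)[OF S8.scaled_t_tri]
            g_carrier_gen(2)[OF S2.scaled_t_tri] g_carrier_gen(2)[OF d]]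
        by (simp add: b c sk e)
    qed
    have 1: ?case if "i = 1"
      using lin[of 2 u' x'] unfolding that X_def
      by (simp add: d br2(11,12) minus g_bracket_tensors tensor_linear iota_add)
    have 2: ?case if "i = 2"
      using lin[of 1 x' u'] unfolding that X_def
      by (simp add: d br2(11,12) minus g_bracket_tensors tensor_linear iota_add)
    show ?case using cases_3[of i] 0 1 2 by blast
  next
    case (same i x x' y y')
    note com = polar_commute[of oct_norm y x] polar_commute[of s2_norm y' x']
    have 0: ?case if "i = 0"
      unfolding that X_def g_bracket_same_iota
      by (simp add: S8.t_simps S2.t_simps com polar_commute[of _ x u] polar_commute[of _ x' u']
          polar_commute[of _ y u] polar_commute[of _ y' u']
          oct.scale_right_diff_distrib s2.scale_right_diff_distrib tensor_linear iota_add iota_diff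
          algebra_simps)
    \<comment> \<open>Here u and u' take the place of y and y' in \<open>tens_identity\<close>, and
      \<open>comp_right_eq\<close> turns q(x,y) u - x*(u*y) into y*(u*x).\<close>
    have 1: ?case if "i = 1"
      unfolding that X_def g_bracket_same_iota unfolding g_bracket_tensors
        minus(1)[OF iota_carrier iota_carrier] minus(2)[OF iota_carrier iota_carrier]
      using tens_identity[of "polar s2_norm x' y'" "polar oct_norm x y" u "S8_mult x (S8_mult u
          y)" u'
          "S2_mult x' (S2_mult u' y')"] S8.comp_right_eq[of y u x] S2.comp_right_eq[of y' u' x']
      by (simp add: S8.t_simps S2.t_simps com iota_diff)
    have 2: ?case if "i = 2"
      unfolding that X_def g_bracket_same_iota unfolding g_bracket_tensors
        minus(1)[OF iota_carrier iota_carrier] minus(2)[OF iota_carrier iota_carrier]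
      using tens_identity[of "polar s2_norm x' y'" "polar oct_norm x y" u "S8_mult (S8_mult y u)
          x" u'
          "S2_mult (S2_mult y' u') x'"] S8.comp_left_eq[of x u y] S2.comp_left_eq[of x' u' y']
      by (simp add: S8.t_simps S2.t_simps com iota_diff)
    show ?case using cases_3[of i] 0 1 2 by blast
  next
    case (succ i x x' y y')
    have 0: ?case if "i = 0"
      unfolding that X_def add_0 g_bracket_same_iota unfolding g_bracket_tensors
        minus(1)[OF iota_carrier iota_carrier] minus(2)[OF iota_carrier iota_carrier]
      using tens_identity[of "polar s2_norm u' x'" "polar oct_norm u x" y "S8_mult (S8_mult x y)
          u" y'
          "S2_mult (S2_mult x' y') u'"] S8.comp_left_eq[of u y x] S2.comp_left_eq[of u' y' x']
      by (simp add: S8.t_simps S2.t_simps iota_diff)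
    have 1: ?case if "i = 1"
    proof -
      \<comment> \<open>The three elements lie in three different summands, and every double bracket
        lies in the triality algebras. The cyclic relation is solved for the term produced by the
        bracket with X outside.\<close>
      have 8: "S8.t u (S8_mult x y) = theta_pow 2 (S8.t (S8_mult u x) y) -
          theta_pow 1 (S8.t x (S8_mult y u))"
        using S8.t_cyclic[of x y u]
        by (simp add: S8.t_antisym[of "S8_mult x y" u] S8.t_antisym[of "S8_mult y u" x]
            S8.theta_tri_scale_minus algebra_simps)
      have 2: "S2.t u' (S2_mult x' y') = theta_pow 2 (S2.t (S2_mult u' x') y') -
          theta_pow 1 (S2.t x' (S2_mult y' u'))"
        using S2.t_cyclic[of x' y' u']
        by (simp add: S2.t_antisym[of "S2_mult x' y'" u'] S2.t_antisym[of "S2_mult y' u'" x']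
            S2.theta_tri_scale_minus algebra_simps)
      have p: "polar oct_norm u (S8_mult x y) = polar oct_norm (S8_mult u x) y"
        "polar oct_norm x (S8_mult y u) = polar oct_norm (S8_mult u x) y"
        "polar s2_norm u' (S2_mult x' y') = polar s2_norm (S2_mult u' x') y'"
        "polar s2_norm x' (S2_mult y' u') = polar s2_norm (S2_mult u' x') y'"
        by (metis S8.polar_assoc polar_commute S2.polar_assoc)+
      have d: "tri_scale oct_scale c (d - e) = tri_scale oct_scale c d - tri_scale oct_scale c e"
        "tri_scale s2_scale c (d' - e') = tri_scale s2_scale c d' - tri_scale s2_scale c e'"
        for c :: 'a and d e d' e'
        by (simp_all add: tri_scale_def fun_eq_iff oct.scale_right_diff_distrib
            s2.scale_right_diff_distrib)
      have [simp]: "theta_pow 0 e = e" for e :: "3 \<Rightarrow> 'c" by (simp add: theta_pow_def)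
      show ?thesis
        unfolding that X_def arith_3 g_bracket_tensors
          minus(1)[OF iota_carrier iota_carrier] minus(2)[OF iota_carrier iota_carrier]
        by (simp add: 8 2 p d)
    qed
    have 2: ?case if "i = 2"
      unfolding that X_def arith_3 g_bracket_same_iota unfolding g_bracket_tensors
        minus(1)[OF iota_carrier iota_carrier] minus(2)[OF iota_carrier iota_carrier]
      using tens_identity[of "polar s2_norm u' y'" "polar oct_norm u y" x "S8_mult u (S8_mult x
          y)" x'
          "S2_mult u' (S2_mult x' y')"] S8.comp_right_eq[of y x u] S2.comp_right_eq[of y' x' u']
        polar_commute[of oct_norm y u] polar_commute[of s2_norm y' u']
      by (simp add: S8.t_simps S2.t_simps iota_diff)
    show ?case using cases_3[of i] 0 1 2 by blast
  }
qed

section \<open>Automorphisms from related triples\<close>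

definition tri_conj :: "(3 \<Rightarrow> 'b \<Rightarrow> 'b) \<Rightarrow> (3 \<Rightarrow> 'b \<Rightarrow> 'b) \<Rightarrow> 3 \<Rightarrow> 'b \<Rightarrow> 'b" where
  "tri_conj a d = (\<lambda>i. a i \<circ> d i \<circ> inv_into UNIV (a i))"

context sym_comp
begin

text \<open>The group counterpart of \<open>tri\<close>: related triples of isometries, with the
  triality rule imposed at all three indices. It acts on \<open>tri\<close> by conjugation.\<close>

definition Tri :: "(3 \<Rightarrow> 'b \<Rightarrow> 'b) set" where
  "Tri = {a. \<forall>i. bij (a i) \<and> (\<forall>x y. a i (x + y) = a i x + a i y) \<and>
     (\<forall>c x. a i (s c x) = s c (a i x)) \<and> (\<forall>x y. B (a i x) (a i y) = B x y) \<and>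
     (\<forall>x y. a i (x \<star> y) = a (i + 1) x \<star> a (i + 2) y)}"

lemma TriD:
  assumes "a \<in> Tri"
  shows "bij (a i)" "a i (x + y) = a i x + a i y" "a i (s c x) = s c (a i x)"
    "B (a i x) (a i y) = B x y" "a i (x \<star> y) = a (i + 1) x \<star> a (i + 2) y"
    "inv_into UNIV (a i) (a i x) = x" "a i (inv_into UNIV (a i) x) = x"
    "a i (x - y) = a i x - a i y" "a i 0 = 0" "a i (- x) = - a i x"
proof -
  show *: "bij (a i)" "a i (x + y) = a i x + a i y" "a i (s c x) = s c (a i x)"
    "B (a i x) (a i y) = B x y" "a i (x \<star> y) = a (i + 1) x \<star> a (i + 2) y" for x y c
    using assms unfolding Tri_def by blast+
  show "inv_into UNIV (a i) (a i x) = x" "a i (inv_into UNIV (a i) x) = x"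
    using *(1) by (simp_all add: bij_is_inj bij_is_surj surj_f_inv_f)
  show m: "a i (- x) = - a i x" for x using *(3)[of "-1" x] by simp
  show "a i 0 = 0" using *(3)[of 0 0] by simp
  show "a i (x - y) = a i x - a i y" using *(2)[of x "- y"] m by simp
qed

lemma Tri_inv:
  assumes "a \<in> Tri" shows "(\<lambda>i. inv_into UNIV (a i)) \<in> Tri"
proof -
  note D = TriD[OF assms]
  have eq: "inv_into UNIV (a i) x = y \<longleftrightarrow> x = a i y" for i x y using D(6,7) by metis
  have "B (inv_into UNIV (a i) x) (inv_into UNIV (a i) y) = B x y" for i x y
    using D(4)[of i "inv_into UNIV (a i) x" "inv_into UNIV (a i) y"] by (simp add: D(7))
  then show ?thesis
    unfolding Tri_def mem_Collect_eq
    by (intro allI conjI bij_imp_bij_inv D(1)) (simp_all add: eq D(2,3,5,7))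
qed

lemma Tri_comp:
  assumes "a \<in> Tri" "b \<in> Tri" shows "(\<lambda>i. a i \<circ> b i) \<in> Tri"
  unfolding Tri_def mem_Collect_eq
  by (intro allI conjI bij_comp) (simp_all add: TriD[OF assms(1)] TriD[OF assms(2)])

lemma Tri_id: "(\<lambda>i. id) \<in> Tri"
  by (simp add: Tri_def)

lemma tri_conj_tri:
  assumes a: "a \<in> Tri" and d: "d \<in> tri s q m"
  shows "tri_conj a d \<in> tri s q m"
proof (rule triI)
  note D = TriD[OF a] and I = TriD[OF Tri_inv[OF a]] and L = tri_linear[OF d]
  show "tri_conj a d i \<in> orth_Lie s q" for i
  proof (rule orth_LieI)
    fix x y
    have "B (a i (d i (inv_into UNIV (a i) x))) y = B (d i (inv_into UNIV (a i) x)) (inv_into UNIV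
        (a i) y)" for x y
      using D(4)[of i "d i (inv_into UNIV (a i) x)" "inv_into UNIV (a i) y"] by (simp add: D(7))
    then show "B (tri_conj a d i x) y = - B (tri_conj a d i y) x"
      using L(7)[of i "inv_into UNIV (a i) x" "inv_into UNIV (a i) y"] by (simp add: tri_conj_def)
  qed (simp_all add: tri_conj_def D(2,3) I(2,3) L(1,5))
  show "tri_conj a d 0 (x \<star> y) = tri_conj a d 1 x \<star> y + x \<star> tri_conj a d 2 y" for x y
    using I(5)[of 0 x y]
    by (simp add: tri_conj_def triD(2)[OF d] D(2,5,7))
qed

lemma tri_conj_linear:
  assumes a: "a \<in> Tri"
  shows "tri_conj a (d + e) = tri_conj a d + tri_conj a e"
    "tri_conj a (tri_scale s c d) = tri_scale s c (tri_conj a d)"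
    "tri_conj a 0 = 0"
    "tri_conj a (tri_bracket d e) = tri_bracket (tri_conj a d) (tri_conj a e)"
  by (intro ext, simp add: tri_conj_def tri_scale_def tri_bracket_def TriD[OF a])+

text \<open>A related triple preserves the form and the products from which t_{x,y} is made. After
  the shift by i it is a_i that acts on x and y; the three cases express j through i so that the
  triality rule is used at the right index.\<close>

lemma tri_conj_t:
  assumes a: "a \<in> Tri"
  shows "tri_conj a (theta_pow i (t x y)) = theta_pow i (t (a i x) (a i y))"
proof (intro ext)
  note D = TriD[OF a]
  fix j z
  have B: "B (a i x) z = B x (inv_into UNIV (a i) z)" for x z
    using D(4)[of i x "inv_into UNIV (a i) z"] by (simp add: D(7))
  have "a j (t x y (j - i) (inv_into UNIV (a j) z)) = t (a i x) (a i y) (j - i) z"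
    using cases_3[of "j - i"]
  proof (elim disjE)
    assume "j - i = 0"
    then have "j = i" by simp
    then show ?thesis by (simp add: t_simps D(3,8) B)
  next
    assume ji: "j - i = 1"
    then have "j = i + 1" by (simp add: algebra_simps)
    then have "j + 1 = i + 2" "j + 2 = i" by (simp_all add: add.assoc)
    then show ?thesis
      using D(5)[of j "y \<star> inv_into UNIV (a j) z" x] D(5)[of "j + 1" y "inv_into UNIV (a j) z"] \<open>j
          = i + 1\<close>
      by (simp add: t_simps ji D(3,4,7,8) add.assoc)
  next
    assume ji: "j - i = 2"
    then have "j = i + 2" by (simp add: algebra_simps)
    then have "j + 1 = i" "j + 2 = i + 1" by (simp_all add: add.assoc)
    then show ?thesis
      using D(5)[of j x "inv_into UNIV (a j) z \<star> y"] D(5)[of "j + 2" "inv_into UNIV (a j) z" y] \<open>j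
          = i + 2\<close>
      by (simp add: t_simps ji D(3,4,7,8) add.assoc)
  qed
  then show "tri_conj a (theta_pow i (t x y)) j z = theta_pow i (t (a i x) (a i y)) j z"
    by (simp add: tri_conj_def theta_pow_def)
qed

lemma tri_conj_comp:
  assumes "a \<in> Tri" "b \<in> Tri"
  shows "tri_conj a (tri_conj b d) = tri_conj (\<lambda>i. a i \<circ> b i) d"
  using TriD(1)[OF assms(1)] TriD(1)[OF assms(2)]
  by (simp add: tri_conj_def o_inv_distrib bij_is_inj bij_is_surj fun_eq_iff)

end

definition g_map :: "(3 \<Rightarrow> 'a::field oct \<Rightarrow> 'a oct) \<Rightarrow> (3 \<Rightarrow> 'a s2 \<Rightarrow> 'a s2) \<Rightarrow> 'a g_elem \<Rightarrow> 'a g_elem"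
  where "g_map a b = (\<lambda>(d, d', v). (tri_conj a d, tri_conj b d', \<lambda>i. tens_map (a i) (b i) (v i)))"

lemma g_ext_eq_g_map: "g_ext f f' = g_map (\<lambda>_. f) (\<lambda>_. f')"
  by (simp add: g_ext_def g_map_def tri_conj_def fun_eq_iff)

locale related_triples =
  fixes a :: "3 \<Rightarrow> 'a::field_char_0 oct \<Rightarrow> 'a oct" and b :: "3 \<Rightarrow> 'a s2 \<Rightarrow> 'a s2"
  assumes a: "a \<in> S8.Tri" and b: "b \<in> S2.Tri"
begin

lemma tens_map_linear:
  "tens_map (a i) (b i) (v + w) = tens_map (a i) (b i) v + tens_map (a i) (b i) w"
  "tens_map (a i) (b i) (tensor x x') = tensor (a i x) (b i x')"
  "tens_map (a i) (b i) (tens_scale c v) = tens_scale c (tens_map (a i) (b i) v)"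
  "tens_map (a i) (b i) 0 = 0"
proof -
  note A = S8.TriD[OF a] and B = S2.TriD[OF b]
  show 1: "tens_map (a i) (b i) (v + w) = tens_map (a i) (b i) v + tens_map (a i) (b i) w" for v w
    by (rule tens_map_add) (rule A)
  show "tens_map (a i) (b i) (tensor x x') = tensor (a i x) (b i x')"
    by (rule tens_map_tensor) (rule A B)+
  show "tens_map (a i) (b i) (tens_scale c v) = tens_scale c (tens_map (a i) (b i) v)"
    by (simp add: tens_map_def A tensor_def oct.scale_right_distrib mult.commute)
  show "tens_map (a i) (b i) 0 = 0" by (rule add_imp_zero) (rule 1)
qed

lemma g_map_add: "g_map a b (x + y) = g_map a b x + g_map a b y"
  by (cases x; cases y)
    (simp add: g_map_def S8.tri_conj_linear[OF a] S2.tri_conj_linear[OF b] tens_map_linear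
        fun_eq_iff)

lemma g_map_scale: "g_map a b (g_scale c x) = g_scale c (g_map a b x)"
  by (cases x) (simp add: g_map_def S8.tri_conj_linear[OF a] S2.tri_conj_linear[OF b]
      tens_map_linear g_scale_def)

lemma g_map_minus: "g_map a b (- x) = - g_map a b x"
  using g_map_scale[of "-1" x] by simp

lemma g_map_zero: "g_map a b 0 = 0"
  using g_map_scale[of 0 0] by simp

lemma g_map_carrier: "x \<in> g_carrier \<Longrightarrow> g_map a b x \<in> g_carrier"
  by (cases x) (simp add: g_map_def g_carrier_iff S8.tri_conj_tri[OF a] S2.tri_conj_tri[OF b])

lemma g_map_generators:
  "g_map a b (d, 0, 0) = (tri_conj a d, 0, 0)" "g_map a b (0, d', 0) = (0, tri_conj b d', 0)"
  "g_map a b (iota i v) = iota i (tens_map (a i) (b i) v)"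
  "g_map a b (iota i (tensor x x')) = iota i (tensor (a i x) (b i x'))"
proof -
  show "g_map a b (iota i v) = iota i (tens_map (a i) (b i) v)" for v
    by (simp add: g_map_def iota_def S8.tri_conj_linear[OF a] S2.tri_conj_linear[OF b]
        tens_map_linear fun_eq_iff)
  then show "g_map a b (iota i (tensor x x')) = iota i (tensor (a i x) (b i x'))"
    by (simp add: tens_map_linear)
qed (simp_all add: g_map_def S8.tri_conj_linear[OF a] S2.tri_conj_linear[OF b] tens_map_linear
    fun_eq_iff)

text \<open>On pairs of generators: conjugation respects brackets of triples,
  \<open>tri_conj_t\<close> together with invariance of the forms handles two elements of one
  \<open>iota i\<close>, and the triality rule itself handles consecutive indices.\<close>

lemma g_map_bracket:
  assumes "x \<in> g_carrier" "y \<in> g_carrier"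
  shows "g_map a b (g_bracket x y) = g_bracket (g_map a b x) (g_map a b y)"
  using assms
proof (induction x y rule: g_induct2)
  note a8 = S8.tri_conj_tri[OF a] and b2 = S2.tri_conj_tri[OF b]
    and A = S8.TriD[OF a] and B = S2.TriD[OF b]
  {
    case (sym x y)
    then show ?case
      using g_bracket_antisym[OF sym(1,2)] g_bracket_antisym[OF g_map_carrier[OF sym(1)]
          g_map_carrier[OF sym(2)]]
      by (simp add: g_map_minus)
  next
    case (add x y z)
    then show ?case by (simp add: g_bracket_add g_map_add g_map_carrier)
  next
    case (tri88 d e)
    show ?case
      unfolding g_map_generators g_bracket_generators(1)[OF tri88 S2.tri_zero S2.tri_zero]
        g_bracket_generators(1)[OF tri88[THEN a8] S2.tri_zero S2.tri_zero] S8.tri_conj_linear[OF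
            a] ..
  next
    case (tri82 d e')
    show ?case
      unfolding g_map_generators g_bracket_generators(2)[OF tri82(1) S8.tri_zero S2.tri_zero
          tri82(2)]
        g_bracket_generators(2)[OF a8[OF tri82(1)] S8.tri_zero S2.tri_zero b2[OF tri82(2)]]
      by (rule g_map_zero)
  next
    case (tri22 d e)
    show ?case
      unfolding g_map_generators g_bracket_generators(4)[OF S8.tri_zero S8.tri_zero tri22]
        g_bracket_generators(4)[OF S8.tri_zero S8.tri_zero tri22[THEN b2]] S2.tri_conj_linear[OF
            b] ..
  next
    case (tri8i d i x x')
    show ?case
      unfolding g_map_generators(1,4) g_bracket_generators(9)[OF tri8i S8.tri_zero S2.tri_zero
          S2.tri_zero]
        g_bracket_generators(9)[OF a8[OF tri8i] S8.tri_zero S2.tri_zero S2.tri_zero]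
      by (simp add: tri_conj_def A)
  next
    case (tri2i d i x x')
    show ?case
      unfolding g_map_generators(2,4) g_bracket_generators(11)[OF S8.tri_zero S8.tri_zero tri2i
          S2.tri_zero]
        g_bracket_generators(11)[OF S8.tri_zero S8.tri_zero b2[OF tri2i] S2.tri_zero]
      by (simp add: tri_conj_def B)
  next
    case (same i x x' y y')
    show ?case
      unfolding g_map_generators(4) g_bracket_tensors g_map_add
      by (simp only: g_map_generators(1,2) S8.tri_conj_linear[OF a] S2.tri_conj_linear[OF b]
          S8.tri_conj_t[OF a] S2.tri_conj_t[OF b] A(4) B(4))
  next
    case (succ i x x' y y')
    then show ?case
      using cases_3[of i] A(5)[of 0 x y] A(5)[of 1 x y] A(5)[of 2 x y]
        B(5)[of 0 x' y'] B(5)[of 1 x' y'] B(5)[of 2 x' y']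
      by (auto simp: g_bracket_tensors g_map_generators(4))
  }
qed

end

lemma g_map_comp:
  assumes "related_triples a b" "related_triples c d"
  shows "g_map a b (g_map c d x) = g_map (\<lambda>i. a i \<circ> c i) (\<lambda>i. b i \<circ> d i) x"
proof -
  interpret ab: related_triples a b by fact
  interpret cd: related_triples c d by fact
  interpret abcd: related_triples "\<lambda>i. a i \<circ> c i" "\<lambda>i. b i \<circ> d i"
    by unfold_locales (rule S8.Tri_comp[OF ab.a cd.a] S2.Tri_comp[OF ab.b cd.b])+
  have "tens_map (a i) (b i) (tens_map (c i) (d i) v) = tens_map (a i \<circ> c i) (b i \<circ> d i) v" for i v
    by (induction v rule: tens_induct)
      (simp_all only: ab.tens_map_linear cd.tens_map_linear abcd.tens_map_linear, simp)
  then show ?thesis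
    by (cases x) (simp add: g_map_def S8.tri_conj_comp[OF ab.a cd.a] S2.tri_conj_comp[OF ab.b cd.b])
qed

lemma g_map_id: "g_map (\<lambda>i. id) (\<lambda>i. id) x = (x :: 'a::field_char_0 g_elem)"
proof -
  have "tens_map id id v = (v :: 'a tens)" for v
    using tens_eq[of v] by (simp add: tens_map_def)
  then show ?thesis by (cases x) (simp add: g_map_def tri_conj_def)
qed

lemma (in related_triples) g_map_bij: "bij_betw (g_map a b) g_carrier g_carrier"
proof (rule bij_betwI)
  interpret i: related_triples "\<lambda>i. inv_into UNIV (a i)" "\<lambda>i. inv_into UNIV (b i)"
    by unfold_locales (rule S8.Tri_inv[OF a] S2.Tri_inv[OF b])+
  have ab: "related_triples a b" ..
  have inv: "a i \<circ> inv_into UNIV (a i) = id" "b i \<circ> inv_into UNIV (b i) = id" "inv_into UNIV (a i)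
      \<circ> a i = id"
    "inv_into UNIV (b i) \<circ> b i = id" for i
    by (simp_all add: fun_eq_iff S8.TriD[OF a] S2.TriD[OF b])
  show "g_map a b \<in> g_carrier \<rightarrow> g_carrier"
    "g_map (\<lambda>i. inv_into UNIV (a i)) (\<lambda>i. inv_into UNIV (b i)) \<in> g_carrier \<rightarrow> g_carrier"
    by (simp_all add: g_map_carrier i.g_map_carrier)
  show "g_map (\<lambda>i. inv_into UNIV (a i)) (\<lambda>i. inv_into UNIV (b i)) (g_map a b x) = x" for x
    by (simp add: g_map_comp[OF i.related_triples_axioms ab] inv g_map_id)
  show "g_map a b (g_map (\<lambda>i. inv_into UNIV (a i)) (\<lambda>i. inv_into UNIV (b i)) x) = x" for x
    by (simp add: g_map_comp[OF ab i.related_triples_axioms] inv g_map_id)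
qed

lemma (in related_triples) g_map_automorphism:
  "restrict (g_map a b) g_carrier \<in> algebra_on.automorphisms g_carrier g_scale g_bracket"
  using g_map_bij
  by (simp add: algebra_on.automorphisms_def Bij_def g_map_add g_map_scale g_map_bracket
      g_carrier_closed g_bracket_closed)

section \<open>The multiplication table of the octonions\<close>

notation oct_mult (infixl \<open>\<odot>\<close> 70)

abbreviation oct_B where "oct_B \<equiv> polar oct_norm"

lemma cases_2: "(x :: 2) = 0 \<or> x = 1"
  using exhaust_2[of x] by auto

lemma add_self_2 [simp]: "(x :: 2) + x = 0"
  using cases_2[of x] by auto

lemma vec2_add_self [simp]: "(v :: 2 ^ 3) + v = 0"
  by (simp only: vec_eq_iff vector_add_component add_self_2 zero_index) simp

lemma neg_add_eq_0D: "- a + - b = 0 \<Longrightarrow> a = - (b :: 'b::ab_group_add)"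
  by (metis add.inverse_inverse add_eq_0_iff)

lemma neg_add_neg_eqD: "- a + - b = c \<Longrightarrow> a + b = - (c :: 'b::ab_group_add)"
  by (metis add.inverse_inverse minus_add_distrib)

lemma oct_half: "oct_scale c x = oct_scale c y \<Longrightarrow> c \<noteq> 0 \<Longrightarrow> x = y"
  by simp

section \<open>Imaginary units and the Fano plane of products\<close>

definition imag_unit :: "'a::field_char_0 oct \<Rightarrow> bool" where
  "imag_unit x \<longleftrightarrow> oct_B x oct_one = 0 \<and> x \<odot> x = - oct_one"

lemma imag_unitD:
  assumes "imag_unit x"
  shows "oct_B x oct_one = 0" "oct_conj x = - x" "x \<odot> x = - oct_one" "oct_B x x = 2"
    "x \<odot> (x \<odot> y) = - y" "(y \<odot> x) \<odot> x = - y"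
proof -
  show 0: "oct_B x oct_one = 0" and sq: "x \<odot> x = - oct_one"
    using assms by (simp_all add: imag_unit_def)
  show c: "oct_conj x = - x" by (rule oct_conj_trace_zero[OF 0])
  have "oct_B x x = oct_B (x \<odot> oct_one) x" by (simp add: oct_one_mult)
  also have "\<dots> = 2"
    unfolding oct_polar_mult_left using c sq
    by (simp add: oct_mult_linear oct_polar_one_one)
  finally show 2: "oct_B x x = 2" .
  have 3: "oct_scale 2 z = z + z" for z :: "'a oct"
    using oct.scale_left_distrib[of 1 1 z] by simp
  have "oct_scale 2 (x \<odot> (x \<odot> y)) = oct_scale 2 (- y)"
    using neg_add_neg_eqD[OF oct_left_alt[of x x y, unfolded c oct_mult_linear]]
    by (simp add: 2 3)
  then show "x \<odot> (x \<odot> y) = - y" by (rule oct_half) simp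
  have "oct_scale 2 ((y \<odot> x) \<odot> x) = oct_scale 2 (- y)"
    using neg_add_neg_eqD[OF oct_right_alt[of y x x, unfolded c oct_mult_linear]]
    by (simp add: 2 3)
  then show "(y \<odot> x) \<odot> x = - y" by (rule oct_half) simp
qed

lemma imag_anticommute:
  assumes x: "imag_unit x" and y: "imag_unit y" and o: "oct_B x y = 0"
  shows "y \<odot> x = - (x \<odot> y)"
proof -
  have "oct_B (x \<odot> y) oct_one = 0"
    unfolding oct_polar_mult_left
    by (simp add: oct_one_mult imag_unitD(2)[OF x] S8.B_linear polar_commute[of _ y x] o)
  then have "oct_conj (x \<odot> y) = - (x \<odot> y)" by (rule oct_conj_trace_zero)
  then show ?thesis
    by (simp add: oct_conj_mult imag_unitD(2)[OF x] imag_unitD(2)[OF y] oct_mult_linear)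
qed

lemma imag_anti_alt:
  assumes x: "imag_unit x" and y: "imag_unit y" and o: "oct_B x y = 0"
  shows "x \<odot> (y \<odot> z) = - (y \<odot> (x \<odot> z))" "(z \<odot> x) \<odot> y = - ((z \<odot> y) \<odot> x)"
proof -
  note c = imag_unitD(2)[OF x] imag_unitD(2)[OF y] o oct_mult_linear oct.scale_zero_left
  show "x \<odot> (y \<odot> z) = - (y \<odot> (x \<odot> z))"
    by (rule neg_add_eq_0D[OF oct_left_alt[of x y z, unfolded c]])
  show "(z \<odot> x) \<odot> y = - ((z \<odot> y) \<odot> x)"
    by (rule neg_add_eq_0D[OF oct_right_alt[of z x y, unfolded c]])
qed

text \<open>Two orthogonal imaginary units generate a copy of the quaternions: moving x or y across
  the form gives trace zero and orthogonality of the product, and \<open>oct_left_alt\<close> gives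
  its square.\<close>

lemma imag_line:
  assumes x: "imag_unit x" and y: "imag_unit y" and o: "oct_B x y = 0" and z: "x \<odot> y = z"
  shows "imag_unit z" "oct_B x z = 0" "oct_B y z = 0"
    "y \<odot> z = x" "z \<odot> x = y" "y \<odot> x = - z" "z \<odot> y = - x" "x \<odot> z = - y"
proof -
  note X = imag_unitD[OF x] and Y = imag_unitD[OF y]
  have B: "oct_B z w = - oct_B y (x \<odot> w)" "oct_B z w = - oct_B x (w \<odot> y)" for w
    unfolding z[symmetric]
    by (simp add: oct_polar_mult_left[of x] X oct_mult_linear S8.B_linear,
        simp add: oct_polar_mult_right[of x] Y oct_mult_linear S8.B_linear)
  have z1: "oct_B z oct_one = 0" using B(1)[of oct_one] o
    by (simp add: oct_one_mult polar_commute)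
  show xz: "x \<odot> z = - y" unfolding z[symmetric] by (rule X)
  show zy: "z \<odot> y = - x" unfolding z[symmetric] by (rule Y)
  show "oct_B x z = 0"
    using B(1)[of x] Y(1) by (simp add: polar_commute[of _ x z] X(3) S8.B_linear)
  show "oct_B y z = 0"
    using B(2)[of y] X(1) by (simp add: polar_commute[of _ y z] Y(3) S8.B_linear)
  show yx: "y \<odot> x = - z" using imag_anticommute[OF x y o] z by simp
  have "oct_B z z = 2" using B(1)[of z] by (simp add: xz S8.B_linear Y)
  moreover have "oct_conj z = - z" by (rule oct_conj_trace_zero[OF z1])
  ultimately have "- (z \<odot> z) + - (z \<odot> z) = oct_scale 2 oct_one"
    using oct_left_alt[of z z oct_one] by (simp add: oct_one_mult oct_mult_linear)
  also have "- (z \<odot> z) + - (z \<odot> z) = oct_scale 2 (- (z \<odot> z))"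
    using oct.scale_left_distrib[of 1 1 "- (z \<odot> z)"] by simp
  finally have "- (z \<odot> z) = oct_one" by (rule oct_half) simp
  then have "z \<odot> z = - oct_one" by (simp add: minus_equation_iff)
  then show zu: "imag_unit z" using z1 by (simp add: imag_unit_def)
  show "z \<odot> x = y" using imag_anticommute[OF x zu \<open>oct_B x z = 0\<close>] xz by simp
  show "y \<odot> z = x" using imag_anticommute[OF zu y] zy \<open>oct_B y z = 0\<close>
    by (simp add: polar_commute)
qed

text \<open>The bits of v select factors of (e_1 e_2) e_3, where e_3 is \<open>e 0\<close> because 3
  = 0 in the index type. Products add the indices up to sign: this is the Z_2^3-grading of the
  octonions.\<close>

definition oct_X :: "(3 \<Rightarrow> 'a::field_char_0 oct) \<Rightarrow> 2 ^ 3 \<Rightarrow> 'a oct" where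
  "oct_X e v = (let p = (\<lambda>i. if v $ i = 0 then oct_one else e i) in (p 1 \<odot> p 2) \<odot> p 0)"

text \<open>A basic triple of the Cayley-Dickson construction: \<open>e 1\<close> and
  \<open>e 2\<close> generate quaternions and \<open>e 0\<close> doubles them.\<close>

definition oct_frame :: "(3 \<Rightarrow> 'a::field_char_0 oct) \<Rightarrow> bool" where
  "oct_frame e \<longleftrightarrow> (\<forall>i. imag_unit (e i)) \<and> (\<forall>i j. i \<noteq> j \<longrightarrow> oct_B (e i) (e j) = 0) \<and>
     oct_B (e 0) (e 1 \<odot> e 2) = 0"

lemma imag_unit_uminus: "imag_unit (- x) \<longleftrightarrow> imag_unit x"
  by (simp add: imag_unit_def S8.B_linear oct_mult_linear)

text \<open>The seven quaternion triples are the lines of the Fano plane: I, J, K, the three lines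
  through L, and three more found by anti-alternativity. \<open>imag_line\<close> completes each of
  them from a single product.\<close>

lemma oct_frame_table:
  assumes "oct_frame e"
  defines "I \<equiv> e 1" and "J \<equiv> e 2" and "L \<equiv> e 0"
  defines "K \<equiv> I \<odot> J"
  shows "imag_unit I" "imag_unit J" "imag_unit K" "imag_unit L"
    "imag_unit (I \<odot> L)" "imag_unit (J \<odot> L)" "imag_unit (K \<odot> L)"
    "J \<odot> K = I" "K \<odot> I = J" "J \<odot> I = - K" "K \<odot> J = - I" "I \<odot> K = - J"
    "L \<odot> (I \<odot> L) = I" "I \<odot> L \<odot> I = L" "L \<odot> I = - (I \<odot> L)" "I \<odot> L \<odot> L = - I" "I \<odot> (I \<odot> L) = - L"
    "L \<odot> (J \<odot> L) = J" "J \<odot> L \<odot> J = L" "L \<odot> J = - (J \<odot> L)" "J \<odot> L \<odot> L = - J" "J \<odot> (J \<odot> L) = - L"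
    "L \<odot> (K \<odot> L) = K" "K \<odot> L \<odot> K = L" "L \<odot> K = - (K \<odot> L)" "K \<odot> L \<odot> L = - K" "K \<odot> (K \<odot> L) = - L"
    "I \<odot> (J \<odot> L) = - (K \<odot> L)" "J \<odot> L \<odot> (K \<odot> L) = - I" "K \<odot> L \<odot> I = - (J \<odot> L)"
    "J \<odot> L \<odot> I = K \<odot> L" "K \<odot> L \<odot> (J \<odot> L) = I" "I \<odot> (K \<odot> L) = J \<odot> L"
    "J \<odot> (I \<odot> L) = K \<odot> L" "I \<odot> L \<odot> (K \<odot> L) = J" "K \<odot> L \<odot> J = I \<odot> L"
    "I \<odot> L \<odot> J = - (K \<odot> L)" "K \<odot> L \<odot> (I \<odot> L) = - J" "J \<odot> (K \<odot> L) = - (I \<odot> L)"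
    "I \<odot> L \<odot> (J \<odot> L) = - K" "J \<odot> L \<odot> K = - (I \<odot> L)" "K \<odot> (I \<odot> L) = - (J \<odot> L)"
    "J \<odot> L \<odot> (I \<odot> L) = K" "K \<odot> (J \<odot> L) = I \<odot> L" "I \<odot> L \<odot> K = J \<odot> L"
proof -
  have u: "imag_unit I" "imag_unit J" "imag_unit L"
    and o: "oct_B I J = 0" "oct_B I L = 0" "oct_B J L = 0" "oct_B K L = 0"
    using assms(1) unfolding oct_frame_def I_def J_def L_def K_def
    by (simp_all add: polar_commute[of _ "e 1 \<odot> e 2"])
  have IJ: "I \<odot> J = K" by (simp add: K_def)
  note K = imag_line[OF u(1,2) o(1) IJ]
  note IL = imag_line[OF u(1,3) o(2) refl] and JL = imag_line[OF u(2,3) o(3) refl]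
    and KL = imag_line[OF K(1) u(3) o(4) refl]
  \<comment> \<open>Exchanging the two left factors reduces I(LJ) to the known product of L with K =
    IJ.\<close>
  have "I \<odot> (L \<odot> J) = K \<odot> L"
    using imag_anti_alt(1)[OF u(1,3) o(2), of J] KL(6) by (simp add: K_def)
  then have 1: "I \<odot> (J \<odot> L) = - (K \<odot> L)" unfolding JL(6) by (simp add: oct_mult_linear
      minus_equation_iff)
  have "J \<odot> (L \<odot> I) = - (K \<odot> L)"
    using imag_anti_alt(1)[OF u(2,3) o(3), of I] KL(6) K(6) by (simp add: oct_mult_linear)
  then have 2: "J \<odot> (I \<odot> L) = K \<odot> L" unfolding IL(6) by (simp add: oct_mult_linear)
  have 3: "I \<odot> L \<odot> (J \<odot> L) = - K"
    using imag_anti_alt(2)[OF u(3) JL(1) JL(3), of I] 1 KL(7) by (simp add: oct_mult_linear)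
  have o1: "oct_B I (J \<odot> L) = 0" "oct_B J (I \<odot> L) = 0"
    using o(4) K(6)
    by (simp_all add: polar_commute[of _ I] polar_commute[of _ J] oct_polar_mult_left[of J L]
        oct_polar_mult_left[of I L] imag_unitD(2) u oct_mult_linear S8.B_linear IJ
        polar_commute[of _ L K])
  have o2: "oct_B (I \<odot> L) (J \<odot> L) = 0"
    by (simp add: oct_polar_mult_right[of I L] imag_unitD(2) u oct_mult_linear JL(7) o)
  note l1 = imag_line[OF u(1) JL(1) o1(1) 1] and l2 = imag_line[OF u(2) IL(1) o1(2) 2]
    and l3 = imag_line[OF IL(1) JL(1) o2 3]
  show "imag_unit I" "imag_unit J" "imag_unit K" "imag_unit L"
    "imag_unit (I \<odot> L)" "imag_unit (J \<odot> L)" "imag_unit (K \<odot> L)" by fact+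
  show "J \<odot> K = I" "K \<odot> I = J" "J \<odot> I = - K" "K \<odot> J = - I" "I \<odot> K = - J"
    "L \<odot> (I \<odot> L) = I" "I \<odot> L \<odot> I = L" "L \<odot> I = - (I \<odot> L)" "I \<odot> L \<odot> L = - I" "I \<odot> (I \<odot> L) = - L"
    "L \<odot> (J \<odot> L) = J" "J \<odot> L \<odot> J = L" "L \<odot> J = - (J \<odot> L)" "J \<odot> L \<odot> L = - J" "J \<odot> (J \<odot> L) = - L"
    "L \<odot> (K \<odot> L) = K" "K \<odot> L \<odot> K = L" "L \<odot> K = - (K \<odot> L)" "K \<odot> L \<odot> L = - K" "K \<odot> (K \<odot> L) = - L"
    by fact+
  show "I \<odot> (J \<odot> L) = - (K \<odot> L)" "J \<odot> L \<odot> (K \<odot> L) = - I" "K \<odot> L \<odot> I = - (J \<odot> L)"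
    "J \<odot> L \<odot> I = K \<odot> L" "K \<odot> L \<odot> (J \<odot> L) = I" "I \<odot> (K \<odot> L) = J \<odot> L"
    by (rule 1, insert l1(4), simp add: oct_mult_linear minus_equation_iff[of _ I],
        insert l1(5), simp add: oct_mult_linear minus_equation_iff[of _ "J \<odot> L"],
        insert l1(6), simp, insert l1(7), simp add: oct_mult_linear,
        insert l1(8), simp add: oct_mult_linear)
  show "J \<odot> (I \<odot> L) = K \<odot> L" "I \<odot> L \<odot> (K \<odot> L) = J" "K \<odot> L \<odot> J = I \<odot> L"
    "I \<odot> L \<odot> J = - (K \<odot> L)" "K \<odot> L \<odot> (I \<odot> L) = - J" "J \<odot> (K \<odot> L) = - (I \<odot> L)"
    by fact+
  show "I \<odot> L \<odot> (J \<odot> L) = - K" "J \<odot> L \<odot> K = - (I \<odot> L)" "K \<odot> (I \<odot> L) = - (J \<odot> L)"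
    "J \<odot> L \<odot> (I \<odot> L) = K" "K \<odot> (J \<odot> L) = I \<odot> L" "I \<odot> L \<odot> K = J \<odot> L"
    by (rule 3, insert l3(4), simp add: oct_mult_linear minus_equation_iff[of _ "I \<odot> L"],
        insert l3(5), simp add: oct_mult_linear minus_equation_iff[of _ "J \<odot> L"],
        insert l3(6), simp, insert l3(7), simp add: oct_mult_linear,
        insert l3(8), simp add: oct_mult_linear)
qed

text \<open>The quantifier over frames stands inside each disjunct, so the sign depends on u and v
  alone. The proof runs through the 64 pairs of bit vectors.\<close>

lemma oct_X_table:
  "(\<forall>e :: 3 \<Rightarrow> 'a::field_char_0 oct. oct_frame e \<longrightarrow> oct_X e u \<odot> oct_X e v = oct_X e (u + v)) \<or>
   (\<forall>e :: 3 \<Rightarrow> 'a oct. oct_frame e \<longrightarrow> oct_X e u \<odot> oct_X e v = - oct_X e (u + v))"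
proof -
  have one: "(1::2) + 1 = 0" by simp
  note sq = imag_unitD(3)[OF oct_frame_table(1)] imag_unitD(3)[OF oct_frame_table(2)]
    imag_unitD(3)[OF oct_frame_table(3)] imag_unitD(3)[OF oct_frame_table(4)]
    imag_unitD(3)[OF oct_frame_table(5)] imag_unitD(3)[OF oct_frame_table(6)]
    imag_unitD(3)[OF oct_frame_table(7)]
  show ?thesis
    unfolding oct_X_def Let_def vector_add_component
    using cases_2[of "u $ 0"] cases_2[of "u $ 1"] cases_2[of "u $ 2"]
      cases_2[of "v $ 0"] cases_2[of "v $ 1"] cases_2[of "v $ 2"]
    by (elim disjE; simp add: oct_one_mult sq oct_frame_table(8-))
qed

definition oct_eps :: "2 ^ 3 \<Rightarrow> 2 ^ 3 \<Rightarrow> 'a::field_char_0" where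
  "oct_eps u v = (if \<forall>e :: 3 \<Rightarrow> 'a oct. oct_frame e \<longrightarrow> oct_X e u \<odot> oct_X e v = oct_X e (u + v)
     then 1 else - 1)"

lemma oct_eps_cases: "oct_eps u v = (1 :: 'a::field_char_0) \<or> oct_eps u v = (- 1 :: 'a)"
  by (simp add: oct_eps_def)

lemma oct_eps_nonzero [simp]: "oct_eps u v \<noteq> (0 :: 'a::field_char_0)"
  using oct_eps_cases[where 'a = 'a, of u v] by auto

lemma oct_X_zero: "oct_X e 0 = oct_one"
  by (simp add: oct_X_def oct_one_mult)

lemma oct_X_axis: "oct_X e (axis i 1) = e i"
  using cases_3[of i] by (auto simp: oct_X_def oct_one_mult axis_def)

lemma vec2_add_eq_0_iff: "u + v = 0 \<longleftrightarrow> u = (v :: 2 ^ 3)"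
  by (metis add_right_cancel vec2_add_self)

lemma vec3_axis_expand:
  "v = (v $ 1) *s axis 1 1 + (v $ 2) *s axis 2 1 + (v $ 0) *s axis 0 1" for v :: "'b::comm_ring_1
      ^ 3"
  by (simp add: vec3_eq_iff axis_def)

text \<open>The coordinates of an octonion, listed by a vector of bits.\<close>

definition oct_coords :: "'a::field oct \<Rightarrow> 'a ^ (2 ^ 3)" where
  "oct_coords = (\<lambda>(a, u, v, b). \<chi> t.
     if t $ 0 = 0
     then if t $ 1 = 0 then if t $ 2 = 0 then a else u $ 0 else if t $ 2 = 0 then u $ 1 else u $ 2
     else if t $ 1 = 0 then if t $ 2 = 0 then b else v $ 0 else if t $ 2 = 0 then v $ 1 else v $ 2)"

lemma inj_oct_coords: "inj (oct_coords :: 'a::field oct \<Rightarrow> _)"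
proof (rule injI)
  fix x y :: "'a oct" assume eq: "oct_coords x = oct_coords y"
  obtain a u v b where x: "x = (a, u, v, b)" by (cases x)
  obtain a' u' v' b' where y: "y = (a', u', v', b')" by (cases y)
  define T :: "2 \<Rightarrow> 2 \<Rightarrow> 2 \<Rightarrow> 2 ^ 3" where
    "T p q r = (\<chi> i. if i = 0 then p else if i = 1 then q else r)" for p q r
  have [simp]: "T p q r $ 0 = p" "T p q r $ 1 = q" "T p q r $ 2 = r" for p q r
    by (simp_all add: T_def)
  have "oct_coords x $ T p q r = oct_coords y $ T p q r" for p q r by (simp add: eq)
  note * = this[unfolded x y oct_coords_def, simplified]
  show "x = y"
    using *[of 0 0 0] *[of 0 0 1] *[of 0 1 0] *[of 0 1 1] *[of 1 0 0] *[of 1 0 1] *[of 1 1 0] *[of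
        1 1 1]
    by (simp add: x y vec3_eq_iff)
qed

lemma oct_coords_linear:
  "oct_coords (x + y) = oct_coords x + oct_coords y"
  "oct_coords (oct_scale c x) = c *s oct_coords x"
  by (cases x; cases y; simp add: oct_coords_def oct_scale_eq vec_eq_iff)+

lemma oct_sum_rules:
  fixes f :: "'i \<Rightarrow> 'a::field_char_0 oct"
  shows "oct_B (\<Sum>i\<in>S. f i) y = (\<Sum>i\<in>S. oct_B (f i) y)"
    "oct_B y (\<Sum>i\<in>S. f i) = (\<Sum>i\<in>S. oct_B y (f i))"
  by (induction S rule: infinite_finite_induct) (simp_all add: S8.B_linear)

locale oct_basis =
  fixes e :: "3 \<Rightarrow> 'a::field_char_0 oct"
  assumes frame: "oct_frame e"
begin

abbreviation X :: "2 ^ 3 \<Rightarrow> 'a oct" where "X \<equiv> oct_X e"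

lemma X_mult: "X u \<odot> X v = oct_scale (oct_eps u v) (X (u + v))"
  using oct_X_table[where 'a = 'a, of u v] frame by (auto simp: oct_eps_def)

lemma imag_unit_X: "v \<noteq> 0 \<Longrightarrow> imag_unit (X v)"
  unfolding vec3_eq_iff oct_X_def Let_def zero_index
  using cases_2[of "v $ 0"] cases_2[of "v $ 1"] cases_2[of "v $ 2"] oct_frame_table(1-7)[OF frame]
  by (elim disjE) (simp_all add: oct_one_mult)

lemma X_conj: "oct_conj (X v) = (if v = 0 then X v else - X v)"
  using imag_unitD(2)[OF imag_unit_X] by (simp add: oct_X_zero oct_conj_one)

lemma X_orth: "oct_B (X u) (X v) = (if u = v then 2 else 0)"
proof -
  have 1: "oct_B (X u) oct_one = 0" if "u \<noteq> 0" for u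
    by (rule imag_unitD(1)[OF imag_unit_X[OF that]])
  have 2: "oct_B (X u) (X v) = 0" if "u \<noteq> v" "u \<noteq> 0"
  proof -
    have "oct_B (X u) (X v) = oct_B (oct_one \<odot> X u) (X v)" by (simp add: oct_one_mult)
    also have "\<dots> = - oct_eps v u * oct_B oct_one (X (v + u))"
      unfolding oct_polar_mult_right
      by (simp add: X_conj that oct_mult_linear S8.B_linear X_mult)
    finally show ?thesis using 1[of "v + u"] that by (simp add: vec2_add_eq_0_iff polar_commute)
  qed
  have 3: "oct_B (X u) (X u) = 2" for u
    using imag_unitD(4)[OF imag_unit_X[of u]] oct_polar_one_one
    by (cases "u = 0") (simp_all add: oct_X_zero)
  show ?thesis
  proof (cases "u = v \<or> u \<noteq> 0")
    case False
    then have "u = 0" "v \<noteq> 0" by auto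
    then show ?thesis using 1[of v] by (simp add: oct_X_zero polar_commute[of _ oct_one])
  qed (use 2 3 in auto)
qed

lemma X_nonzero: "X v \<noteq> 0"
  using X_orth[of v v] by (auto simp: S8.B_linear)

text \<open>A dimension count. Orthogonality makes the map from coefficient families to octonions
  injective; the index type \<open>2 ^ 3\<close> has 8 elements, so followed by
  \<open>oct_coords\<close> it is an injective, hence surjective, endomorphism.\<close>

lemma X_expand: "x = (\<Sum>v\<in>UNIV. oct_scale (oct_B x (X v) / 2) (X v))"
proof -
  define f :: "'a ^ (2 ^ 3) \<Rightarrow> 'a oct" where "f c = (\<Sum>v\<in>UNIV. oct_scale (c $ v) (X v))" for c
  have f_B: "oct_B (f c) (X v) = 2 * c $ v" for c v
    by (simp add: f_def oct_sum_rules S8.B_linear X_orth if_distrib cong: if_cong)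
  have add: "f (c + d) = f c + f d" for c d
    by (simp add: f_def oct.scale_left_distrib sum.distrib)
  have scale: "f (k *s c) = oct_scale k (f c)" for k c
    by (simp add: f_def oct.scale_sum_right)
  have "inj f"
  proof (rule injI)
    fix c d assume "f c = f d"
    then have "2 * c $ v = 2 * d $ v" for v using f_B by metis
    then show "c = d" by (simp add: vec_eq_iff)
  qed
  moreover have "Vector_Spaces.linear (*s) (*s) (oct_coords \<circ> f)"
    by unfold_locales
      (simp_all add: add scale oct_coords_linear vec.scale_right_distrib vec.scale_left_distrib)
  ultimately have "surj (oct_coords \<circ> f)"
    by (intro vec.linear_inj_imp_surj) (simp_all add: inj_compose inj_oct_coords)
  then obtain c where "oct_coords x = (oct_coords \<circ> f) c" by (rule surjE)
  then have "oct_coords (f c) = oct_coords x" by simp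
  then have x: "f c = x" by (rule injD[OF inj_oct_coords])
  then have cv: "c $ v = oct_B x (X v) / 2" for v using f_B[of c v] by simp
  show ?thesis by (rule x[unfolded f_def cv, symmetric])
qed

lemma X_induct:
  assumes "\<And>x y. P x \<Longrightarrow> P y \<Longrightarrow> P (x + y)" "\<And>c x. P x \<Longrightarrow> P (oct_scale c x)" "\<And>v. P (X v)"
  shows "P x"
proof -
  have "P 0" using assms(2)[of _ 0] assms(3) by (metis oct.scale_zero_left)
  then have "P (\<Sum>v\<in>S. oct_scale (oct_B x (X v) / 2) (X v))" for S
    by (induction S rule: infinite_finite_induct) (simp_all add: assms)
  from this[of UNIV] show ?thesis unfolding X_expand[symmetric] .
qed

end

section \<open>Automorphisms carrying one frame to another\<close>

definition oct_Phi :: "(3 \<Rightarrow> 'a::field_char_0 oct) \<Rightarrow> (3 \<Rightarrow> 'a oct) \<Rightarrow> 'a oct \<Rightarrow> 'a oct" where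
  "oct_Phi e e' x = (\<Sum>v\<in>UNIV. oct_scale (oct_B x (oct_X e v) / 2) (oct_X e' v))"

lemma oct_Phi_linear:
  "oct_Phi e e' (x + y) = oct_Phi e e' x + oct_Phi e e' y"
  "oct_Phi e e' (oct_scale c x) = oct_scale c (oct_Phi e e' x)"
  by (simp_all add: oct_Phi_def S8.B_linear add_divide_distrib oct.scale_left_distrib sum.distrib
      oct.scale_sum_right)

lemma oct_Phi_X:
  assumes "oct_frame e" shows "oct_Phi e e' (oct_X e v) = oct_X e' v"
proof -
  interpret oct_basis e by unfold_locales fact
  have "oct_Phi e e' (X v) = (\<Sum>u\<in>UNIV. if v = u then oct_X e' u else 0)"
    unfolding oct_Phi_def by (intro sum.cong) (auto simp: X_orth)
  then show ?thesis by simp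
qed

lemma oct_Phi_inverse:
  assumes "oct_frame e" "oct_frame e'"
  shows "oct_Phi e' e (oct_Phi e e' x) = x"
proof -
  interpret oct_basis e by unfold_locales fact
  show ?thesis
    by (induction x rule: X_induct) (simp_all add: oct_Phi_linear oct_Phi_X assms)
qed

text \<open>The structure constants \<open>oct_eps\<close> are common to all frames, so matching
  basis elements is multiplicative; both bases being orthogonal with equal norms, it is an
  isometry.\<close>

lemma oct_Phi_automorphism:
  assumes "oct_frame e" "oct_frame e'"
  defines "f \<equiv> oct_Phi e e'"
  shows "bij f" "f (x \<odot> y) = f x \<odot> f y" "oct_B (f x) (f y) = oct_B x y" "f oct_one = oct_one"
    "f (oct_conj x) = oct_conj (f x)"
proof -
  interpret e: oct_basis e by unfold_locales fact
  interpret e': oct_basis e' by unfold_locales fact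
  note lin = oct_Phi_linear[of e e', folded f_def]
  have fX: "f (e.X v) = e'.X v" for v by (simp add: f_def oct_Phi_X assms)
  show "bij f" unfolding f_def by (rule o_bij[of "oct_Phi e' e"]) (auto simp: oct_Phi_inverse assms)
  show "f (x \<odot> y) = f x \<odot> f y"
  proof (induction x rule: e.X_induct)
    case (3 u)
    show ?case
      by (induction y rule: e.X_induct) (simp_all add: oct_mult_linear lin fX e.X_mult e'.X_mult)
  qed (simp_all add: oct_mult_linear lin)
  show B: "oct_B (f x) (f y) = oct_B x y" for x y
  proof (induction x rule: e.X_induct)
    case (3 u)
    show ?case
      by (induction y rule: e.X_induct) (simp_all add: S8.B_linear lin fX e.X_orth e'.X_orth)
  qed (simp_all add: S8.B_linear lin)
  show 1: "f oct_one = oct_one" using fX[of 0] by (simp add: oct_X_zero)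
  have minus: "f (- z) = - f z" for z using lin(2)[of "-1" z] by simp
  have "f (oct_scale c oct_one - x) = oct_scale c oct_one - f x" for c
    using lin(1)[of "oct_scale c oct_one" "- x"] by (simp add: minus lin 1)
  then show "f (oct_conj x) = oct_conj (f x)"
    using B[of x oct_one] by (simp add: oct_conj_def 1)
qed

lemma oct_Phi_Tri:
  assumes "oct_frame e" "oct_frame e'"
  shows "(\<lambda>_. oct_Phi e e') \<in> S8.Tri"
  unfolding S8.Tri_def mem_Collect_eq S8_mult_def
  using oct_Phi_automorphism[OF assms] by (simp add: oct_Phi_linear)

lemma oct_Phi_in_automorphisms:
  assumes "oct_frame e" "oct_frame e'"
  shows "oct_Phi e e' \<in> algebra_on.automorphisms UNIV oct_scale oct_mult"
  unfolding algebra_on.automorphisms_def mem_Collect_eq Bij_def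
  using oct_Phi_automorphism[OF assms] by (simp add: oct_Phi_linear)

subsection \<open>Sign changes of a frame\<close>

definition flip_sign :: "3 \<Rightarrow> (3 \<Rightarrow> 'b::uminus) \<Rightarrow> 3 \<Rightarrow> 'b" where
  "flip_sign i e = (\<lambda>j. if j = i then - e j else e j)"

lemma flip_sign_frame:
  assumes "oct_frame e" shows "oct_frame (flip_sign i e)"
  using assms cases_3[of i] unfolding oct_frame_def flip_sign_def
  by (auto simp: imag_unit_uminus S8.B_linear oct_mult_linear)

lemma oct_X_flip_sign:
  "oct_X (flip_sign i e) v = (if v $ i = 0 then oct_X e v else - oct_X e v)"
  using cases_3[of i] by (auto simp: oct_X_def flip_sign_def oct_mult_linear Let_def)

text \<open>This resolves the definite description in \<open>oct_sign\<close>: an automorphism fixes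
  1, because it is surjective, and is then determined by its values on the frame. The factor c lets
  w be a multiple of a frame, since the w_i square to 1 and not to -1.\<close>

lemma oct_sign_eq:
  fixes w :: "3 \<Rightarrow> 'a::field_char_0 oct"
  assumes frame: "oct_frame e" and w: "\<And>j. e j = oct_scale c (w j)" and "c \<noteq> 0"
  shows "oct_sign w i = oct_Phi e (flip_sign i e)"
  unfolding oct_sign_def
proof (rule the_equality, intro conjI allI)
  interpret oct_basis e by unfold_locales fact
  note flip = flip_sign_frame[OF frame, of i]
  have we: "w j = oct_scale (inverse c) (e j)" for j using w[of j] \<open>c \<noteq> 0\<close> by simp
  show Phi: "oct_Phi e (flip_sign i e) \<in> algebra_on.automorphisms UNIV oct_scale oct_mult"
    by (rule oct_Phi_in_automorphisms[OF frame flip])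
  have Phi_e: "oct_Phi e (flip_sign i e) (e j) = (if j = i then - e j else e j)" for j
    using oct_Phi_X[OF frame, of "flip_sign i e" "axis j 1"]
    by (simp add: oct_X_axis flip_sign_def)
  show "oct_Phi e (flip_sign i e) (w j) = (if j = i then - w j else w j)" for j
    by (simp add: we oct_Phi_linear Phi_e)
  fix f assume f: "f \<in> algebra_on.automorphisms UNIV oct_scale oct_mult \<and>
    (\<forall>j. f (w j) = (if j = i then - w j else w j))"
  then have fw: "f (w j) = (if j = i then - w j else w j)" for j by blast
  have lin: "f (x + y) = f x + f y" "f (oct_scale k x) = oct_scale k (f x)"
    and mult: "f (x \<odot> y) = f x \<odot> f y" and bij: "bij f" for x y k
    using f unfolding algebra_on.automorphisms_def Bij_def by (simp_all only: mem_Collect_eq) blast+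
  have fe: "f (e j) = flip_sign i e j" for j
    unfolding w lin fw by (simp add: flip_sign_def w)
  have one: "f oct_one = oct_one"
  proof -
    obtain y where y: "f y = oct_one" using bij by (metis bij_is_surj surjD)
    have "f oct_one = f oct_one \<odot> f y" by (simp add: y oct_one_mult)
    also have "\<dots> = f (oct_one \<odot> y)" by (simp only: mult)
    also have "\<dots> = oct_one" by (simp add: oct_one_mult y)
    finally show ?thesis .
  qed
  have "f x = oct_Phi e (flip_sign i e) x" for x
  proof (induction x rule: X_induct)
    case (3 v)
    have if_f: "f (if P then x else y) = (if P then f x else f y)" for P x y by simp
    have "f (X v) = oct_X (flip_sign i e) v"
      unfolding oct_X_def Let_def mult if_f one fe ..
    then show ?case by (simp add: oct_Phi_X frame)
  qed (simp_all add: lin oct_Phi_linear)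
  then show "f = oct_Phi e (flip_sign i e)" by blast
qed

subsection \<open>Linear changes of a frame\<close>

definition frame_change :: "(3 \<Rightarrow> 'a::field_char_0 oct) \<Rightarrow> 2 ^ 3 ^ 3 \<Rightarrow> 3 \<Rightarrow> 'a oct" where
  "frame_change e A = (\<lambda>j. oct_X e (A *v axis j 1))"

lemma invertible_inj: "invertible (A :: 'b::comm_ring_1 ^ 'n ^ 'n) \<Longrightarrow> A *v x = A *v y \<longleftrightarrow> x = y"
  by (metis invertible_def matrix_vector_mul_assoc matrix_vector_mul_lid)

context oct_basis
begin

text \<open>Invertibility keeps the columns of A nonzero and distinct, and the column of index 0
  different from the sum of the other two; in terms of labels this is what a frame requires.\<close>

lemma frame_change_frame:
  assumes "invertible A" shows "oct_frame (frame_change e A)"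
  unfolding oct_frame_def frame_change_def
proof (intro conjI allI impI)
  note inj = invertible_inj[OF assms]
  have ax: "axis i (1::2) \<noteq> 0" for i :: 3 by (simp add: axis_eq_0_iff)
  have "A *v axis i 1 \<noteq> 0" for i using inj[of "axis i 1" 0] ax by simp
  then show "imag_unit (X (A *v axis i 1))" for i by (rule imag_unit_X)
  show "oct_B (X (A *v axis i 1)) (X (A *v axis j 1)) = 0" if "i \<noteq> j" for i j
    using that by (simp add: X_orth inj axis_eq_axis)
  have "axis 0 1 \<noteq> axis 1 1 + (axis 2 1 :: 2 ^ 3)"
    by (simp add: vec3_eq_iff axis_def)
  then show "oct_B (X (A *v axis 0 1)) (X (A *v axis 1 1) \<odot> X (A *v axis 2 1)) = 0"
    by (simp add: X_mult S8.B_linear X_orth matrix_vector_right_distrib[symmetric] inj)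
qed

text \<open>Products of basis elements add labels, so expanding v along the axes leaves only a
  product of values of \<open>oct_eps\<close> undetermined.\<close>

lemma oct_X_frame_change:
  "oct_X (frame_change e A) v = X (A *v v) \<or> oct_X (frame_change e A) v = - X (A *v v)"
proof -
  have p: "(if v $ i = 0 then oct_one else frame_change e A i) = X (A *v (v $ i *s axis i 1))" for i
    using cases_2[of "v $ i"] by (auto simp: oct_X_zero frame_change_def)
  have Av: "A *v (v $ 1 *s axis 1 1) + A *v (v $ 2 *s axis 2 1) + A *v (v $ 0 *s axis 0 1) = A *v v"
    by (simp only: matrix_vector_right_distrib[symmetric] vec3_axis_expand[symmetric])
  obtain k where "k = 1 \<or> k = - 1"
    and "oct_X (frame_change e A) v = oct_scale k (X (A *v v))"
    unfolding oct_X_def[of "frame_change e A"] Let_def p X_mult oct_mult_linear Av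
    using oct_eps_cases by (metis (no_types) add.inverse_inverse mult_minus1 mult_1 oct.scale_scale)
  then show ?thesis by auto
qed

end

section \<open>Gradings by simultaneous eigenspaces\<close>

definition homogeneous_sum :: "('g \<Rightarrow> 'b::ab_group_add set) \<Rightarrow> 'b \<Rightarrow> bool" where
  "homogeneous_sum \<Gamma> z \<longleftrightarrow>
     (\<exists>c. (\<forall>g. c g \<in> \<Gamma> g) \<and> finite {g. c g \<noteq> 0} \<and> z = (\<Sum>g | c g \<noteq> 0. c g))"

context vector_space
begin

text \<open>The usual elimination: an operator separating g from h, minus its eigenvalue at h,
  removes the summand at h and rescales the others. The operator may depend on g, so no single one
  has to separate all degrees.\<close>

lemma sum_eigenvectors_eq_0:
  fixes T :: "'i \<Rightarrow> 'b \<Rightarrow> 'b" and mu :: "'i \<Rightarrow> 'g \<Rightarrow> 'a"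
  assumes V: "subspace V"
    and add: "\<And>i x y. x \<in> V \<Longrightarrow> y \<in> V \<Longrightarrow> T i (x + y) = T i x + T i y"
    and T_scale: "\<And>i c x. x \<in> V \<Longrightarrow> T i (scale c x) = scale c (T i x)"
    and separate: "\<And>g h. g \<noteq> h \<Longrightarrow> \<exists>i. mu i g \<noteq> mu i h"
    and "finite S" and c: "\<And>g. g \<in> S \<Longrightarrow> c g \<in> V"
    and eigen: "\<And>i g. g \<in> S \<Longrightarrow> T i (c g) = scale (mu i g) (c g)"
    and "(\<Sum>g\<in>S. c g) = 0" and "g \<in> S"
  shows "c g = 0"
  using assms(5-)
proof (induction S arbitrary: c g)
  case (insert h S)
  have T_sum: "T i (\<Sum>g\<in>S'. c g) = (\<Sum>g\<in>S'. T i (c g))"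
    if "\<And>g. g \<in> S' \<Longrightarrow> c g \<in> V" "finite S'" for i S'
    using that(2,1)
  proof (induction S')
    case empty
    show ?case using T_scale[of 0 i 0] subspace_0[OF V] by simp
  next
    case (insert x F)
    then show ?case by (simp add: add subspace_sum[OF V])
  qed
  have in_S: "c g = 0" if "g \<in> S" for g
  proof -
    have "g \<noteq> h" using that insert.hyps(2) by auto
    then obtain i where i: "mu i g \<noteq> mu i h" using separate by blast
    define c' where "c' g = scale (mu i g - mu i h) (c g)" for g
    have sum: "c h = - (\<Sum>g\<in>S. c g)"
      using insert.prems(3) insert.hyps by (simp add: eq_neg_iff_add_eq_0)
    have "scale (mu i h) (c h) = - (\<Sum>g\<in>S. scale (mu i g) (c g))"
    proof -
      have "0 = T i (\<Sum>g\<in>insert h S. c g)"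
        using insert.prems(3) T_scale[of 0 i 0] subspace_0[OF V] by simp
      also have "\<dots> = (\<Sum>g\<in>insert h S. scale (mu i g) (c g))"
        using T_sum[of "insert h S" i] insert.prems insert.hyps by simp
      finally show ?thesis using insert.hyps by (simp add: eq_neg_iff_add_eq_0)
    qed
    then have "(\<Sum>g\<in>S. c' g) = 0"
      unfolding sum c'_def
      by (simp add: scale_left_diff_distrib sum_subtractf scale_sum_right)
    moreover have "T j (c' g) = scale (mu j g) (c' g)" if "g \<in> S" for j g
      using insert.prems(1,2) that T_scale[of "c g" j "mu i g - mu i h"]
      by (simp add: c'_def mult.commute)
    moreover have "c' g \<in> V" if "g \<in> S" for g
      using insert.prems(1) that by (simp add: c'_def subspace_scale[OF V])
    ultimately have "c' g = 0" using insert.IH[of c' g] \<open>g \<in> S\<close> by blast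
    then show ?thesis using i by (simp add: c'_def)
  qed
  then have "c h = 0" using insert.prems(3) insert.hyps by simp
  then show ?case using in_S insert.prems(4) by blast
qed simp

lemma homogeneous_sumI:
  assumes "\<And>g. subspace (\<Gamma> g)" "z \<in> \<Gamma> g"
  shows "homogeneous_sum \<Gamma> z"
proof -
  define c where "c = (\<lambda>h. if h = g then z else 0)"
  have "\<forall>g. c g \<in> \<Gamma> g" using assms subspace_0 by (auto simp: c_def)
  moreover have "{g. c g \<noteq> 0} = (if z = 0 then {} else {g})" by (auto simp: c_def)
  moreover have "c g = z" by (simp add: c_def)
  ultimately show ?thesis unfolding homogeneous_sum_def by (intro exI[of _ c]) auto
qed

lemma homogeneous_sum_add:
  assumes sub: "\<And>g. subspace (\<Gamma> g)" and "homogeneous_sum \<Gamma> x" "homogeneous_sum \<Gamma> y"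
  shows "homogeneous_sum \<Gamma> (x + y)"
proof -
  obtain c where c: "\<And>g. c g \<in> \<Gamma> g" "finite {g. c g \<noteq> 0}" "x = (\<Sum>g | c g \<noteq> 0. c g)"
    using assms(2) unfolding homogeneous_sum_def by blast
  obtain d where d: "\<And>g. d g \<in> \<Gamma> g" "finite {g. d g \<noteq> 0}" "y = (\<Sum>g | d g \<noteq> 0. d g)"
    using assms(3) unfolding homogeneous_sum_def by blast
  define S where "S = {g. c g \<noteq> 0} \<union> {g. d g \<noteq> 0}"
  have S: "finite S" using c d by (simp add: S_def)
  have sub': "{g. c g + d g \<noteq> 0} \<subseteq> S" by (auto simp: S_def)
  have "x = (\<Sum>g\<in>S. c g)" unfolding c(3) by (rule sum.mono_neutral_left[OF S]) (auto simp: S_def)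
  moreover have "y = (\<Sum>g\<in>S. d g)"
    unfolding d(3) by (rule sum.mono_neutral_left[OF S]) (auto simp: S_def)
  moreover have "(\<Sum>g\<in>S. c g + d g) = (\<Sum>g | c g + d g \<noteq> 0. c g + d g)"
    by (rule sum.mono_neutral_right[OF S sub']) auto
  ultimately show ?thesis
    unfolding homogeneous_sum_def
    using c(1) d(1) finite_subset[OF sub' S] subspace_add[OF sub]
    by (intro exI[of _ "\<lambda>g. c g + d g"]) (simp add: sum.distrib)
qed

end

section \<open>Gradings over additive groups\<close>

lemma additive_group_simps [simp]:
  "carrier additive_group = UNIV" "x \<otimes>\<^bsub>additive_group\<^esub> y = x + y" "\<one>\<^bsub>additive_group\<^esub> = 0"
  by (simp_all add: additive_group_def)

lemma comm_group_additive_group: "comm_group (additive_group :: 'g::ab_group_add monoid)"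
proof (rule comm_groupI)
  fix x :: 'g
  show "\<exists>y\<in>carrier additive_group. y \<otimes>\<^bsub>additive_group\<^esub> x = \<one>\<^bsub>additive_group\<^esub>"
    by (intro bexI[of _ "- x"]) simp_all
qed (simp_all add: add.assoc add.commute)

locale graded_space = vector_space scale
  for scale :: "'a::field \<Rightarrow> 'v::ab_group_add \<Rightarrow> 'v" +
  fixes V :: "'v set" and mul :: "'v \<Rightarrow> 'v \<Rightarrow> 'v" and \<Gamma> :: "'g::ab_group_add \<Rightarrow> 'v set"
  assumes subspace_V: "subspace V" and subspace_\<Gamma>: "subspace (\<Gamma> g)" and \<Gamma>_V: "\<Gamma> g \<subseteq> V"
    and decompose: "z \<in> V \<Longrightarrow> homogeneous_sum \<Gamma> z"
    and independent_\<Gamma>: "finite S \<Longrightarrow> (\<And>g. g \<in> S \<Longrightarrow> c g \<in> \<Gamma> g) \<Longrightarrow> (\<Sum>g\<in>S. c g) = 0 \<Longrightarrow> g \<in> S \<Longrightarrow> c g = 0"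
    and mul_\<Gamma>: "x \<in> \<Gamma> g \<Longrightarrow> y \<in> \<Gamma> h \<Longrightarrow> mul x y \<in> \<Gamma> (g + h)"
begin

abbreviation G :: "'g monoid" where "G \<equiv> additive_group"

lemma zero_\<Gamma>: "0 \<in> \<Gamma> g"
  by (rule subspace_0[OF subspace_\<Gamma>])

lemma decomposition_unique:
  assumes c: "\<And>g. c g \<in> \<Gamma> g" "finite {g. c g \<noteq> 0}" and d: "\<And>g. d g \<in> \<Gamma> g" "finite {g. d g \<noteq> 0}"
    and eq: "(\<Sum>g | c g \<noteq> 0. c g) = (\<Sum>g | d g \<noteq> 0. d g)"
  shows "c = d"
proof
  fix g
  define S where "S = {g. c g \<noteq> 0} \<union> {g. d g \<noteq> 0}"
  have S: "finite S" using c d by (simp add: S_def)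
  have "(\<Sum>g | c g \<noteq> 0. c g) = (\<Sum>g\<in>S. c g)" "(\<Sum>g | d g \<noteq> 0. d g) = (\<Sum>g\<in>S. d g)"
    by (rule sum.mono_neutral_left[OF S]; auto simp: S_def)+
  then have 0: "(\<Sum>g\<in>S. c g - d g) = 0" using eq by (simp add: sum_subtractf)
  have "c g - d g = 0" if "g \<in> S"
    by (rule independent_\<Gamma>[OF S _ 0 that]) (use c d subspace_diff[OF subspace_\<Gamma>] in auto)
  then show "c g = d g" by (cases "g \<in> S") (auto simp: S_def)
qed

lemma components_disjoint:
  assumes "x \<in> \<Gamma> g" "x \<in> \<Gamma> h" "g \<noteq> h" shows "x = 0"
proof -
  define c where "c k = (if k = g then x else if k = h then - x else 0)" for k
  have "c g = 0"
    by (rule independent_\<Gamma>[of "{g, h}"])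
      (use assms subspace_neg[OF subspace_\<Gamma>, of x h] in \<open>auto simp: c_def zero_\<Gamma>\<close>)
  then show ?thesis by (simp add: c_def)
qed

lemma is_grading: "algebra_on.is_grading V scale mul G \<Gamma>"
  unfolding algebra_on.is_grading_def
proof (intro conjI ballI)
  show "comm_group G" by (rule comm_group_additive_group)
  fix z assume "z \<in> V"
  then obtain c where c: "\<forall>g. c g \<in> \<Gamma> g" "finite {g. c g \<noteq> 0}" "z = (\<Sum>g | c g \<noteq> 0. c g)"
    using decompose unfolding homogeneous_sum_def by blast
  show "\<exists>!c. (\<forall>g\<in>carrier G. c g \<in> \<Gamma> g) \<and> (\<forall>g. g \<notin> carrier G \<longrightarrow> c g = 0) \<and>
      finite {g. c g \<noteq> 0} \<and> z = (\<Sum>g | c g \<noteq> 0. c g)"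
  proof (rule ex1I[of _ c])
    fix d assume d: "(\<forall>g\<in>carrier G. d g \<in> \<Gamma> g) \<and> (\<forall>g. g \<notin> carrier G \<longrightarrow> d g = 0) \<and>
      finite {g. d g \<noteq> 0} \<and> z = (\<Sum>g | d g \<noteq> 0. d g)"
    show "d = c"
      by (rule decomposition_unique) (use c d in auto)
  qed (use c in auto)
qed (use subspace_\<Gamma> \<Gamma>_V mul_\<Gamma> in auto)

lemma Supp_iff: "g \<in> algebra_on.Supp G \<Gamma> \<longleftrightarrow> (\<exists>x\<in>\<Gamma> g. x \<noteq> 0)"
  using zero_\<Gamma>[of g] by (auto simp: algebra_on.Supp_def)

lemma Supp_inj:
  assumes "g \<in> algebra_on.Supp G \<Gamma>" "\<Gamma> g = \<Gamma> h" shows "g = h"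
  using assms components_disjoint[of _ g h] unfolding Supp_iff by metis

text \<open>Inclusion in all degrees forces equality: decompose a preimage of y, apply f and compare
  the parts of degree \<alpha> g. Injectivity of \<alpha> keeps the other summands away from that
  degree.\<close>

lemma image_component:
  assumes f: "bij_betw f V V" "\<And>x y. x \<in> V \<Longrightarrow> y \<in> V \<Longrightarrow> f (x + y) = f x + f y"
    and \<alpha>: "inj \<alpha>" and sub: "\<And>g. f ` \<Gamma> g \<subseteq> \<Gamma> (\<alpha> g)"
  shows "f ` \<Gamma> g = \<Gamma> (\<alpha> g)"
proof
  show "f ` \<Gamma> g \<subseteq> \<Gamma> (\<alpha> g)" by (rule sub)
  show "\<Gamma> (\<alpha> g) \<subseteq> f ` \<Gamma> g"
  proof
    fix y assume y: "y \<in> \<Gamma> (\<alpha> g)"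
    then obtain x where x: "x \<in> V" "y = f x"
      using f(1) \<Gamma>_V by (metis bij_betw_imp_surj_on imageE subsetD)
    obtain c where c: "\<And>g. c g \<in> \<Gamma> g" "finite {g. c g \<noteq> 0}" "x = (\<Sum>g | c g \<noteq> 0. c g)"
      using decompose[OF x(1)] unfolding homogeneous_sum_def by blast
    have f0: "f 0 = 0" using f(2)[of 0 0] subspace_0[OF subspace_V] by simp
    have cV: "c g \<in> V" for g using c(1) \<Gamma>_V by blast
    have f_sum: "f (\<Sum>g\<in>S. c g) = (\<Sum>g\<in>S. f (c g))" if "finite S" for S
      using that by (induction S) (simp_all add: f0 f(2) cV subspace_sum[OF subspace_V])
    define S where "S = insert g {g. c g \<noteq> 0}"
    have S: "finite S" using c(2) by (simp add: S_def)
    have inv: "inv_into UNIV \<alpha> (\<alpha> h) = h" for h using \<alpha> by simp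
    \<comment> \<open>The decomposition of y obtained from that of x, minus the one concentrated in
      degree \<alpha> g; independence makes the difference vanish.\<close>
    define d where "d k = f (c (inv_into UNIV \<alpha> k)) - (if k = \<alpha> g then y else 0)" for k
    have "d (\<alpha> g) = 0"
    proof (rule independent_\<Gamma>[of "\<alpha> ` S"])
      show "d k \<in> \<Gamma> k" if "k \<in> \<alpha> ` S" for k
      proof -
        from that obtain h where h: "k = \<alpha> h" by (rule imageE)
        have "f (c h) \<in> \<Gamma> (\<alpha> h)" using c(1) sub by blast
        then show ?thesis
          unfolding h d_def inv using y zero_\<Gamma>
          by (intro subspace_diff[OF subspace_\<Gamma>]) auto
      qed
      have "(\<Sum>k\<in>\<alpha> ` S. d k) = (\<Sum>h\<in>S. f (c h) - (if h = g then y else 0))"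
        unfolding sum.reindex[OF inj_on_subset[OF \<alpha> subset_UNIV]] comp_def d_def inv
          inj_eq[OF \<alpha>] ..
      also have "\<dots> = (\<Sum>h\<in>S. f (c h)) - y"
        using S by (simp add: sum_subtractf S_def)
      also have "(\<Sum>h\<in>S. f (c h)) = y"
      proof -
        have "x = (\<Sum>h\<in>S. c h)"
          unfolding c(3) by (rule sum.mono_neutral_left[OF S]) (auto simp: S_def)
        then show ?thesis using f_sum[OF S] x(2) by simp
      qed
      finally show "(\<Sum>k\<in>\<alpha> ` S. d k) = 0" by simp
    qed (use S in \<open>auto simp: S_def\<close>)
    then have "y = f (c g)" using inv by (simp add: d_def)
    then show "y \<in> f ` \<Gamma> g" using c(1) by blast
  qed
qed

end

section \<open>The grading \<open>\<Gamma>\<^sub>2\<close>\<close>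

abbreviation s2_one :: "'a::field_char_0 s2" where "s2_one \<equiv> (1, 1)"

abbreviation s2_B where "s2_B \<equiv> polar s2_norm"

definition tens_one :: "'a::field_char_0 tens" where "tens_one = tensor oct_one s2_one"

definition g_one :: "'a::field_char_0 g_elem" where "g_one = iota 0 tens_one"

abbreviation g_D :: "'a::field_char_0 g_elem \<Rightarrow> 'a g_elem" where "g_D \<equiv> g_bracket g_one"

lemma s2_one_S2: "S2_mult s2_one x = s2_swap x" "S2_mult x s2_one = s2_swap x"
  by (cases x; simp add: S2_mult_def s2_swap_def)+

lemma g_one_carrier [simp]: "g_one \<in> g_carrier"
  by (simp add: g_one_def)

lemma g_D_closed: "z \<in> g_carrier \<Longrightarrow> g_D z \<in> g_carrier"
  by (simp add: g_bracket_closed)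

lemma g_D_linear:
  shows "x \<in> g_carrier \<Longrightarrow> y \<in> g_carrier \<Longrightarrow> g_D (x + y) = g_D x + g_D y"
    "x \<in> g_carrier \<Longrightarrow> g_D (g_scale c x) = g_scale c (g_D x)"
    "x \<in> g_carrier \<Longrightarrow> g_D (- x) = - g_D x"
    "x \<in> g_carrier \<Longrightarrow> y \<in> g_carrier \<Longrightarrow> g_D (x - y) = g_D x - g_D y"
proof -
  show 1: "g_D (x + y) = g_D x + g_D y" if "x \<in> g_carrier" "y \<in> g_carrier" for x y
    using that by (simp add: g_bracket_add)
  show 2: "g_D (g_scale c x) = g_scale c (g_D x)" if "x \<in> g_carrier" for x c
    using that by (simp add: g_bracket_scale)
  show 3: "g_D (- x) = - g_D x" if "x \<in> g_carrier" for x using 2[of x "-1"] that by simp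
  show "g_D (x - y) = g_D x - g_D y" if "x \<in> g_carrier" "y \<in> g_carrier" for x y
    using 1[OF that(1) g_carrier_closed(5)[OF that(2)]] 3[OF that(2)] by simp
qed

lemma g_D_derivation:
  "y \<in> g_carrier \<Longrightarrow> z \<in> g_carrier \<Longrightarrow>
    g_D (g_bracket y z) = g_bracket (g_D y) z + g_bracket y (g_D z)"
  unfolding g_one_def tens_one_def by (rule ad_iota0_derivation)

text \<open>This is multiplication by 1 (x) 1 on either side: in the product x*y = conj(x) conj(y)
  the old unit acts as the involution.\<close>

definition tens_conj :: "'a::field_char_0 tens \<Rightarrow> 'a tens" where
  "tens_conj = tens_map oct_conj s2_swap"

lemma tens_conj_tensor: "tens_conj (tensor x x') = tensor (oct_conj x) (s2_swap x')"
  unfolding tens_conj_def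
  by (rule tens_map_tensor) (auto simp: oct_conj_scale s2_swap_def s2_scale_def)

lemma tens_conj_add: "tens_conj (v + w) = tens_conj v + tens_conj w"
  unfolding tens_conj_def by (rule tens_map_add) (rule oct_conj_add)

lemma tens_conj_conj: "tens_conj (tens_conj v) = v"
  by (induction v rule: tens_induct)
    (simp_all add: tens_conj_add tens_conj_tensor oct_conj_conj s2_swap_def case_prod_beta)

lemma tens_conj_scale: "tens_conj (tens_scale c v) = tens_scale c (tens_conj v)"
proof (induction v rule: tens_induct)
  case (tensor x x')
  show ?case
    unfolding tensor_scale tens_conj_tensor by (simp only: oct_conj_scale)
qed (simp only: tens_scale_add tens_conj_add)

lemma g_D_eq:
  assumes "d \<in> tri8" "d' \<in> tri2"
  shows "g_D (d, d', v) = (T8 0 tens_one (v 0), T2 0 tens_one (v 0),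
    \<lambda>i. if i = 0 then - (tensor (d 0 oct_one) s2_one + tensor oct_one (d' 0 s2_one))
      else if i = 1 then - tens_conj (v 2) else tens_conj (v 1))"
proof -
  have m: "tens_mult tens_one v = tens_conj v" "tens_mult v tens_one = tens_conj v" for v :: "'a
      tens"
    by (induction v rule: tens_induct)
      (simp_all add: tens_mult_add tens_conj_add tens_one_def tens_mult_tensor tens_conj_tensor
        oct_one_S8 s2_one_S2)
  have z: "tens_map (\<lambda>_. 0) id = (\<lambda>_. 0 :: 'a tens)" "tens_map id (\<lambda>_. 0) = (\<lambda>_. 0 :: 'a tens)"
    by (simp_all add: fun_eq_iff tens_map_def tensor_linear)
  have t: "tens_map (d 0) id tens_one = tensor (d 0 oct_one) s2_one"
    "tens_map id (d' 0) tens_one = tensor oct_one (d' 0 s2_one)"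
    unfolding tens_one_def by (rule tens_map_tri8_linear(3)[OF assms(1)], rule
        tens_map_tri2_linear(3)[OF assms(2)])
  show ?thesis
    unfolding g_one_def iota_def g_bracket_eq
    by (rule g_elem_eqI)
      (simp_all add: assms sum_UNIV_3 m z t tens_map_tri8_linear(4)[OF assms(1)]
        tens_map_tri2_linear(4)[OF assms(2)])
qed

lemma g_D_generators:
  fixes v :: "'a::field_char_0 tens"
  shows "d \<in> tri8 \<Longrightarrow> g_D (d, 0, 0) = - iota 0 (tensor (d 0 oct_one) s2_one)"
  "d' \<in> tri2 \<Longrightarrow> g_D (0, d', 0) = - iota 0 (tensor oct_one (d' 0 s2_one))"
  "g_D (iota 0 (tensor x x')) =
    (tri_scale oct_scale (s2_B s2_one x') (S8.t oct_one x), 0, 0) +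
    (0, tri_scale s2_scale (oct_B oct_one x) (S2.t s2_one x'), 0)"
  "g_D (iota 1 v) = iota 2 (tens_conj v)" "g_D (iota 2 v) = - iota 1 (tens_conj v)"
proof -
  show "d \<in> tri8 \<Longrightarrow> g_D (d, 0, 0) = - iota 0 (tensor (d 0 oct_one) s2_one)"
    unfolding g_one_def tens_one_def by (rule g_bracket_generators(10)[OF _ S8.tri_zero
        S2.tri_zero S2.tri_zero])
  show "d' \<in> tri2 \<Longrightarrow> g_D (0, d', 0) = - iota 0 (tensor oct_one (d' 0 s2_one))"
    unfolding g_one_def tens_one_def by (rule g_bracket_generators(12)[OF S8.tri_zero S8.tri_zero
        _ S2.tri_zero])
  show "g_D (iota 0 (tensor x x')) =
    (tri_scale oct_scale (s2_B s2_one x') (S8.t oct_one x), 0, 0) +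
    (0, tri_scale s2_scale (oct_B oct_one x) (S2.t s2_one x'), 0)"
    unfolding g_one_def tens_one_def g_bracket_tensors by (simp add: theta_pow_def)
  have 12: "g_D (iota 1 (tensor x x')) = iota 2 (tens_conj (tensor x x'))"
    "g_D (iota 2 (tensor x x')) = - iota 1 (tens_conj (tensor x x'))" for x :: "'a oct" and x'
    unfolding g_one_def tens_one_def g_bracket_tensors tens_conj_tensor oct_one_S8 s2_one_S2
    by (rule refl)+
  show "g_D (iota 1 v) = iota 2 (tens_conj v)"
    by (induction v rule: tens_induct) (simp_all add: 12 iota_add g_D_linear tens_conj_add)
  show "g_D (iota 2 v) = - iota 1 (tens_conj v)"
    by (induction v rule: tens_induct) (simp_all add: 12 iota_add g_D_linear tens_conj_add)
qed

lemma g_D_odd: "g_D (g_D (iota 1 v + iota 2 w)) = - (iota 1 v + iota 2 w)"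
  by (simp add: g_D_linear g_carrier_closed g_D_generators tens_conj_conj)

lemma tri_skew_one:
  "d \<in> tri8 \<Longrightarrow> oct_B oct_one (d i oct_one) = 0" "d' \<in> tri2 \<Longrightarrow> s2_B s2_one (d' i s2_one) = 0"
  for d :: "3 \<Rightarrow> 'a::field_char_0 oct \<Rightarrow> 'a oct" and d' :: "3 \<Rightarrow> 'a s2 \<Rightarrow> 'a s2"
  using S8.tri_linear(6)[of d i oct_one oct_one] S2.tri_linear(6)[of d' i s2_one s2_one]
  by (simp_all add: polar_commute[of _ "d _ _"] polar_commute[of _ "d' _ _"])

lemma s2_B_one_one: "s2_B s2_one s2_one = 2"
  by (simp add: s2_polar_eq)

lemma (in sym_comp) t_self: "t x x = 0"
proof (intro ext)
  fix i z
  have half: "y = s (B x x / 2) z" if "y + y = s (B x x) z" for y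
  proof -
    have "s 2 y = s 2 (s (B x x / 2) z)"
      using that scale_left_distrib[of 1 1 y] by simp
    then show ?thesis by (simp only: scale_cancel_left) simp
  qed
  have "x \<star> z \<star> x = s (B x x / 2) z" "x \<star> (z \<star> x) = s (B x x / 2) z"
    by (intro half comp_left comp_right)+
  then show "t x x i z = 0 i z" using cases_3[of i] by (auto simp: t_simps)
qed

lemma g_scale_generators:
  "g_scale c (d, 0, 0) = (tri_scale oct_scale c d, 0, 0)"
  "g_scale c (0, d', 0) = (0, tri_scale s2_scale c d', 0 :: 3 \<Rightarrow> 'a::field_char_0 tens)"
  unfolding g_scale_def split S8.theta_tri_scale_linear(8) S2.theta_tri_scale_linear(8)
  by (simp_all add: zero_prod_def[symmetric] zero_fun_def[symmetric])

lemma g_D_g_D_iota0: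
  fixes x :: "'a::field_char_0 oct"
  shows "g_D (g_D (iota 0 (tensor x x'))) =
    - iota 0 (tensor (oct_scale (s2_B s2_one x') (oct_scale 2 x - oct_scale (oct_B oct_one x)
        oct_one)) s2_one +
      tensor oct_one (s2_scale (oct_B oct_one x) (s2_scale 2 x' - s2_scale (s2_B s2_one x')
          s2_one)))"
proof -
  have mem: "tri_scale oct_scale c (S8.t oct_one x) \<in> tri8" "tri_scale s2_scale c (S2.t s2_one x')
      \<in> tri2" for c
    by (rule S8.tri_tri_scale[OF S8.t_tri] S2.tri_tri_scale[OF S2.t_tri])+
  have t0: "S8.t oct_one x 0 oct_one = oct_scale 2 x - oct_scale (oct_B oct_one x) oct_one"
    "S2.t s2_one x' 0 s2_one = s2_scale 2 x' - s2_scale (s2_B s2_one x') s2_one"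
    by (simp_all add: S8.t_simps S2.t_simps oct_polar_one_one s2_B_one_one
        polar_commute[of _ x oct_one] polar_commute[of _ x' s2_one])
  show ?thesis
    unfolding g_D_generators(3) g_D_linear(1)[OF g_carrier_gen(1)[OF mem(1)] g_carrier_gen(2)[OF
        mem(2)]]
      g_D_generators(1)[OF mem(1)] g_D_generators(2)[OF mem(2)]
    unfolding tri_scale_def t0 iota_add by simp
qed

text \<open>D^2 sends x (x) x' into the span of x (x) 1, 1 (x) x' and 1 (x) 1, the last of which D
  kills. On each of the other two one triality part vanishes by \<open>t_self\<close> and the other
  picks up q(1,1) = 2; with the coefficient 2 already present this is the 4.\<close>

lemma g_D_cube_iota0:
  fixes x :: "'a::field_char_0 oct"
  shows "g_D (g_D (g_D (iota 0 (tensor x x')))) = - g_scale 4 (g_D (iota 0 (tensor x x')))"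
proof -
  define b b' where "b = oct_B oct_one x" and "b' = s2_B s2_one x'"
  define p where "p = iota 0 (tensor x s2_one)"
  define p' where "p' = iota 0 (tensor (oct_one :: 'a oct) x')"
  have [simp]: "p \<in> g_carrier" "p' \<in> g_carrier" by (simp_all add: p_def p'_def)
  have sc: "iota 0 (tensor u (s2_scale c u')) = g_scale c (iota 0 (tensor u u'))" for c and u ::
      "'a oct" and u'
    by (simp only: iota_scale tensor_scale tensor_linear)
  have "g_D (g_D (iota 0 (tensor x x'))) =
      - (g_scale (2 * b') p + g_scale (2 * b) p' - g_scale (2 * b * b') g_one)"
    unfolding g_D_g_D_iota0 b_def[symmetric] b'_def[symmetric] p_def p'_def
    unfolding g_one_def tens_one_def
    by (simp add: oct.scale_right_diff_distrib s2.scale_right_diff_distrib tensor_linear iota_add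
        iota_diff sc g.scale_right_distrib g.scale_right_diff_distrib algebra_simps
        g.scale_left_distrib[symmetric] del: s2.scale_scale oct.scale_scale)
  moreover have "g_D g_one = (0 :: 'a g_elem)"
    by (simp add: g_one_def[where 'a = 'a] tens_one_def g_D_generators(3)[unfolded g_one_def
        tens_one_def]
        S8.t_self S2.t_self S8.theta_tri_scale_linear S2.theta_tri_scale_linear zero_prod_def)
  moreover have "g_D p = (tri_scale oct_scale 2 (S8.t oct_one x), 0, 0)"
    by (simp add: p_def g_D_generators(3) s2_B_one_one S2.t_self S2.theta_tri_scale_linear)
  moreover have "g_D p' = (0, tri_scale s2_scale 2 (S2.t s2_one x'), 0)"
    by (simp add: p'_def g_D_generators(3) oct_polar_one_one S8.t_self S8.theta_tri_scale_linear)
  ultimately have "g_D (g_D (g_D (iota 0 (tensor x x')))) =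
      - (g_scale (2 * b') (tri_scale oct_scale 2 (S8.t oct_one x), 0, 0) +
         g_scale (2 * b) (0, tri_scale s2_scale 2 (S2.t s2_one x'), 0))"
    by (simp add: g_D_linear g_carrier_closed)
  also have "\<dots> = - g_scale 4 (g_D (iota 0 (tensor x x')))"
    unfolding g_D_generators(3) b_def b'_def g.scale_right_distrib g_scale_generators
      S8.theta_tri_scale_linear(5) S2.theta_tri_scale_linear(5)
    by (simp add: mult.commute)
  finally show ?thesis .
qed

text \<open>On the triality algebras D takes values c (x) 1 and 1 (x) s with c and s orthogonal to
  the units (\<open>tri_skew_one\<close>), where D^2 = -4. The \<open>iota 0\<close> part is
  \<open>g_D_cube_iota0\<close>.\<close>

lemma g_D_even:
  fixes v :: "'a::field_char_0 tens"
  assumes "d \<in> tri8" "d' \<in> tri2"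
  defines "z \<equiv> (d, 0, 0) + (0, d', 0) + iota 0 v"
  shows "g_D (g_D (g_D z)) = - g_scale 4 (g_D z)"
proof -
  define P where "P z \<longleftrightarrow> z \<in> g_carrier \<and> g_D (g_D (g_D z)) = - g_scale 4 (g_D z)" for z :: "'a
      g_elem"
  have add: "P (x + y)" if "P x" "P y" for x y
    using that by (simp add: P_def g_carrier_closed g_D_linear g_D_closed g.scale_right_distrib)
  have v: "P (iota 0 v)"
    by (induction v rule: tens_induct) (simp_all add: iota_add add, simp add: P_def g_D_cube_iota0)
  have "g_D (g_D (- iota 0 (tensor (d 0 oct_one) s2_one))) = g_scale 4 (iota 0 (tensor (d 0
      oct_one) s2_one))"
    unfolding g_D_linear(3)[OF iota_carrier] g_D_linear(3)[OF g_D_closed, OF iota_carrier]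
      g_D_g_D_iota0 tri_skew_one(1)[OF assms(1)] s2_B_one_one iota_scale tensor_scale
    by (simp add: tensor_linear)
  then have 1: "P (d, 0, 0)"
    using assms(1) by (simp add: P_def g_D_generators(1))
  have "g_D (g_D (- iota 0 (tensor oct_one (d' 0 s2_one)))) = g_scale 4 (iota 0 (tensor (oct_one
      :: 'a oct) (d' 0 s2_one)))"
    unfolding g_D_linear(3)[OF iota_carrier] g_D_linear(3)[OF g_D_closed, OF iota_carrier]
      g_D_g_D_iota0 tri_skew_one(2)[OF assms(2)] oct_polar_one_one iota_scale tensor_scale
    by (simp add: tensor_linear)
  then have 2: "P (0, d', 0)"
    using assms(2) by (simp add: P_def g_D_generators(2))
  show ?thesis using add[OF add[OF 1 2] v] unfolding P_def z_def by blast
qed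

lemma s2_swap_linear:
  "s2_swap (x + y) = s2_swap x + s2_swap y" "s2_swap (s2_scale c x) = s2_scale c (s2_swap x)"
  "s2_swap (s2_swap x) = x" "s2_swap s2_one = s2_one"
  by (cases x; cases y; simp add: s2_swap_def s2_scale_def)+

lemma s2_swap_Tri: "(\<lambda>_. s2_swap) \<in> S2.Tri"
  unfolding S2.Tri_def mem_Collect_eq
proof (intro allI conjI)
  show "bij (s2_swap :: 'a s2 \<Rightarrow> _)"
    by (rule o_bij[of s2_swap]) (simp_all add: fun_eq_iff s2_swap_linear)
  show "s2_B (s2_swap x) (s2_swap y) = s2_B x y" for x y :: "'a s2"
    by (cases x; cases y) (simp add: s2_swap_def s2_polar_eq algebra_simps)
  show "s2_swap (S2_mult x y) = S2_mult (s2_swap x) (s2_swap y)" for x y :: "'a s2"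
    by (cases x; cases y) (simp add: s2_swap_def S2_mult_def)
qed (rule s2_swap_linear)+

definition sgn2 :: "2 \<Rightarrow> 'a::field_char_0" where "sgn2 k = (if k = 0 then 1 else - 1)"

lemma sgn2_simps [simp]: "sgn2 0 = 1" "sgn2 1 = - 1" "sgn2 k * sgn2 k = 1" "sgn2 (k + l) = sgn2 k
    * sgn2 l"
  using cases_2[of k] cases_2[of l] by (auto simp: sgn2_def)

lemma sgn2_inj: "sgn2 k = (sgn2 l :: 'a::field_char_0) \<Longrightarrow> k = l"
  using cases_2[of k] cases_2[of l] by (auto simp: sgn2_def)

section \<open>The simultaneous eigenspaces forming \<open>Gamma2\<close>\<close>

locale gamma2 =
  fixes w :: "3 \<Rightarrow> 'a::field_char_0 oct" and im :: 'a
  assumes trace: "\<forall>i. oct_B (w i) oct_one = 0"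
    and orth: "\<forall>i j. i \<noteq> j \<longrightarrow> oct_B (w i) (w j) = 0"
    and square: "\<forall>i. w i \<odot> w i = oct_one"
    and third: "oct_B (w 3) (w 1 \<odot> w 2) = 0"
    and im: "im ^ 2 = -1"
begin

text \<open>The square root of -1 turns the w_i, which square to 1, into imaginary units.\<close>

definition e :: "3 \<Rightarrow> 'a oct" where "e i = oct_scale im (w i)"

lemma im_im: "im * im = -1" "im * (im * c) = - c" "im \<noteq> 0"
  using im by (auto simp: power2_eq_square mult.assoc[symmetric])

sublocale oct_basis e
proof
  show "oct_frame e"
    unfolding oct_frame_def imag_unit_def
    using trace orth square third im_im
    by (simp add: e_def S8.B_linear oct_mult_linear)
qed

abbreviation sg :: "3 \<Rightarrow> 'a oct \<Rightarrow> 'a oct" where "sg i \<equiv> oct_sign w i"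

lemma sg_eq: "sg i = oct_Phi e (flip_sign i e)"
  using oct_sign_eq[OF frame, of im w i] im_im by (simp add: e_def)

lemmas sg_Tri = oct_Phi_Tri[OF frame flip_sign_frame[OF frame], folded sg_eq]
lemmas sg_auto = oct_Phi_automorphism[OF frame flip_sign_frame[OF frame], folded sg_eq]
lemmas sg_linear = oct_Phi_linear[of e "flip_sign i e" for i, folded sg_eq]

lemma sg_X: "sg i (X v) = oct_scale (sgn2 (v $ i)) (X v)"
  by (simp add: sg_eq oct_Phi_X frame oct_X_flip_sign sgn2_def)

lemma sg_commute: "sg i (sg j x) = sg j (sg i x)"
  by (induction x rule: X_induct) (simp_all add: sg_linear sg_X mult.commute)

lemma sg_sg: "sg i (sg i x) = x"
  by (induction x rule: X_induct) (simp_all add: sg_linear sg_X)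

text \<open>The involutions \<open>\<rho>\<close> and \<open>F\<^sub>i\<close> are indexed by \<open>None\<close> and \<open>Some i\<close>.\<close>

definition T :: "3 option \<Rightarrow> 'a g_elem \<Rightarrow> 'a g_elem" where
  "T j = (case j of None \<Rightarrow> g_ext id s2_swap | Some i \<Rightarrow> g_ext (sg i) id)"

definition T_oct :: "3 option \<Rightarrow> 'a oct \<Rightarrow> 'a oct" where
  "T_oct j = (case j of None \<Rightarrow> id | Some i \<Rightarrow> sg i)"

definition T_s2 :: "3 option \<Rightarrow> 'a s2 \<Rightarrow> 'a s2" where
  "T_s2 j = (case j of None \<Rightarrow> s2_swap | Some i \<Rightarrow> id)"

lemma T_eq: "T j = g_map (\<lambda>_. T_oct j) (\<lambda>_. T_s2 j)"
  by (cases j) (simp_all add: T_def T_oct_def T_s2_def g_ext_eq_g_map)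

lemma T_related: "related_triples (\<lambda>_. T_oct j) (\<lambda>_. T_s2 j)"
  using S8.Tri_id S2.Tri_id sg_Tri s2_swap_Tri
  by (cases j) (simp_all add: related_triples_def T_oct_def T_s2_def)

sublocale T: related_triples "\<lambda>_. T_oct j" "\<lambda>_. T_s2 j" for j
  by (rule T_related)

lemmas T_add = T.g_map_add[of j for j, folded T_eq]
  and T_scale = T.g_map_scale[of j for j, folded T_eq]
  and T_carrier = T.g_map_carrier[of _ j for j, folded T_eq]
  and T_bracket = T.g_map_bracket[of _ _ j for j, folded T_eq]
  and T_iota = T.g_map_generators(4)[of j for j, folded T_eq]

lemma T_comp: "T i (T j z) = T j (T i z)" and T_T: "T j (T j z) = z"
proof -
  have c: "T_oct i \<circ> T_oct j = T_oct j \<circ> T_oct i" "T_s2 i \<circ> T_s2 j = T_s2 j \<circ> T_s2 i"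
    "T_oct j \<circ> T_oct j = id" "T_s2 j \<circ> T_s2 j = id" for i j
    by (cases i; cases j; simp add: T_oct_def T_s2_def fun_eq_iff sg_commute sg_sg s2_swap_linear)+
  show "T i (T j z) = T j (T i z)" unfolding T_eq g_map_comp[OF T_related T_related] c(1)[of i j]
      c(2)[of i j] ..
  show "T j (T j z) = z" unfolding T_eq g_map_comp[OF T_related T_related] c(3,4) by (rule g_map_id)
qed

lemma T_g_one: "T j g_one = g_one"
  unfolding g_one_def tens_one_def T_iota
  by (cases j) (simp_all add: T_oct_def T_s2_def sg_auto s2_swap_linear)

lemma T_D: "z \<in> g_carrier \<Longrightarrow> T j (g_D z) = g_D (T j z)"
  by (simp add: T_bracket T_g_one)

abbreviation \<Gamma> :: "G2 \<Rightarrow> 'a g_elem set" where "\<Gamma> \<equiv> Gamma2 w im"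

definition T_eig :: "3 option \<Rightarrow> G2 \<Rightarrow> 'a" where
  "T_eig j g = (case j of None \<Rightarrow> sgn2 (fst g) | Some i \<Rightarrow> sgn2 (fst (snd g) $ i))"

abbreviation lev :: "G2 \<Rightarrow> int" where "lev g \<equiv> snd (snd g)"

lemma \<Gamma>_iff:
  "z \<in> \<Gamma> g \<longleftrightarrow> z \<in> g_carrier \<and> (\<forall>j. T j z = g_scale (T_eig j g) z) \<and>
     g_D z = g_scale (of_int (lev g) * im) z"
  unfolding split_option_all T_def T_eig_def option.case sgn2_def g_one_def tens_one_def
  by (cases g) (simp add: Gamma2_def)

lemma g_D_zero: "g_D 0 = 0"
  using g_D_linear(2)[OF g_one_carrier, of 0] by simp

lemma \<Gamma>_subspace: "g.subspace (\<Gamma> g)"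
  by (rule g.subspaceI)
    (auto simp: \<Gamma>_iff g_carrier_closed T_add T_scale g_D_linear g.scale_right_distrib mult.commute
      T.g_map_zero[folded T_eq] g_D_zero)

lemma \<Gamma>_mul:
  assumes "x \<in> \<Gamma> g" "y \<in> \<Gamma> h" shows "g_bracket x y \<in> \<Gamma> (g + h)"
proof -
  have x: "x \<in> g_carrier" "T j x = g_scale (T_eig j g) x" "g_D x = g_scale (of_int (lev g) * im) x"
    and y: "y \<in> g_carrier" "T j y = g_scale (T_eig j h) y" "g_D y = g_scale (of_int (lev h) * im)
        y" for j
    using assms by (auto simp: \<Gamma>_iff)
  have e: "T_eig j (g + h) = T_eig j g * T_eig j h" for j
    by (cases j) (simp_all add: T_eig_def)
  show ?thesis
    unfolding \<Gamma>_iff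
    by (simp add: g_bracket_closed x y T_bracket e g_bracket_scale g_carrier_closed mult.commute
        g_D_derivation distrib_left distrib_right g.scale_left_distrib)
qed

lemma \<Gamma>_independent:
  assumes "finite S" "\<And>g. g \<in> S \<Longrightarrow> c g \<in> \<Gamma> g" "(\<Sum>g\<in>S. c g) = 0" "g \<in> S"
  shows "c g = 0"
\<comment> \<open>Five operators indexed by an option type: \<open>None\<close> stands for
  \<open>g_D\<close>, which separates levels, and \<open>Some j\<close> for the involutions, which
  separate the Z_2 coordinates.\<close>
proof (rule g.sum_eigenvectors_eq_0[OF g_subspace, where T = "case_option g_D T"
      and mu = "case_option (\<lambda>g. of_int (lev g) * im) T_eig"])
  fix g h :: G2 assume gh: "g \<noteq> h"
  show "\<exists>i. case_option (\<lambda>g. of_int (lev g) * im) T_eig i g \<noteq> case_option (\<lambda>g. of_int (lev g) *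
      im) T_eig i h"
  proof (rule ccontr)
    assume "\<nexists>i. case_option (\<lambda>g. of_int (lev g) * im) T_eig i g \<noteq> case_option (\<lambda>g. of_int (lev g)
        * im) T_eig i h"
    then have all: "case_option (\<lambda>g. of_int (lev g) * im) T_eig i g = case_option (\<lambda>g. of_int (lev
        g) * im) T_eig i h" for i
      by blast
    have "lev g = lev h" using all[of None] im_im by simp
    moreover have "fst g = fst h" using all[of "Some None"] by (auto simp: T_eig_def dest: sgn2_inj)
    moreover have "fst (snd g) $ i = fst (snd h) $ i" for i
      using all[of "Some (Some i)"] by (auto simp: T_eig_def dest: sgn2_inj)
    ultimately show False using gh by (simp add: prod_eq_iff vec_eq_iff)
  qed
qed (use assms in \<open>auto simp: g_D_linear T_add T_scale \<Gamma>_iff split: option.split\<close>)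

text \<open>J contains the involutions for which z may fail to be an eigenvector. Splitting z by (1
  + T_j)/2 and (1 - T_j)/2 removes j from J; the level and the signs already reached survive because
  all operators commute.\<close>

lemma homogeneous_of_level:
  assumes "z \<in> g_carrier" "g_D z = g_scale (of_int n * im) z"
  shows "homogeneous_sum \<Gamma> z"
proof -
  have "homogeneous_sum \<Gamma> z"
    if "z \<in> g_carrier" "g_D z = g_scale (of_int n * im) z" "\<forall>j. j \<notin> J \<longrightarrow> T j z = z \<or> T j z = - z"
      and "finite J" for z and J :: "3 option set"
    using that(4,1,2,3)
  proof (induction J arbitrary: z)
    case empty
    define g :: G2 where "g = (if T None z = z then 0 else 1, \<chi> i. if T (Some i) z = z then 0 else
        1, n)"
    have "T j z = g_scale (T_eig j g) z" for j
      using empty(3) by (cases j) (auto simp: g_def T_eig_def)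
    moreover have lev: "lev g = n" by (simp add: g_def)
    ultimately have "z \<in> \<Gamma> g" unfolding \<Gamma>_iff lev using empty(1,2) by blast
    then show ?case by (rule g.homogeneous_sumI[OF \<Gamma>_subspace])
  next
    case (insert j J)
    define p where "p = g_scale (1 / 2) (z + T j z)"
    define m where "m = g_scale (1 / 2) (z - T j z)"
    have Tz: "T j z \<in> g_carrier" by (rule T_carrier[OF insert.prems(1)])
    have T_diff: "T i (x - y) = T i x - T i y" for i x y
      using T_add[of i "x - y" y] by (simp add: eq_diff_eq)
    have carr: "p \<in> g_carrier" "m \<in> g_carrier"
      by (simp_all add: p_def m_def g_carrier_closed insert.prems(1) Tz)
    have DT: "g_D (T j z) = g_scale (of_int n * im) (T j z)"
      by (simp add: T_D[OF insert.prems(1), symmetric] insert.prems(2) T_scale)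
    have D: "g_D p = g_scale (of_int n * im) p" "g_D m = g_scale (of_int n * im) m"
      by (simp_all add: p_def m_def g_D_linear insert.prems(1) Tz g_carrier_closed DT
          insert.prems(2)
          g.scale_right_distrib g.scale_right_diff_distrib mult.commute)
    have j: "T j p = p" "T j m = - m"
      by (simp_all add: p_def m_def T_scale T_add T_diff T_T add.commute flip: g.scale_minus_right)
    have i: "(T i p = p \<or> T i p = - p) \<and> (T i m = m \<or> T i m = - m)" if "i \<notin> J" for i
    proof (cases "i = j")
      case False
      then have "T i z = z \<or> T i z = - z" using insert.prems(3) that by blast
      then show ?thesis
      proof
        assume "T i z = z"
        then show ?thesis using T_comp[of i j z] by (simp add: p_def m_def T_scale T_add T_diff)
      next
        assume z: "T i z = - z"
        have "T i (T j z) = - T j z"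
          using T_comp[of i j z] T_scale[of j "-1" z] by (simp add: z)
        then have "T i p = - p" "T i m = - m"
          by (simp_all add: p_def m_def T_scale T_add T_diff z flip: g.scale_minus_right)
        then show ?thesis by blast
      qed
    qed (use j in auto)
    have "homogeneous_sum \<Gamma> p" "homogeneous_sum \<Gamma> m"
      using insert.IH[OF carr(1) D(1)] insert.IH[OF carr(2) D(2)] i by blast+
    then have "homogeneous_sum \<Gamma> (p + m)" by (rule g.homogeneous_sum_add[OF \<Gamma>_subspace])
    moreover have "p + m = z"
      by (simp add: p_def m_def g.scale_right_distrib[symmetric] flip: g.scale_left_distrib)
        (simp flip: g.scale_left_distrib add: g.scale_right_distrib)
    ultimately show ?case by simp
  qed
  from this[OF assms, of UNIV] show ?thesis by simp
qed

lemma decompose_\<Gamma>: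
  assumes "z \<in> g_carrier" shows "homogeneous_sum \<Gamma> z"
proof -
  obtain d d' v where z: "z = (d, d', v)" by (cases z)
  have mem: "d \<in> tri8" "d' \<in> tri2" using assms by (simp_all add: z g_carrier_iff)
  define a where "a = (d, 0, 0) + (0, d', 0) + iota 0 (v 0)"
  define b where "b = iota 1 (v 1) + iota 2 (v 2)"
  have zab: "z = a + b" unfolding z a_def b_def g_elem_eq[of d d' v] by (simp add: add.assoc)
  have ac: "a \<in> g_carrier" and bc: "b \<in> g_carrier"
    unfolding a_def b_def by (intro g_carrier_closed g_carrier_gen iota_carrier mem)+
  define a1 where "a1 = g_D a"
  define a2 where "a2 = g_D a1"
  define b1 where "b1 = g_D b"
  have c: "a1 \<in> g_carrier" "a2 \<in> g_carrier" "b1 \<in> g_carrier"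
    by (simp_all add: a1_def a2_def b1_def g_D_closed ac bc)
  have a3: "g_D a2 = - g_scale 4 a1" unfolding a2_def a1_def a_def by (rule g_D_even[OF mem])
  have b2: "g_D b1 = - b" unfolding b1_def b_def by (rule g_D_odd)
  note D = g_D_linear g_carrier_closed ac bc c a3 b2 a1_def[symmetric] a2_def[symmetric]
      b1_def[symmetric]
    g.scale_right_distrib g.scale_right_diff_distrib
  have E: "homogeneous_sum \<Gamma> (g_scale p x + g_scale q y)"
    if "x \<in> g_carrier" "y \<in> g_carrier" "g_D (g_scale p x + g_scale q y) = g_scale (of_int n * im)
        (g_scale p x + g_scale q y)"
    for p q x y n
    by (rule homogeneous_of_level[OF _ that(3)]) (simp add: that g_carrier_closed)
  \<comment> \<open>Lagrange projections. The relation D^3 = -4 D has the roots 0, 2i, -2i and D^2 =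
    -1 the roots i, -i; the coefficients are those of 1 + D^2/4, D(D + 2i)/(-8), (D + i)/(2i) and
    the conjugates of the last two.\<close>
  have "homogeneous_sum \<Gamma> (g_scale 1 a + g_scale (1/4) a2)"
    by (rule E[where n = 0]) (simp_all add: D)
  moreover have "homogeneous_sum \<Gamma> (g_scale (-1/8) a2 + g_scale (- (im/4)) a1)"
    by (rule E[where n = 2]) (simp_all add: D im_im mult.commute algebra_simps)
  moreover have "homogeneous_sum \<Gamma> (g_scale (-1/8) a2 + g_scale (im/4) a1)"
    by (rule E[where n = "-2"]) (simp_all add: D im_im mult.commute algebra_simps)
  moreover have "homogeneous_sum \<Gamma> (g_scale (1/2) b + g_scale (- (im/2)) b1)"
    by (rule E[where n = 1]) (simp_all add: D im_im mult.commute algebra_simps)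
  moreover have "homogeneous_sum \<Gamma> (g_scale (1/2) b + g_scale (im/2) b1)"
    by (rule E[where n = "-1"]) (simp_all add: D im_im mult.commute algebra_simps)
  ultimately have "homogeneous_sum \<Gamma> ((g_scale 1 a + g_scale (1/4) a2) +
    (g_scale (-1/8) a2 + g_scale (- (im/4)) a1) + (g_scale (-1/8) a2 + g_scale (im/4) a1) +
    (g_scale (1/2) b + g_scale (- (im/2)) b1) + (g_scale (1/2) b + g_scale (im/2) b1))"
    by - (assumption | rule g.homogeneous_sum_add[OF \<Gamma>_subspace])+
  moreover have "g_scale (1/4) a2 + g_scale (-1/8) a2 + g_scale (-1/8) a2 = 0"
    "g_scale (1/2) b + g_scale (1/2) b = b"
    by (simp_all only: g.scale_left_distrib[symmetric]) simp_all
  then have "(g_scale 1 a + g_scale (1/4) a2) +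
    (g_scale (-1/8) a2 + g_scale (- (im/4)) a1) + (g_scale (-1/8) a2 + g_scale (im/4) a1) +
    (g_scale (1/2) b + g_scale (- (im/2)) b1) + (g_scale (1/2) b + g_scale (im/2) b1) = z"
    unfolding zab by (simp add: algebra_simps)
  ultimately show ?thesis by simp
qed

sublocale graded_space g_scale g_carrier g_bracket \<Gamma>
proof
  show "\<Gamma> g \<subseteq> g_carrier" for g using \<Gamma>_iff by blast
qed (rule g_subspace \<Gamma>_subspace decompose_\<Gamma> \<Gamma>_mul; assumption | rule \<Gamma>_independent; assumption)+

end

section \<open>The support and nonzero brackets\<close>

lemma g_bracket_iota12:
  fixes x y :: "'a::field_char_0 oct"
  shows "g_bracket (iota 1 (tensor x x') + g_scale c (iota 2 (tensor x x')))
      (iota 1 (tensor y y') + g_scale c' (iota 2 (tensor y y'))) =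
    (tri_scale oct_scale (s2_B x' y') (theta_pow 1 (S8.t x y) + tri_scale oct_scale (c * c')
        (theta_pow 2 (S8.t x y))),
     tri_scale s2_scale (oct_B x y) (theta_pow 1 (S2.t x' y') + tri_scale s2_scale (c * c')
         (theta_pow 2 (S2.t x' y'))),
     \<lambda>i. if i = 0 then tensor (oct_scale c' (S8_mult x y)) (S2_mult x' y') -
       tensor (oct_scale c (S8_mult y x)) (S2_mult y' x') else 0)"
proof -
  have "g_bracket (iota 1 (tensor x x') + g_scale c (iota 2 (tensor x x')))
      (iota 1 (tensor y y') + g_scale c' (iota 2 (tensor y y'))) =
    g_bracket (iota 1 (tensor x x')) (iota 1 (tensor y y')) +
    g_scale c' (g_bracket (iota 1 (tensor x x')) (iota 2 (tensor y y'))) +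
    (g_scale c (g_bracket (iota 2 (tensor x x')) (iota 1 (tensor y y'))) +
    g_scale (c * c') (g_bracket (iota 2 (tensor x x')) (iota 2 (tensor y y'))))"
    by (simp add: g_bracket_add g_bracket_scale g_carrier_closed g.scale_right_distrib)
  also have "\<dots> = (tri_scale oct_scale (s2_B x' y') (theta_pow 1 (S8.t x y)) +
       tri_scale oct_scale (c * c') (tri_scale oct_scale (s2_B x' y') (theta_pow 2 (S8.t x y))),
     tri_scale s2_scale (oct_B x y) (theta_pow 1 (S2.t x' y')) +
       tri_scale s2_scale (c * c') (tri_scale s2_scale (oct_B x y) (theta_pow 2 (S2.t x' y'))), 0) +
     iota 0 (tensor (oct_scale c' (S8_mult x y)) (S2_mult x' y') -
       tensor (oct_scale c (S8_mult y x)) (S2_mult y' x'))"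
    unfolding g_bracket_tensors g.scale_right_distrib g_scale_generators g.scale_minus_right
      iota_scale tensor_scale iota_diff
    by (simp add: algebra_simps)
  finally show ?thesis
    by (simp add: iota_def S8.theta_tri_scale_linear S2.theta_tri_scale_linear mult.commute
        fun_eq_iff)
qed

section \<open>Explicit elements of level 1 and -1\<close>

context gamma2
begin

text \<open>\<open>sk 0\<close> and \<open>sk 1\<close> form an eigenbasis of the swap, just as the
  \<open>X u\<close> form one of octonion conjugation, with eigenvalues \<open>cc u\<close>.\<close>

definition sk :: "2 \<Rightarrow> 'a s2" where "sk k = (1, sgn2 k)"

definition cc :: "2 ^ 3 \<Rightarrow> 'a" where "cc u = (if u = 0 then 1 else - 1)"

lemma cc_cc [simp]: "cc u * cc u = 1" "cc u * (cc u * c) = c"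
  by (simp_all add: cc_def)

lemma sgn2_sgn2 [simp]: "sgn2 k * (sgn2 k * c) = (c :: 'a)"
  by (simp add: mult.assoc[symmetric])

lemma eps_eps [simp]: "oct_eps u v * oct_eps u v = (1 :: 'a)"
  using oct_eps_cases[where 'a = 'a, of u v] by auto

lemma X_conj_cc: "oct_conj (X u) = oct_scale (cc u) (X u)"
  by (simp add: X_conj cc_def)

lemma sk_simps: "s2_swap (sk k) = s2_scale (sgn2 k) (sk k)"
  "S2_mult (sk k) (sk l) = s2_scale (sgn2 k * sgn2 l) (sk (k + l))"
  "s2_B (sk k) (sk l) = (if k = l then 2 * sgn2 k else 0)"
  using cases_2[of k] cases_2[of l]
  by (auto simp: sk_def s2_swap_def s2_scale_def S2_mult_eq s2_polar_eq)

lemma X_S8_mult: "S8_mult (X u) (X v) = oct_scale (cc u * cc v * oct_eps u v) (X (u + v))"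
  by (simp add: S8_mult_def X_conj_cc oct_mult_linear X_mult mult.commute mult.left_commute)

text \<open>Conjugation reverses products and multiplies each basis element by its
  \<open>cc\<close>.\<close>

lemma oct_eps_swap: "oct_eps v u = cc u * cc v * cc (u + v) * (oct_eps u v :: 'a)"
proof -
  have "oct_conj (X u \<odot> X v) = oct_scale (oct_eps u v * cc (u + v)) (X (u + v))"
    by (simp add: X_mult oct_conj_scale X_conj_cc)
  moreover have "oct_conj (X u \<odot> X v) = oct_scale (cc u * cc v * oct_eps v u) (X (u + v))"
    unfolding oct_conj_mult unfolding X_conj_cc oct_mult_linear X_mult add.commute[of v u]
    by (simp add: mult.commute mult.left_commute)
  ultimately have "oct_eps u v * cc (u + v) = cc u * cc v * (oct_eps v u :: 'a)"
    using X_nonzero by simp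
  then have "cc u * cc v * (oct_eps u v * cc (u + v)) = cc u * cc v * (cc u * cc v * (oct_eps v u
      :: 'a))"
    by simp
  also have "\<dots> = oct_eps v u" by (simp add: mult.commute mult.left_commute)
  finally show ?thesis by (simp add: mult.commute mult.left_commute)
qed

lemma cc_nonzero [simp]: "cc u \<noteq> 0" and sgn2_nonzero [simp]: "sgn2 k \<noteq> (0 :: 'a)"
  by (simp_all add: cc_def sgn2_def)

lemma tensor_X_sk_eq_0: "tensor (oct_scale c (X u)) (sk k) = 0 \<longleftrightarrow> c = 0"
proof
  assume "tensor (oct_scale c (X u)) (sk k) = 0"
  then have "fst (tensor (oct_scale c (X u)) (sk k)) = 0" by simp
  then show "c = 0" using X_nonzero[of u] by (simp add: tensor_def sk_def)
qed (simp add: tensor_linear)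

text \<open>On \<open>\<iota>\<^sub>1 + \<iota>\<^sub>2\<close> the derivation \<open>g_D\<close> squares to \<open>-1\<close>, so \<open>\<iota>\<^sub>1(v) - n i \<iota>\<^sub>2(v*)\<close> has degree
  \<open>n = \<plusminus>1\<close>, where \<open>v*\<close> is the conjugate of \<open>v\<close>, which for \<open>v\<close> a product of basis elements is
  \<open>\<plusminus>v\<close>.\<close>

definition zel :: "int \<Rightarrow> 2 ^ 3 \<Rightarrow> 2 \<Rightarrow> 'a g_elem" where
  "zel n u k = iota 1 (tensor (X u) (sk k)) +
     g_scale (- of_int n * im * cc u * sgn2 k) (iota 2 (tensor (X u) (sk k)))"

lemma zel_\<Gamma>:
  assumes "n = 1 \<or> n = -1" shows "zel n u k \<in> \<Gamma> (k, u, n)"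
proof -
  define Y where "Y = tensor (X u) (sk k)"
  have conj: "tens_conj Y = tens_scale (cc u * sgn2 k) Y"
    unfolding Y_def tens_conj_tensor X_conj_cc sk_simps tensor_linear(9)[symmetric] tensor_scale
    by (simp add: tensor_linear(9)[symmetric] mult.commute)
  have D: "g_D (iota 1 Y) = g_scale (cc u * sgn2 k) (iota 2 Y)"
    "g_D (iota 2 Y) = - g_scale (cc u * sgn2 k) (iota 1 Y)"
    by (simp_all only: g_D_generators conj iota_scale)
  have T: "T j (iota i Y) = g_scale (T_eig j (k, u, n)) (iota i Y)" for i j
  proof -
    have "T j (iota i Y) = iota i (tensor (oct_scale (T_eig j (k, u, n)) (X u)) (sk k))"
      unfolding Y_def T_iota
      by (cases j) (simp_all add: T_oct_def T_s2_def T_eig_def sg_X sk_simps tensor_linear)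
    then show ?thesis by (simp only: iota_scale Y_def tensor_scale)
  qed
  define \<kappa> where "\<kappa> = cc u * sgn2 k"
  define c where "c = - of_int n * im * \<kappa>"
  have zel: "zel n u k = iota 1 Y + g_scale c (iota 2 Y)"
    by (simp add: zel_def Y_def c_def \<kappa>_def mult.assoc)
  have "\<kappa> * \<kappa> = 1" by (simp add: \<kappa>_def mult.commute mult.left_commute)
  moreover have "c * \<kappa> = - of_int n * im * (\<kappa> * \<kappa>)" "of_int n * im * c = - (im * im) * (of_int n *
      of_int n) * \<kappa>"
    by (simp_all add: c_def)
  moreover have "of_int n * of_int n = (1 :: 'a)" using assms by auto
  ultimately have c: "c * \<kappa> = - (of_int n * im)" "of_int n * im * c = \<kappa>"
    by (simp_all add: im_im)
  have "g_D (zel n u k) = g_scale \<kappa> (iota 2 Y) + g_scale (- (c * \<kappa>)) (iota 1 Y)"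
    unfolding zel by (simp add: g_D_linear g_carrier_closed D \<kappa>_def[symmetric])
  also have "\<dots> = g_scale (of_int n * im) (zel n u k)"
    unfolding zel c(1) g.scale_right_distrib g.scale_scale c(2) by simp
  finally have "g_D (zel n u k) = g_scale (of_int n * im) (zel n u k)" .
  moreover have "zel n u k \<in> g_carrier" unfolding zel by (simp add: g_carrier_closed)
  moreover have "T j (zel n u k) = g_scale (T_eig j (k, u, n)) (zel n u k)" for j
    unfolding zel by (simp only: T_add T_scale T g.scale_right_distrib g.scale_scale mult.commute)
  ultimately show ?thesis unfolding \<Gamma>_iff by simp
qed

lemma zel_nonzero: "zel n u k \<noteq> 0"
proof
  assume "zel n u k = 0"
  then have "snd (snd (zel n u k)) 1 = 0" by simp
  then have "tensor (X u) (sk k) = 0"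
    by (simp add: zel_def iota_def g_scale_def zero_prod_def[symmetric])
  then show False using tensor_X_sk_eq_0[of 1 u k] by simp
qed

text \<open>The \<open>iota 0\<close> part of the bracket is a multiple of X_{u+v} (x) sk_{k+l}
  whose coefficient is, up to a nonzero factor, the difference of the two sides of the
  hypothesis.\<close>

lemma bracket_zel_iota0:
  assumes "cc (u + v) * of_int n \<noteq> of_int n' * sgn2 (k + l)"
  shows "g_bracket (zel n u k) (zel n' v l) \<noteq> 0"
proof
  assume "g_bracket (zel n u k) (zel n' v l) = 0"
  then have "snd (snd (g_bracket (zel n u k) (zel n' v l))) 0 = 0" by simp
  moreover define a b where "a = - of_int n' * im * cc v * sgn2 l" and "b = - of_int n * im * cc u
      * sgn2 k"
  ultimately have "tensor (oct_scale a (S8_mult (X u) (X v))) (S2_mult (sk k) (sk l)) -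
       tensor (oct_scale b (S8_mult (X v) (X u))) (S2_mult (sk l) (sk k)) = 0"
    unfolding zel_def g_bracket_iota12 by simp
  also have "tensor (oct_scale a (S8_mult (X u) (X v))) (S2_mult (sk k) (sk l)) -
      tensor (oct_scale b (S8_mult (X v) (X u))) (S2_mult (sk l) (sk k)) =
    tensor (oct_scale (cc u * cc v * sgn2 k * sgn2 l * oct_eps u v * (a - b * cc u * cc v * cc (u
        + v))) (X (u + v))) (sk (k + l))"
    unfolding X_S8_mult sk_simps oct_eps_swap[of v u] add.commute[of v u] add.commute[of l k]
    by (simp add: tensor_linear tensor_linear(4)[symmetric] flip: s2.scale_left_diff_distrib)
      (simp add: algebra_simps)
  finally have "a - b * cc u * cc v * cc (u + v) = 0"
    unfolding tensor_X_sk_eq_0 by simp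
  moreover have "a - b * cc u * cc v * cc (u + v) =
    im * cc v * sgn2 k * (cc (u + v) * of_int n - of_int n' * sgn2 (k + l))"
    by (simp add: algebra_simps a_def b_def)
  ultimately show False using assms im_im(3) by simp
qed

lemma two_plus_sign: "\<delta> * \<delta> = 1 \<Longrightarrow> 2 + \<delta> \<noteq> (0 :: 'a)"
proof
  assume d: "\<delta> * \<delta> = 1" "2 + \<delta> = 0"
  then have "\<delta> = - 2" by (simp add: add_eq_0_iff)
  with d(1) show False by simp
qed

text \<open>When the \<open>iota 0\<close> part vanishes, exactly one of u = v and k = l holds, and
  a triality part survives. At index 1 it combines t at index 0, contributing 2, with t at index 2,
  contributing 1 or -1; the total 3 or 1 is nonzero in characteristic zero.\<close>

lemma bracket_zel_opposite: "g_bracket (zel 1 u k) (zel (-1) v l) \<noteq> 0"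
proof (cases "cc (u + v) = sgn2 (k + l)")
  case True
  then have "cc (u + v) \<noteq> - sgn2 (k + l)" by (auto simp: cc_def sgn2_def split: if_splits)
  then show ?thesis by (intro bracket_zel_iota0) simp
next
  case False
  define c where "c = cc u * sgn2 k * cc v * sgn2 l"
  have c: "c * c = 1" by (simp add: c_def mult.commute mult.left_commute)
  have cc': "- of_int 1 * im * cc u * sgn2 k * (- of_int (-1) * im * cc v * sgn2 l) = c"
  proof -
    have "- of_int 1 * im * cc u * sgn2 k * (- of_int (-1) * im * cc v * sgn2 l) = - (im * im) * c"
      by (simp add: c_def mult.commute mult.left_commute)
    then show ?thesis by (simp add: im_im(1))
  qed
  show ?thesis
  proof (cases "u = v")
    case True
    then have kl: "k \<noteq> l" using False by (auto simp: cc_def)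
    have e: "S2_mult (sk k) (S2_mult (sk k) (sk l)) = s2_scale (sgn2 k) (sk l)"
      using cases_2[of k] cases_2[of l] by (auto simp: S2_mult_def s2_swap_def sk_def s2_scale_def)
    have t: "S2.t (sk k) (sk l) 0 (sk k) = s2_scale (2 * sgn2 k) (sk l)"
      "S2.t (sk k) (sk l) 2 (sk k) = s2_scale (- sgn2 k) (sk l)"
      by (simp_all add: S2.t_simps e sk_simps(3) kl kl[symmetric])
    have "fst (snd (g_bracket (zel 1 u k) (zel (-1) v l))) 1 (sk k) =
      s2_scale 2 (s2_scale (2 * sgn2 k) (sk l) + s2_scale c (s2_scale (- sgn2 k) (sk l)))"
      unfolding zel_def g_bracket_iota12 cc' fst_conv snd_conv
      by (simp add: True X_orth tri_scale_def theta_pow_def t)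
    also have "\<dots> = s2_scale (2 * sgn2 k * (2 + - c)) (sk l)"
      unfolding s2.scale_scale s2.scale_left_distrib[symmetric] by (simp add: algebra_simps)
    finally have "fst (snd (g_bracket (zel 1 u k) (zel (-1) v l))) 1 (sk k) =
      s2_scale (2 * sgn2 k * (2 + - c)) (sk l)" .
    moreover have "2 * sgn2 k * (2 + - c) \<noteq> 0"
      using two_plus_sign[of "- c"] c by (auto simp: sgn2_def split: if_splits)
    moreover have "sk l \<noteq> 0" by (simp add: sk_def zero_prod_def)
    ultimately have "fst (snd (g_bracket (zel 1 u k) (zel (-1) v l))) 1 (sk k) \<noteq> 0" by simp
    then show ?thesis by (rule contrapos_nn) simp
  next
    case uv: False
    then have kl: "k = l" using False cases_2[of k] cases_2[of l] by (auto simp: cc_def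
        vec2_add_eq_0_iff)
    define d where "d = cc u * cc v * oct_eps u v * (cc u * cc (u + v) * oct_eps u (u + v))"
    have d: "d * d = 1" by (simp add: d_def mult.commute mult.left_commute)
    have "u + (u + v) = v" by (simp add: add.assoc[symmetric])
    then have e: "S8_mult (X u) (S8_mult (X u) (X v)) = oct_scale d (X v)"
      unfolding X_S8_mult S8.m_linear by (simp add: d_def)
    have t: "S8.t (X u) (X v) 0 (X u) = oct_scale 2 (X v)"
      "S8.t (X u) (X v) 2 (X u) = oct_scale (- d) (X v)"
      by (simp_all add: S8.t_simps e X_orth uv uv[symmetric])
    have "fst (g_bracket (zel 1 u k) (zel (-1) v l)) 1 (X u) =
      oct_scale (2 * sgn2 k) (oct_scale 2 (X v) + oct_scale c (oct_scale (- d) (X v)))"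
      unfolding zel_def g_bracket_iota12 cc' fst_conv snd_conv
      by (simp add: kl sk_simps(3) tri_scale_def theta_pow_def t)
    also have "\<dots> = oct_scale (2 * sgn2 k * (2 + - c * d)) (X v)"
      unfolding oct.scale_scale oct.scale_left_distrib[symmetric] by (simp add: algebra_simps)
    finally have "fst (g_bracket (zel 1 u k) (zel (-1) v l)) 1 (X u) =
      oct_scale (2 * sgn2 k * (2 + - c * d)) (X v)" .
    moreover have "(- c * d) * (- c * d) = 1"
    proof -
      have "(- c * d) * (- c * d) = (c * c) * (d * d)" by (simp add: mult.commute mult.left_commute)
      then show ?thesis using c d by simp
    qed
    then have "2 * sgn2 k * (2 + - c * d) \<noteq> 0"
      using two_plus_sign[of "- c * d"] by (auto simp: sgn2_def split: if_splits)
    ultimately have "fst (g_bracket (zel 1 u k) (zel (-1) v l)) 1 (X u) \<noteq> 0"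
      using X_nonzero[of v] by simp
    then show ?thesis by (rule contrapos_nn) simp
  qed
qed

end

lemma (in sym_comp) double_eq_0: "x + x = 0 \<Longrightarrow> x = (0 :: 'b)"
  using scale_left_distrib[of 1 1 x] by simp

interpretation tens: vector_space "\<lambda>c v. tens_scale c (v :: 'a::field tens)"
  by unfold_locales (auto simp: oct.scale_right_distrib oct.scale_left_distrib)

section \<open>Determination of the support\<close>

context gamma2
begin

text \<open>These are the labels for which \<open>tens_conj\<close> acts as -1 on X_u (x) sk_k; they
  turn out to be the Z_2 parts of the degrees of level 2 and -2.\<close>

definition top_degrees :: "(2 \<times> (2 ^ 3)) set" where
  "top_degrees = {(k, u). cc u \<noteq> (sgn2 k :: 'a)}"

lemma top_degrees_iff: "(k, u) \<in> top_degrees \<longleftrightarrow> k = 1 \<and> u = 0 \<or> k = 0 \<and> u \<noteq> 0"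
  using cases_2[of k] by (auto simp: top_degrees_def cc_def)

abbreviation supp :: "G2 set" where "supp \<equiv> algebra_on.Supp G \<Gamma>"

lemma supp_level_1: "n = 1 \<or> n = -1 \<Longrightarrow> (k, u, n) \<in> supp"
  unfolding Supp_iff using zel_\<Gamma> zel_nonzero by blast

text \<open>The degree is the sum of (k, u, 1) and (0, 0, -1), and brackets of opposite levels never
  vanish.\<close>

lemma supp_level_0: "(k, u, 0) \<in> supp"
  using \<Gamma>_mul[OF zel_\<Gamma>[of 1 u k] zel_\<Gamma>[of "-1" 0 0]] bracket_zel_opposite[of u k 0 0]
  unfolding Supp_iff by auto

lemma supp_level_2:
  assumes "n = 1 \<or> n = -1" "(k, u) \<in> top_degrees"
  shows "(k, u, 2 * n) \<in> supp" "g_bracket (zel n u k) (zel n 0 0) \<noteq> 0"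
proof -
  show *: "g_bracket (zel n u k) (zel n 0 0) \<noteq> 0"
    by (rule bracket_zel_iota0) (use assms in \<open>auto simp: top_degrees_def mult.commute\<close>)
  show "(k, u, 2 * n) \<in> supp"
    using \<Gamma>_mul[OF zel_\<Gamma>[OF assms(1), of u k] zel_\<Gamma>[OF assms(1), of 0 0]] *
    unfolding Supp_iff by auto
qed

text \<open>Each X_v with v \<noteq> 0 is negated by some sign automorphism. As this is an isometry
  fixing c, the vector c is orthogonal to X_v.\<close>

lemma fixed_by_signs:
  assumes "\<And>i. sg i c = c" "oct_B oct_one c = 0" shows "c = 0"
proof -
  have "oct_B c (X v) = 0" for v
  proof (cases "v = 0")
    case False
    then obtain i where "v $ i \<noteq> 0" by (auto simp: vec_eq_iff)
    then have "sg i (X v) = - X v" using cases_2[of "v $ i"] by (simp add: sg_X)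
    then have "oct_B c (X v) = - oct_B c (X v)"
      using sg_auto(3)[of i c "X v"] assms(1)[of i] by (simp add: S8.B_linear)
    then show ?thesis by simp
  qed (use assms(2) in \<open>simp add: oct_X_zero polar_commute\<close>)
  then show ?thesis using X_expand[of c] by simp
qed

text \<open>On \<open>tri8 + tri2 + \<iota>\<^sub>0\<close> the derivation satisfies \<open>g_D\<^sup>3 = -4 g_D\<close>, which bounds the levels. An
  element of level \<open>\<plusminus>2\<close> is determined by its \<open>\<iota>\<^sub>0\<close>-component \<open>c \<otimes> 1 + 1 \<otimes> s\<close> with \<open>c\<close> and \<open>s\<close>
  orthogonal to \<open>1\<close>.\<close>

lemma supp_level:
  assumes "g \<in> supp" shows "\<bar>lev g\<bar> \<le> 1 \<or> \<bar>lev g\<bar> = 2 \<and> (fst g, fst (snd g)) \<in> top_degrees"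
proof (rule disjCI)
  assume n1: "\<not> (\<bar>lev g\<bar> = 2 \<and> (fst g, fst (snd g)) \<in> top_degrees)"
  show "\<bar>lev g\<bar> \<le> 1"
  proof (rule ccontr)
    assume n: "\<not> \<bar>lev g\<bar> \<le> 1"
    define \<mu> where "\<mu> = of_int (lev g) * im"
    have mu2: "\<mu> * \<mu> = - of_int (lev g * lev g)"
    proof -
      have "\<mu> * \<mu> = im * im * of_int (lev g * lev g)"
        by (simp add: \<mu>_def mult.commute mult.left_commute)
      then show ?thesis by (simp add: im_im(1))
    qed
    have mu0: "\<mu> \<noteq> 0" using n im_im(3) by (auto simp: \<mu>_def)
    obtain z where z: "z \<in> \<Gamma> g" "z \<noteq> 0" using assms Supp_iff by blast
    then have zc: "z \<in> g_carrier" and zD: "g_D z = g_scale \<mu> z"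
      and zT: "T j z = g_scale (T_eig j g) z" for j
      by (simp_all add: \<Gamma>_iff \<mu>_def)
    obtain d d' v where zd: "z = (d, d', v)" by (cases z)
    have mem: "d \<in> tri8" "d' \<in> tri2" using zc by (simp_all add: zd g_carrier_iff)
    \<comment> \<open>The eigenvector equation read componentwise; \<open>g_D\<close> exchanges the
      \<open>iota 1\<close> and \<open>iota 2\<close> parts through
      \<open>tens_conj\<close>.\<close>
    have eqs: "T8 0 tens_one (v 0) = tri_scale oct_scale \<mu> d"
      "T2 0 tens_one (v 0) = tri_scale s2_scale \<mu> d'"
      "- (tensor (d 0 oct_one) s2_one + tensor oct_one (d' 0 s2_one)) = tens_scale \<mu> (v 0)"
      "- tens_conj (v 2) = tens_scale \<mu> (v 1)" "tens_conj (v 1) = tens_scale \<mu> (v 2)"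
    proof -
      have D: "(T8 0 tens_one (v 0), T2 0 tens_one (v 0),
          \<lambda>i. if i = 0 then - (tensor (d 0 oct_one) s2_one + tensor oct_one (d' 0 s2_one))
          else if i = 1 then - tens_conj (v 2) else tens_conj (v 1)) = g_scale \<mu> (d, d', v)"
        using zD unfolding zd g_D_eq[OF mem] .
      show "T8 0 tens_one (v 0) = tri_scale oct_scale \<mu> d"
        "T2 0 tens_one (v 0) = tri_scale s2_scale \<mu> d'"
        using D by (simp_all add: g_scale_def)
      show "- (tensor (d 0 oct_one) s2_one + tensor oct_one (d' 0 s2_one)) = tens_scale \<mu> (v 0)"
        "- tens_conj (v 2) = tens_scale \<mu> (v 1)" "tens_conj (v 1) = tens_scale \<mu> (v 2)"
        using arg_cong[OF D, of "\<lambda>z. snd (snd z) 0"] arg_cong[OF D, of "\<lambda>z. snd (snd z) 1"]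
          arg_cong[OF D, of "\<lambda>z. snd (snd z) 2"]
        by (simp_all add: g_scale_def)
    qed
    have conj_minus: "tens_conj (- x) = - tens_conj x" for x :: "'a tens"
      using tens_conj_scale[of "-1" x] unfolding tens.scale_minus_left tens.scale_one .
    \<comment> \<open>Combining the last two equations, a nonzero part here would give \<mu>^2 = -1,
      that is, level 1 or -1.\<close>
    have v12: "v 1 = 0" "v 2 = 0"
    proof -
      have "- v 2 = tens_conj (tens_scale \<mu> (v 1))"
        unfolding eqs(4)[symmetric] conj_minus tens_conj_conj ..
      also have "\<dots> = tens_scale (\<mu> * \<mu>) (v 2)"
        unfolding tens_conj_scale eqs(5) tens.scale_scale ..
      finally have "tens_scale (\<mu> * \<mu> + 1) (v 2) = 0"
        unfolding tens.scale_left_distrib tens.scale_one by (metis add.commute add.right_inverse)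
      moreover have "\<mu> * \<mu> + 1 \<noteq> 0"
      proof
        assume "\<mu> * \<mu> + 1 = 0"
        then have "of_int (lev g * lev g) = (of_int 1 :: 'a)" unfolding mu2 by simp
        then have "lev g * lev g = 1 * 1" by (simp only: of_int_eq_iff)
        then show False using n by (auto simp only: square_eq_iff)
      qed
      ultimately show "v 2 = 0" using tens.scale_eq_0_iff by blast
      then have "tens_scale \<mu> (v 1) = 0"
        unfolding eqs(4)[symmetric] by (simp add: tens_conj_def tens_map_def tensor_linear
            oct_conj_zero)
      then show "v 1 = 0" using tens.scale_eq_0_iff mu0 by blast
    qed
    have zeq: "z = (d, 0, 0) + (0, d', 0) + iota 0 (v 0)"
      unfolding zd g_elem_eq[of d d' v] by (simp add: v12 iota_zero)
    have "g_D (g_D (g_D z)) = - g_scale 4 (g_D z)"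
      unfolding zeq by (rule g_D_even[OF mem])
    then have "g_scale (\<mu> * (\<mu> * \<mu> + 4)) z = 0"
      by (simp add: zD g_D_linear zc g_carrier_closed distrib_left g.scale_left_distrib
          mult.commute mult.assoc)
    then have "\<mu> * \<mu> + 4 = 0" using z(2) mu0 by simp
    then have "of_int (lev g * lev g) = (of_int 4 :: 'a)" unfolding mu2 by simp
    then have "lev g * lev g = 4" by (simp only: of_int_eq_iff)
    then have "lev g * lev g = 2 * 2" by simp
    then have lev2: "\<bar>lev g\<bar> = 2" by (auto simp only: square_eq_iff)
    \<comment> \<open>The third equation expresses the \<open>iota 0\<close> part through c (x) 1 +
      1 (x) s, and the first two recover d and d' from that part. Hence c and s determine z, and the
      degree can be read off from them.\<close>
    define c s where "c = d 0 oct_one" and "s = d' 0 s2_one"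
    have skew: "oct_B oct_one c = 0" "s2_B s2_one s = 0"
      unfolding c_def s_def using tri_skew_one mem by blast+
    have v0: "tens_scale (- \<mu>) (v 0) = tensor c s2_one + tensor oct_one s"
      using eqs(3) unfolding tens.scale_minus_left c_def s_def by (metis add.inverse_inverse)
    have nz: "c \<noteq> 0 \<or> s \<noteq> 0"
    proof (rule ccontr)
      assume "\<not> (c \<noteq> 0 \<or> s \<noteq> 0)"
      then have "tens_scale (- \<mu>) (v 0) = 0" using v0 by (simp add: tensor_linear)
      then have v0': "v 0 = 0" using tens.scale_eq_0_iff mu0 by (metis neg_equal_0_iff_equal)
      have "d = 0" "d' = 0"
      proof -
        have "tri_scale oct_scale \<mu> d = 0" "tri_scale s2_scale \<mu> d' = 0"
          using eqs(1,2) v0' by simp_all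
        then show "d = 0" "d' = 0" using mu0 by (auto simp: fun_eq_iff tri_scale_def)
      qed
      then have "z = (0, 0, 0) + (0, 0, 0) + 0" using zeq v0' by (simp only: iota_zero)
      then show False using z(2) by (simp add: zero_prod_def)
    qed
    obtain k u where g: "g = (k, u, lev g)" by (cases g) auto
    have T_v0: "tensor (T_oct j c) s2_one + tensor oct_one (T_s2 j s) =
        tens_scale (T_eig j g) (tensor c s2_one + tensor oct_one s)" for j
    proof -
      have tm: "T j (iota 0 (tensor c s2_one + tensor oct_one s)) =
        iota 0 (tensor (T_oct j c) s2_one + tensor oct_one (T_s2 j s))"
        unfolding iota_add T_add T_iota
        by (cases j) (simp_all add: T_oct_def T_s2_def sg_auto(4) s2_swap_linear)
      have "snd (snd (T j z)) 0 = tens_map (T_oct j) (T_s2 j) (v 0)"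
        by (simp add: zd T_eq g_map_def)
      then have "tens_map (T_oct j) (T_s2 j) (v 0) = tens_scale (T_eig j g) (v 0)"
        unfolding zT by (simp add: zd g_scale_def)
      then have "tens_scale (- \<mu>) (tens_map (T_oct j) (T_s2 j) (v 0)) = tens_scale (T_eig j g)
          (tens_scale (- \<mu>) (v 0))"
        unfolding tens.scale_scale by (simp only: tens.scale_scale mult.commute)
      then have "tens_map (T_oct j) (T_s2 j) (tensor c s2_one + tensor oct_one s) =
        tens_scale (T_eig j g) (tensor c s2_one + tensor oct_one s)"
        unfolding T.tens_map_linear(3)[symmetric] v0 .
      moreover have "tens_map (T_oct j) (T_s2 j) (tensor c s2_one + tensor oct_one s) =
          tensor (T_oct j c) s2_one + tensor oct_one (T_s2 j s)"
        unfolding T.tens_map_linear(1,2)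
        by (cases j) (simp_all add: T_oct_def T_s2_def sg_auto(4) s2_swap_linear)
      ultimately show ?thesis by simp
    qed
    have eig: "T_eig None g = sgn2 k" "T_eig (Some i) g = sgn2 (u $ i)" for i
      by (subst g, simp add: T_eig_def)+
    have T_simps: "T_oct None c = c" "T_s2 None s = s2_swap s" "T_oct (Some i) c = sg i c" "T_s2
        (Some i) s = s" for i
      by (simp_all add: T_oct_def T_s2_def)
    note T_v0 = T_v0[of None, unfolded T_simps eig] T_v0[of "Some _", unfolded T_simps eig]
    have swap_s: "s2_swap s = - s"
    proof (cases s)
      case (Pair a b)
      then show ?thesis using skew(2) by (simp add: s2_polar_eq s2_swap_def eq_neg_iff_add_eq_0
          add.commute)
    qed
    have tc: "tensor x s2_one = 0 \<longleftrightarrow> x = 0" for x :: "'a oct" by (auto simp: tensor_def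
        zero_prod_def)
    have tss: "tensor oct_one x = (0 :: 'a tens) \<longleftrightarrow> x = 0" for x
      by (cases x) (auto simp: tensor_def zero_prod_def oct_one_def oct_scale_def)
    \<comment> \<open>The swap fixes c (x) 1 and negates 1 (x) s, so only c survives for k = 0 and
      only s for k = 1. The sign automorphisms fix 1 (x) s, which forces u = 0 in the second case,
      and cannot all fix c in the first.\<close>
    have "(k, u) \<in> top_degrees"
    proof (cases "k = 0")
      case True
      have "tensor oct_one s + tensor oct_one s = (0 :: 'a tens)"
      proof -
        have "tensor c s2_one + - tensor oct_one s = tensor c s2_one + tensor oct_one s"
          using T_v0(1) unfolding True sgn2_simps tens.scale_one swap_s tensor_linear .
        then show ?thesis by (simp only: add_left_cancel) (metis add.right_inverse)
      qed
      then have s0: "s = 0" unfolding tensor_linear(2)[symmetric] tss by (rule S2.double_eq_0)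
      have "u \<noteq> 0"
      proof
        assume "u = 0"
        then have "tensor (sg i c) s2_one = tensor c s2_one" for i
          using T_v0(2)[of i] unfolding \<open>u = 0\<close> zero_index sgn2_simps tens.scale_one s0
              tensor_linear
          by simp
        then have "sg i c = c" for i
          using tc[of "sg i c - c"] by (simp add: tensor_linear)
        then have "c = 0" by (rule fixed_by_signs) (rule skew)
        then show False using nz s0 by simp
      qed
      then show ?thesis using True by (simp add: top_degrees_iff)
    next
      case False
      then have k: "k = 1" using cases_2[of k] by simp
      have "tensor c s2_one + tensor c s2_one = (0 :: 'a tens)"
      proof -
        have "tensor c s2_one + - tensor oct_one s = - (tensor c s2_one + tensor oct_one s)"
          using T_v0(1) unfolding k sgn2_simps tens.scale_minus_left tens.scale_one swap_s
              tensor_linear .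
        then show ?thesis by (simp only: minus_add_distrib add_right_cancel) (metis
            add.right_inverse)
      qed
      then have c0: "c = 0" unfolding tensor_linear(1)[symmetric] tc by (rule S8.double_eq_0)
      have "u $ i = 0" for i
      proof (rule ccontr)
        assume "u $ i \<noteq> 0"
        then have "u $ i = 1" using cases_2[of "u $ i"] by simp
        then have "tensor oct_one s + tensor oct_one s = (0 :: 'a tens)"
        proof -
          have "sg i 0 = 0" using sg_linear(2)[of i 0 0] by simp
          then have "tensor oct_one s = - tensor oct_one s"
            using T_v0(2)[of i] unfolding \<open>u $ i = 1\<close> c0 sgn2_simps tens.scale_minus_left
                tens.scale_one
            by (simp add: tensor_linear)
          then show ?thesis by (metis add.right_inverse)
        qed
        then have "s = 0" unfolding tensor_linear(2)[symmetric] tss by (rule S2.double_eq_0)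
        then show False using nz c0 by simp
      qed
      then show ?thesis using k by (simp add: top_degrees_iff vec_eq_iff)
    qed
    then show False using n1 lev2 g by (metis fst_conv snd_conv)
  qed
qed

end

section \<open>Universality\<close>

text \<open>Otherwise x would have two decompositions, one concentrated at h and one at k.\<close>

lemma grading_disjoint:
  fixes scale :: "'a::field \<Rightarrow> 'v::ab_group_add \<Rightarrow> 'v"
  assumes gr: "algebra_on.is_grading V scale mul H \<Delta>" and h: "h \<in> carrier H" "k \<in> carrier H"
    and x: "x \<in> \<Delta> h" "x \<in> \<Delta> k" "x \<noteq> 0" and "vector_space scale"
  shows "h = k"
proof (rule ccontr)
  assume hk: "h \<noteq> k"
  interpret vector_space scale by fact
  have sub: "subspace (\<Delta> g)" "\<Delta> g \<subseteq> V" if "g \<in> carrier H" for g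
    using gr that unfolding algebra_on.is_grading_def by blast+
  have "\<forall>x\<in>V. \<exists>!c. (\<forall>g\<in>carrier H. c g \<in> \<Delta> g) \<and> (\<forall>g. g \<notin> carrier H \<longrightarrow> c g = 0) \<and>
      finite {g. c g \<noteq> 0} \<and> x = (\<Sum>g | c g \<noteq> 0. c g)"
    using gr unfolding algebra_on.is_grading_def by (elim conjE) assumption
  note ex1 = bspec[OF this subsetD[OF sub(2)[OF h(1)] x(1)]]
  have unique: "c = d"
    if "(\<forall>g\<in>carrier H. c g \<in> \<Delta> g) \<and> (\<forall>g. g \<notin> carrier H \<longrightarrow> c g = 0) \<and>
      finite {g. c g \<noteq> 0} \<and> x = (\<Sum>g | c g \<noteq> 0. c g)"
      and "(\<forall>g\<in>carrier H. d g \<in> \<Delta> g) \<and> (\<forall>g. g \<notin> carrier H \<longrightarrow> d g = 0) \<and>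
      finite {g. d g \<noteq> 0} \<and> x = (\<Sum>g | d g \<noteq> 0. d g)" for c d
    by (rule ex1E[OF ex1]) (use that in metis)
  define c where "c l = (\<lambda>g. if g = l then x else 0)" for l :: 'b
  have c: "(\<forall>g\<in>carrier H. c l g \<in> \<Delta> g) \<and> (\<forall>g. g \<notin> carrier H \<longrightarrow> c l g = 0) \<and>
      finite {g. c l g \<noteq> 0} \<and> x = (\<Sum>g | c l g \<noteq> 0. c l g)" if "l \<in> carrier H" "x \<in> \<Delta> l" for l
  proof -
    have "{g. c l g \<noteq> 0} = {l}" using x(3) by (auto simp: c_def)
    then show ?thesis using that subspace_0[OF sub(1)] by (auto simp: c_def)
  qed
  have "c h = c k" by (rule unique[OF c[OF h(1) x(1)] c[OF h(2) x(2)]])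
  then have "c h h = c k h" by simp
  then show False using hk x(3) by (simp add: c_def)
qed

context gamma2
begin

text \<open>Levels 0, 1 and -1 are fully supported, so the support generates \<open>G2\<close> even
  as a semigroup. Hence homomorphisms on \<open>G2\<close> are determined by their values on
  it.\<close>

lemma supp_induct:
  assumes "\<And>s. s \<in> supp \<Longrightarrow> P s" "\<And>g h. P g \<Longrightarrow> P h \<Longrightarrow> P (g + h)"
  shows "P g"
proof -
  have "P (0, 0, n)" for n
  proof (induction n rule: int_induct[where k = 0])
    case (step1 i)
    then show ?case using assms(2)[OF _ assms(1)[OF supp_level_1[of 1 0 0]]] by fastforce
  next
    case (step2 i)
    then show ?case using assms(2)[OF _ assms(1)[OF supp_level_1[of "-1" 0 0]]] by fastforce
  qed (rule assms(1)[OF supp_level_0])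
  then show ?thesis
    using assms(2)[OF assms(1)[OF supp_level_0[of "fst g" "fst (snd g)"]], of "(0, 0, lev g)"]
    by (cases g) simp
qed

lemma g_one_\<Gamma>: "g_one \<in> \<Gamma> 0"
proof -
  have "T_eig j 0 = 1" for j by (cases j) (simp_all add: T_eig_def)
  moreover have "g_D g_one = (0 :: 'a g_elem)"
  proof -
    have "g_D (iota 0 (tensor oct_one s2_one)) = (0, 0, 0 :: 3 \<Rightarrow> 'a tens) + (0, 0, 0)"
      unfolding g_D_generators(3) S8.t_self S2.t_self S8.theta_tri_scale_linear
          S2.theta_tri_scale_linear ..
    then show ?thesis by (simp add: g_one_def[symmetric] tens_one_def[symmetric] zero_prod_def)
  qed
  ultimately show ?thesis by (simp add: \<Gamma>_iff T_g_one)
qed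

text \<open>A second realization gives labels \<delta> in H. Write f, f' and h for the labels of
  levels 1, -1 and 0. Since opposite levels have nonzero brackets, h(x + y) = f(x) f'(y); with h(0)
  = 1 this makes h a homomorphism and f(x) = h(x) f(0). The required map is therefore h times a
  power of f(0).\<close>

lemma universal: "algebra_on.universal_group g_carrier g_scale g_bracket TYPE('h) G \<Gamma>"
  unfolding algebra_on.universal_group_def
proof (intro conjI allI impI)
  show "algebra_on.is_grading g_carrier g_scale g_bracket G \<Gamma>" by (rule is_grading)
  fix H :: "'h monoid" and \<Delta>
  assume *: "algebra_on.is_grading g_carrier g_scale g_bracket H \<Delta> \<and>
    algebra_on.components H \<Delta> = algebra_on.components G \<Gamma>"
  then have gr: "algebra_on.is_grading g_carrier g_scale g_bracket H \<Delta>"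
    and comp: "algebra_on.components H \<Delta> = algebra_on.components G \<Gamma>" by blast+
  interpret H: comm_group H using gr unfolding algebra_on.is_grading_def by blast
  have disj: "h = k" if "h \<in> carrier H" "k \<in> carrier H" "x \<in> \<Delta> h" "x \<in> \<Delta> k" "x \<noteq> 0" for h k x
    by (rule grading_disjoint[OF gr that g.vector_space_axioms])
  have "\<exists>h. h \<in> carrier H \<and> \<Delta> h = \<Gamma> s" if "s \<in> supp" for s
  proof -
    have "\<Gamma> s \<in> algebra_on.components H \<Delta>"
      unfolding comp unfolding algebra_on.components_def using that by blast
    then show ?thesis unfolding algebra_on.components_def algebra_on.Supp_def by auto
  qed
  then obtain \<delta> where \<delta>: "\<And>s. s \<in> supp \<Longrightarrow> \<delta> s \<in> carrier H" "\<And>s. s \<in> supp \<Longrightarrow> \<Delta> (\<delta> s) = \<Gamma> s"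
    by metis
  have \<delta>_eq: "h = \<delta> s" if "s \<in> supp" "h \<in> carrier H" "\<Delta> h = \<Gamma> s" for h s
    using that \<delta>[OF that(1)] disj[of h "\<delta> s"] unfolding Supp_iff by metis
  \<comment> \<open>A nonzero bracket of homogeneous elements forces a relation between the labels in \<open>H\<close>.\<close>
  have \<delta>_mult: "\<delta> (s + t) = \<delta> s \<otimes>\<^bsub>H\<^esub> \<delta> t"
    if "x \<in> \<Gamma> s" "y \<in> \<Gamma> t" "g_bracket x y \<noteq> 0" for s t x y
  proof -
    have xy: "x \<in> g_carrier" "y \<in> g_carrier" using that(1,2) \<Gamma>_V by blast+
    have "x \<noteq> 0" "y \<noteq> 0"
      using that(3) g_bracket_scale[OF xy, of 0] by auto
    then have s: "s \<in> supp" "t \<in> supp" and st: "s + t \<in> supp"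
      using that mul_\<Gamma> unfolding Supp_iff by blast+
    have "g_bracket x y \<in> \<Delta> (\<delta> s \<otimes>\<^bsub>H\<^esub> \<delta> t)"
      using gr that(1,2) \<delta>[OF s(1)] \<delta>[OF s(2)] unfolding algebra_on.is_grading_def by metis
    moreover have "g_bracket x y \<in> \<Delta> (\<delta> (s + t))"
      using mul_\<Gamma>[OF that(1,2)] \<delta>(2)[OF st] by simp
    ultimately show ?thesis using disj that(3) \<delta>(1) s st by blast
  qed
  define f where "f x = \<delta> (fst x, snd x, 1)" for x
  define f' where "f' x = \<delta> (fst x, snd x, -1)" for x
  define h where "h x = \<delta> (fst x, snd x, 0)" for x
  have [simp]: "f x \<in> carrier H" "f' x \<in> carrier H" "h x \<in> carrier H" for x
    unfolding f_def f'_def h_def by (intro \<delta> supp_level_0 supp_level_1; simp)+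
  have ff': "h (x + y) = f x \<otimes>\<^bsub>H\<^esub> f' y" for x y
    using \<delta>_mult[OF zel_\<Gamma>[of 1 "snd x" "fst x"] zel_\<Gamma>[of "-1" "snd y" "fst y"] bracket_zel_opposite]
    by (simp add: f_def f'_def h_def)
  \<comment> \<open>\<open>g_one\<close> has degree 0 and acts on level 1 by a nonzero scalar, so
    its label is neutral.\<close>
  have h0: "h 0 = \<one>\<^bsub>H\<^esub>"
  proof -
    have z: "zel 1 0 0 \<in> \<Gamma> (0, 0, 1)" by (rule zel_\<Gamma>) simp
    then have "g_D (zel 1 0 0) \<noteq> 0" using zel_nonzero im_im(3) by (simp add: \<Gamma>_iff)
    from \<delta>_mult[OF g_one_\<Gamma> z this] have "f 0 = h 0 \<otimes>\<^bsub>H\<^esub> f 0"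
      by (simp add: f_def h_def zero_prod_def)
    then show ?thesis using H.r_cancel_one' by simp
  qed
  \<comment> \<open>The finite part has exponent 2, so y = x in the relation for h shows that f' is
    the inverse of f.\<close>
  have xx: "x + x = 0" for x :: "2 \<times> (2 ^ 3)" by (simp add: prod_eq_iff)
  have f': "f' x = inv\<^bsub>H\<^esub> (f x)" for x
    using ff'[of x x] h0 by (intro H.inv_equality[symmetric]) (simp_all add: xx H.m_comm)
  have hx: "h x = f x \<otimes>\<^bsub>H\<^esub> inv\<^bsub>H\<^esub> (f 0)" "h x = f 0 \<otimes>\<^bsub>H\<^esub> inv\<^bsub>H\<^esub> (f x)" for x
    using ff'[of x 0] ff'[of 0 x] by (simp_all add: f')
  have fx: "f x = h x \<otimes>\<^bsub>H\<^esub> f 0" "f' x = h x \<otimes>\<^bsub>H\<^esub> inv\<^bsub>H\<^esub> (f 0)" for x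
  proof -
    show "f x = h x \<otimes>\<^bsub>H\<^esub> f 0" unfolding hx(1) by (simp add: H.m_assoc)
    show "f' x = h x \<otimes>\<^bsub>H\<^esub> inv\<^bsub>H\<^esub> (f 0)"
      unfolding hx(2) f' by (simp add: H.m_assoc H.m_comm[of "inv\<^bsub>H\<^esub> (f x)"]) (simp add:
          H.m_assoc[symmetric])
  qed
  have h_add: "h (x + y) = h x \<otimes>\<^bsub>H\<^esub> h y" for x y
  proof -
    have "inv\<^bsub>H\<^esub> (f 0) \<otimes>\<^bsub>H\<^esub> (f 0 \<otimes>\<^bsub>H\<^esub> z) = z" if "z \<in> carrier H" for z
      using that by (simp add: H.m_assoc[symmetric])
    then have "h x \<otimes>\<^bsub>H\<^esub> h y = f x \<otimes>\<^bsub>H\<^esub> inv\<^bsub>H\<^esub> (f y)"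
      unfolding hx(1)[of x] hx(2)[of y] by (simp add: H.m_assoc)
    then show ?thesis by (simp add: ff' f')
  qed
  define \<phi> where "\<phi> g = h (fst g, fst (snd g)) \<otimes>\<^bsub>H\<^esub> f 0 [^]\<^bsub>H\<^esub> lev g" for g
  have hom: "\<phi> \<in> hom G H"
  proof (rule homI)
    fix x y :: G2
    have "\<phi> (x + y) = (h (fst x, fst (snd x)) \<otimes>\<^bsub>H\<^esub> h (fst y, fst (snd y))) \<otimes>\<^bsub>H\<^esub> (f 0 [^]\<^bsub>H\<^esub> lev x
        \<otimes>\<^bsub>H\<^esub> f 0 [^]\<^bsub>H\<^esub> lev y)"
      using h_add[of "(fst x, fst (snd x))" "(fst y, fst (snd y))"]
      by (simp add: \<phi>_def H.int_pow_mult)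
    then show "\<phi> (x \<otimes>\<^bsub>G\<^esub> y) = \<phi> x \<otimes>\<^bsub>H\<^esub> \<phi> y"
      by (simp add: \<phi>_def H.m_ac)
  qed (simp add: \<phi>_def)
  have \<phi>\<delta>: "\<phi> s = \<delta> s" if supp: "s \<in> supp" for s
  proof -
    obtain k u n where s: "s = (k, u, n)" by (cases s) auto
    \<comment> \<open>Levels 2 and -2 contain a nonzero bracket of two elements of level m, one of
      them in degree (0, 0, m), which determines their labels as well.\<close>
    have top: "\<delta> (k, u, 2 * m) = \<delta> (k, u, m) \<otimes>\<^bsub>H\<^esub> \<delta> (0, 0, m)"
      if "m = 1 \<or> m = -1" "(k, u) \<in> top_degrees" for m
      using \<delta>_mult[OF zel_\<Gamma>[OF that(1)] zel_\<Gamma>[OF that(1)] supp_level_2(2)[OF that]] by simp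
    consider "n = 0" | "n = 1" | "n = -1" | "n = 2" "(k, u) \<in> top_degrees" | "n = -2" "(k, u) \<in>
        top_degrees"
      using supp_level[OF supp] unfolding s fst_conv snd_conv by linarith
    then show ?thesis
    proof cases
      case 1
      then show ?thesis by (simp add: s \<phi>_def) (simp add: h_def)
    next
      case 2
      then show ?thesis using fx(1)[of "(k, u)"] by (simp add: s \<phi>_def) (simp add: f_def)
    next
      case 3
      then show ?thesis using fx(2)[of "(k, u)"]
        by (simp add: s \<phi>_def H.int_pow_neg) (simp add: f'_def)
    next
      case 4
      have "\<phi> s = f (k, u) \<otimes>\<^bsub>H\<^esub> f 0"
        using H.int_pow_mult[of "f 0" 1 1] unfolding fx(1)[of "(k, u)"]
        by (simp add: s 4 \<phi>_def H.m_assoc)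
      then show ?thesis using top[of 1] 4 by (simp add: s f_def)
    next
      case 5
      have "f' 0 = inv\<^bsub>H\<^esub> (f 0)" by (rule f')
      then have "\<phi> s = f' (k, u) \<otimes>\<^bsub>H\<^esub> f' 0"
        using H.int_pow_mult[of "f 0" "-1" "-1"] unfolding fx(2)[of "(k, u)"]
        by (simp add: s 5 \<phi>_def H.m_assoc H.int_pow_neg)
      then show ?thesis using top[of "-1"] 5 by (simp add: s f'_def)
    qed
  qed
  show "\<exists>!\<phi>. \<phi> \<in> hom G H \<and> \<phi> \<in> extensional (carrier G) \<and> (\<forall>s\<in>supp. \<Delta> (\<phi> s) = \<Gamma> s)"
  proof (rule ex1I[of _ \<phi>])
    show "\<phi> \<in> hom G H \<and> \<phi> \<in> extensional (carrier G) \<and> (\<forall>s\<in>supp. \<Delta> (\<phi> s) = \<Gamma> s)"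
      using hom \<phi>\<delta> \<delta>(2) by simp
    fix \<psi> assume \<psi>: "\<psi> \<in> hom G H \<and> \<psi> \<in> extensional (carrier G) \<and> (\<forall>s\<in>supp. \<Delta> (\<psi> s) = \<Gamma> s)"
    then have \<psi>_hom: "\<psi> (x + y) = \<psi> x \<otimes>\<^bsub>H\<^esub> \<psi> y" "\<psi> x \<in> carrier H" for x y
    proof -
      have "\<psi> \<in> carrier G \<rightarrow> carrier H" using \<psi> by (simp only: hom_def mem_Collect_eq)
      from funcset_mem[OF this, of x] show "\<psi> x \<in> carrier H" by simp
      show "\<psi> (x + y) = \<psi> x \<otimes>\<^bsub>H\<^esub> \<psi> y" using \<psi> hom_mult[of \<psi> G H x y] by simp
    qed
    have "\<psi> g = \<phi> g" for g
    proof (induction g rule: supp_induct)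
      case (1 s)
      then show ?case using \<psi> \<psi>_hom(2) \<delta>_eq \<phi>\<delta> by simp
    next
      case (2 g h)
      then show ?case using hom_mult[OF hom, of g h] by (simp add: \<psi>_hom(1))
    qed
    then show "\<psi> = \<phi>" by blast
  qed
qed

end

section \<open>Realising the Weyl group\<close>

context sym_comp
begin

text \<open>As for \<open>tri\<close>, the rule at index 0 implies the other two: pair with a vector
  written as f_1 z' and use that the maps are isometries and the form is associative.\<close>

lemma TriI:
  assumes bij: "\<And>i. bij (a i)" and add: "\<And>i x y. a i (x + y) = a i x + a i y"
    and scale: "\<And>i c x. a i (s c x) = s c (a i x)"
    and iso: "\<And>i x y. B (a i x) (a i y) = B x y"
    and rel: "\<And>x y. a 0 (x \<star> y) = a 1 x \<star> a 2 y"
  shows "a \<in> Tri"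
proof -
  have step: "f 1 (x \<star> y) = f 2 x \<star> f 0 y"
    if f: "\<And>i. bij (f i)" "\<And>i x y. B (f i x) (f i y) = B x y" "\<And>x y. f 0 (x \<star> y) = f 1 x \<star> f 2 y"
    for f :: "3 \<Rightarrow> 'b \<Rightarrow> 'b" and x y
  proof (rule B_eqI)
    fix z
    obtain z' where z: "z = f 1 z'" using f(1) by (metis bij_pointE)
    have "B (f 1 (x \<star> y)) z = B (x \<star> y) z'" by (simp add: z f)
    also have "\<dots> = B (z' \<star> x) y" by (metis B_rotate)
    also have "\<dots> = B (f 1 z' \<star> f 2 x) (f 0 y)" using f(2)[of 0] f(3) by metis
    also have "\<dots> = B (f 2 x \<star> f 0 y) z" unfolding z by (rule B_rotate)
    finally show "B (f 1 (x \<star> y)) z = B (f 2 x \<star> f 0 y) z" .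
  qed
  have 1: "a 1 (x \<star> y) = a 2 x \<star> a 0 y" for x y by (rule step[OF bij iso rel])
  have 2: "a 2 (x \<star> y) = a 0 x \<star> a 1 y" for x y
    using step[of "\<lambda>i. a (i + 1)" x y] bij iso 1 by simp
  have "a i (x \<star> y) = a (i + 1) x \<star> a (i + 2) y" for i x y
    using cases_3[of i] rel 1 2 by auto
  then show ?thesis using bij add scale iso by (simp add: Tri_def)
qed

lemma unit_cancel:
  assumes "B x x = 2" shows "x \<star> z \<star> x = z" "x \<star> (z \<star> x) = z"
proof -
  have half: "y = z" if "y + y = s 2 z" for y
    using that scale_left_distrib[of 1 1 y] scale_cancel_left[of 2 y z] by simp
  show "x \<star> z \<star> x = z" "x \<star> (z \<star> x) = z"
    using comp_left[of x z x] comp_right[of x z x] assms by (auto intro!: half)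
qed

text \<open>For B x x = 2 this is minus the reflection in the hyperplane orthogonal to x: it fixes x
  and negates the orthogonal complement.\<close>

definition refl :: "'b \<Rightarrow> 'b \<Rightarrow> 'b" where "refl x z = s (B x z) x - z"

text \<open>The group analogue of \<open>t\<^bsub>x,y\<^esub>\<close>: its \<open>1\<close>- and \<open>2\<close>-components are \<open>r\<^sub>x l\<^sub>y\<close> and \<open>l\<^sub>x r\<^sub>y\<close>.\<close>

definition refl_triple :: "'b \<Rightarrow> 'b \<Rightarrow> 3 \<Rightarrow> 'b \<Rightarrow> 'b" where
  "refl_triple x y i z = (if i = 0 then refl x (refl y z) else if i = 1 then y \<star> z \<star> x else x \<star> (z
      \<star> y))"

lemma refl_triple_Tri:
  assumes x: "B x x = 2" and y: "B y y = 2"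
  shows "refl_triple x y \<in> Tri"
proof (rule TriI)
  have refl: "refl x (z + w) = refl x z + refl x w" "refl x (s c z) = s c (refl x z)" for x z w c
    by (simp_all add: refl_def B_linear scale_left_distrib scale_right_diff_distrib mult.commute)
  have refl_refl: "refl x (refl x z) = z" if "B x x = 2" for x z
  proof -
    have "B x (refl x z) = B x z" by (simp add: refl_def B_linear that)
    then show ?thesis unfolding refl_def[of x "refl x z"] by (simp add: refl_def)
  qed
  have refl_B: "B (refl x z) (refl x w) = B z w" if "B x x = 2" for x z w
    by (simp add: refl_def B_linear that polar_commute[of _ z x])
  have lr: "B (x \<star> z) (x \<star> w) = B z w" "B (z \<star> x) (w \<star> x) = B z w" if "B x x = 2" for x z w
    using unit_cancel[OF that] polar_assoc[of z x "w \<star> x"] polar_assoc[of "x \<star> z" x w]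
    by (metis polar_assoc polar_commute)+
  show "refl_triple x y i (z + w) = refl_triple x y i z + refl_triple x y i w" for i z w
    by (simp add: refl_triple_def refl m_linear)
  show "refl_triple x y i (s c z) = s c (refl_triple x y i z)" for i c z
    by (simp add: refl_triple_def refl m_linear)
  show "B (refl_triple x y i z) (refl_triple x y i w) = B z w" for i z w
    by (simp add: refl_triple_def refl_B x y lr)
  show "bij (refl_triple x y i)" for i
  \<comment> \<open>The inverse triple exchanges x and y, by \<open>unit_cancel\<close> at indices 1
    and 2 and because \<open>refl\<close> is an involution at index 0.\<close>
  proof (rule o_bij[of "refl_triple y x (if i = 0 then 0 else i)"])
    show "refl_triple y x (if i = 0 then 0 else i) \<circ> refl_triple x y i = id"
      "refl_triple x y i \<circ> refl_triple y x (if i = 0 then 0 else i) = id"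
      using cases_3[of i] by (auto simp: fun_eq_iff refl_triple_def refl_refl x y unit_cancel)
  qed
  \<comment> \<open>\<open>comp_four\<close> with its two symmetric arguments equal, divided by 2.
    Used once for x and once for y it gives the triality rule.\<close>
  have mid: "z \<star> x \<star> (x \<star> w) = refl x (w \<star> z)" if "B x x = 2" for x z w
  proof -
    have "z \<star> x \<star> (x \<star> w) + z \<star> x \<star> (x \<star> w) = refl x (w \<star> z) + refl x (w \<star> z)"
      unfolding comp_four[of z x x w] refl_def that
      using scale_left_distrib[of 1 1 "w \<star> z"] by simp
    then have "s 2 (z \<star> x \<star> (x \<star> w)) = s 2 (refl x (w \<star> z))"
      using scale_left_distrib[of 1 1] by simp
    then show ?thesis by simp
  qed
  show "refl_triple x y 0 (z \<star> w) = refl_triple x y 1 z \<star> refl_triple x y 2 w" for z w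
    by (simp add: refl_triple_def mid x y)
qed

lemma sign_triple_Tri:
  assumes "\<And>i. \<epsilon> i * \<epsilon> i = 1" "\<epsilon> 0 = \<epsilon> 1 * \<epsilon> 2"
  shows "(\<lambda>i. s (\<epsilon> i)) \<in> Tri"
proof (rule TriI)
  show "bij (s (\<epsilon> i))" for i
    by (rule o_bij[of "s (\<epsilon> i)"]) (simp_all add: fun_eq_iff assms)
  show "B (s (\<epsilon> i) x) (s (\<epsilon> i) y) = B x y" for i x y
    using assms(1)[of i] by (simp add: B_linear mult.assoc[symmetric])
qed (simp_all add: scale_right_distrib m_linear assms(2) mult.commute)

end

section \<open>Parity and triples of signs\<close>

definition g_parity :: "'a::field_char_0 g_elem \<Rightarrow> 'a g_elem" where
  "g_parity = (\<lambda>(d, d', v). (d, d', \<lambda>i. if i = 0 then v i else - v i))"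

definition sign012 :: "3 \<Rightarrow> 'a::field_char_0" where "sign012 i = (if i = 0 then 1 else - 1)"

text \<open>The signs (-1, -1, 1). The value -1 at index 0 negates 1 (x) 1: alone this reverses the
  level, and next to an octonion triple with the same effect it restores it.\<close>

definition sign_c :: "3 \<Rightarrow> 'a::field_char_0" where "sign_c i = (if i = 2 then 1 else - 1)"

lemma sign_related:
  "related_triples (\<lambda>i. oct_scale (sign012 i)) (\<lambda>_. id)"
  "related_triples (\<lambda>_. id) (\<lambda>i. s2_scale (sign012 i))"
  "related_triples (\<lambda>_. id) (\<lambda>i. s2_scale (sign_c i))"
proof -
  have 8: "(\<lambda>i. oct_scale (sign012 i)) \<in> S8.Tri"
    by (rule S8.sign_triple_Tri) (simp_all add: sign012_def)
  have 2: "(\<lambda>i. s2_scale (sign012 i)) \<in> S2.Tri" "(\<lambda>i. s2_scale (sign_c i)) \<in> S2.Tri"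
    by (rule S2.sign_triple_Tri; simp add: sign012_def sign_c_def)+
  show "related_triples (\<lambda>i. oct_scale (sign012 i)) (\<lambda>_. id)"
    "related_triples (\<lambda>_. id) (\<lambda>i. s2_scale (sign012 i))"
    "related_triples (\<lambda>_. id) (\<lambda>i. s2_scale (sign_c i))"
    by unfold_locales (rule 8 2 S8.Tri_id S2.Tri_id)+
qed

lemma tri_conj_sign:
  "d \<in> tri8 \<Longrightarrow> tri_conj (\<lambda>i. oct_scale (sign012 i)) d = d"
  "d' \<in> tri2 \<Longrightarrow> tri_conj (\<lambda>i. s2_scale (sign012 i)) d' = d'"
  for d :: "3 \<Rightarrow> 'a::field_char_0 oct \<Rightarrow> 'a oct" and d' :: "3 \<Rightarrow> 'a s2 \<Rightarrow> 'a s2"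
proof -
  have *: "sign012 i * sign012 i = (1 :: 'a)" for i by (simp add: sign012_def)
  have inv: "inv_into UNIV (oct_scale (sign012 i)) = oct_scale (sign012 i :: 'a)"
    "inv_into UNIV (s2_scale (sign012 i)) = s2_scale (sign012 i :: 'a)" for i
    by (rule inv_unique_comp; simp add: fun_eq_iff *)+
  show "d \<in> tri8 \<Longrightarrow> tri_conj (\<lambda>i. oct_scale (sign012 i)) d = d"
    by (simp add: tri_conj_def inv fun_eq_iff S8.tri_linear *)
  show "d' \<in> tri2 \<Longrightarrow> tri_conj (\<lambda>i. s2_scale (sign012 i)) d' = d'"
    by (simp add: tri_conj_def inv fun_eq_iff S2.tri_linear *)
qed

text \<open>Scalars act trivially by conjugation, and on a tensor product a sign may be placed on
  either factor. Parity can thus correct a triple of S_8 as well as one of S_2.\<close>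

lemma g_parity_eq:
  assumes "z \<in> g_carrier"
  shows "g_map (\<lambda>i. oct_scale (sign012 i)) (\<lambda>_. id) z = g_parity z"
    "g_map (\<lambda>_. id) (\<lambda>i. s2_scale (sign012 i)) z = g_parity z"
proof -
  obtain d d' v where z: "z = (d, d', v)" by (cases z)
  have mem: "d \<in> tri8" "d' \<in> tri2" using assms by (simp_all add: z g_carrier_iff)
  have id: "tri_conj (\<lambda>_. id) d = d" "tri_conj (\<lambda>_. id) d' = d'" by (simp_all add: tri_conj_def)
  have "tens_map id id v = v" for v :: "'a tens"
    using tens_eq[of v] by (simp add: tens_map_def)
  then have t: "tens_map (oct_scale (sign012 i)) id v = (if i = 0 then v else - v)"
    "tens_map id (s2_scale (sign012 i)) v = (if i = 0 then v else - v)" for i and v :: "'a tens"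
    using tens_eq[of v]
    by (simp_all add: sign012_def tens_map_def tensor_linear s2_scale_def tensor_def
        uminus_prod_def)
  show "g_map (\<lambda>i. oct_scale (sign012 i)) (\<lambda>_. id) z = g_parity z"
    "g_map (\<lambda>_. id) (\<lambda>i. s2_scale (sign012 i)) z = g_parity z"
    by (simp_all add: z g_map_def g_parity_def tri_conj_sign mem id t)
qed

context gamma2
begin

text \<open>Write z = a + b with b the part in \<open>iota 1\<close> and \<open>iota 2\<close>; both
  are eigenvectors of \<open>g_D\<close> with the eigenvalue of z. At level 1 or -1 the relation D^3
  = -4 D kills a, at levels 0, 2 and -2 the relation D^2 = -1 kills b.\<close>

lemma g_parity_level:
  assumes "z \<in> \<Gamma> g" shows "g_parity z = g_scale (sgn2 (of_int (lev g))) z"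
proof (cases "z = 0")
  case False
  then have supp: "g \<in> supp" using assms Supp_iff by blast
  obtain d d' v where z: "z = (d, d', v)" by (cases z)
  have zc: "z \<in> g_carrier" and zD: "g_D z = g_scale (of_int (lev g) * im) z"
    using assms by (simp_all add: \<Gamma>_iff)
  have mem: "d \<in> tri8" "d' \<in> tri2" using zc by (simp_all add: z g_carrier_iff)
  define a where "a = (d, 0, 0) + (0, d', 0) + iota 0 (v 0)"
  define b where "b = iota 1 (v 1) + iota 2 (v 2)"
  have zab: "z = a + b" unfolding z a_def b_def g_elem_eq[of d d' v] by (simp add: add.assoc)
  have ac: "a \<in> g_carrier" and bc: "b \<in> g_carrier"
    unfolding a_def b_def by (intro g_carrier_closed g_carrier_gen iota_carrier mem)+
  have pz: "g_parity z = a - b"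
  proof -
    have "g_parity z = (d, 0, 0) + (0, d', 0) + iota 0 (v 0) + iota 1 (- v 1) + iota 2 (- v 2)"
      unfolding z g_parity_def split
      using g_elem_eq[of d d' "\<lambda>i. if i = 0 then v i else - v i"] by simp
    then show ?thesis by (simp add: a_def b_def iota_minus)
  qed
  \<comment> \<open>Parity is induced by related triples and fixes \<open>g_one\<close>, so it
    commutes with \<open>g_D\<close>; this yields separate equations for a and b.\<close>
  have N: "g_parity (g_D z) = g_D (g_parity z)"
  proof -
    interpret related_triples "\<lambda>_. id" "\<lambda>i. s2_scale (sign012 i)" by (rule sign_related)
    have "g_map (\<lambda>_. id) (\<lambda>i. s2_scale (sign012 i)) g_one = (g_one :: 'a g_elem)"
      unfolding g_one_def tens_one_def g_map_generators(4) by (simp add: sign012_def)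
    then show ?thesis
      using g_map_bracket[OF g_one_carrier zc]
      by (simp add: g_parity_eq(2) zc g_D_closed)
  qed
  have Pscale: "g_parity (g_scale c z) = g_scale c (g_parity z)" for c
    by (simp add: z g_parity_def g_scale_def fun_eq_iff oct.scale_minus_right)
  define \<mu> where "\<mu> = of_int (lev g) * im"
  have "g_scale \<mu> (a - b) = g_D (a - b)"
    using N unfolding zD Pscale pz \<mu>_def .
  then have Dab: "g_D a + g_D b = g_scale \<mu> a + g_scale \<mu> b" "g_D a - g_D b = g_scale \<mu> a -
      g_scale \<mu> b"
    using zD unfolding zab \<mu>_def[symmetric]
    by (simp_all add: g_D_linear ac bc g.scale_right_distrib g.scale_right_diff_distrib)
  have half: "x = y" if "x + x = y + y" for x y :: "'a g_elem"
    using that g.scale_left_distrib[of 1 1 x] g.scale_left_distrib[of 1 1 y]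
        g.scale_cancel_left[of 2 x y] by simp
  have Da: "g_D a = g_scale \<mu> a"
    by (rule half) (use arg_cong2[OF Dab, of "(+)"] in \<open>simp add: algebra_simps\<close>)
  then have Db: "g_D b = g_scale \<mu> b" using Dab(1) by simp
  have a3: "g_D (g_D (g_D a)) = - g_scale 4 (g_D a)" unfolding a_def by (rule g_D_even[OF mem])
  have b2: "g_D (g_D b) = - b" unfolding b_def by (rule g_D_odd)
  have a0: "g_scale (\<mu> * (\<mu> * \<mu> + 4)) a = 0"
    using a3 by (simp add: Da g_D_linear ac g_carrier_closed distrib_left g.scale_left_distrib
        mult.commute mult.assoc)
  have b0: "g_scale (\<mu> * \<mu> + 1) b = 0"
    using b2 by (simp add: Db g_D_linear bc g.scale_left_distrib)
  have mu: "\<mu> * \<mu> = - of_int (lev g * lev g)"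
  proof -
    have "\<mu> * \<mu> = im * im * of_int (lev g * lev g)" by (simp add: \<mu>_def mult.commute
        mult.left_commute)
    then show ?thesis by (simp add: im_im(1))
  qed
  consider "lev g = 1 \<or> lev g = -1" | "lev g = 0 \<or> lev g = 2 \<or> lev g = -2"
    using supp_level[OF supp] by linarith
  then show ?thesis
  proof cases
    case 1
    then have "\<mu> * \<mu> = -1" "\<mu> \<noteq> 0" "sgn2 (of_int (lev g)) = (-1 :: 'a)"
      using mu im_im(3) by (auto simp: \<mu>_def sgn2_def)
    then show ?thesis unfolding pz using a0 by (simp add: zab)
  next
    case 2
    then have "\<mu> * \<mu> + 1 \<noteq> 0" "sgn2 (of_int (lev g)) = (1 :: 'a)"
      using mu by (auto simp: sgn2_def)
    then show ?thesis unfolding pz using b0 by (simp add: zab)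
  qed
next
  case True
  have zero: "(0 :: 'a g_elem) = (0, 0, 0)" by (simp add: zero_prod_def)
  have "g_parity 0 = (0 :: 'a g_elem)" unfolding zero g_parity_def split by (rule g_elem_eqI)
      simp_all
  then show ?thesis by (simp add: True)
qed

end

section \<open>Automorphisms realising the generators\<close>

context gamma2
begin

definition shift_deg :: "2 \<Rightarrow> 2 ^ 3 \<Rightarrow> G2 \<Rightarrow> G2" where
  "shift_deg b D g = (fst g + of_int (lev g) * b, fst (snd g) + of_int (lev g) *s D, lev g)"

text \<open>Inclusions are easy to verify on eigenvectors and easy to compose;
  \<open>image_component\<close> upgrades them to equalities.\<close>

definition realises :: "(G2 \<Rightarrow> G2) \<Rightarrow> bool" where
  "realises \<alpha> \<longleftrightarrow> (\<exists>a b. related_triples a b \<and> (\<forall>g. g_map a b ` \<Gamma> g \<subseteq> \<Gamma> (\<alpha> g)))"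

lemma realises_comp:
  assumes "realises \<alpha>" "realises \<beta>" shows "realises (\<alpha> \<circ> \<beta>)"
proof -
  obtain a b where ab: "related_triples a b" "\<And>g. g_map a b ` \<Gamma> g \<subseteq> \<Gamma> (\<alpha> g)"
    using assms(1) unfolding realises_def by blast
  obtain c d where cd: "related_triples c d" "\<And>g. g_map c d ` \<Gamma> g \<subseteq> \<Gamma> (\<beta> g)"
    using assms(2) unfolding realises_def by blast
  have "related_triples (\<lambda>i. a i \<circ> c i) (\<lambda>i. b i \<circ> d i)"
    using ab(1) cd(1) S8.Tri_comp S2.Tri_comp unfolding related_triples_def by blast
  moreover have "g_map (\<lambda>i. a i \<circ> c i) (\<lambda>i. b i \<circ> d i) ` \<Gamma> g \<subseteq> \<Gamma> (\<alpha> (\<beta> g))" for g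
    using ab(2)[of "\<beta> g"] cd(2)[of g] unfolding g_map_comp[OF ab(1) cd(1), symmetric] by blast
  ultimately show ?thesis unfolding realises_def comp_apply by blast
qed

lemma level_of_g_map:
  assumes rel: "related_triples a b" and one: "g_map a b g_one = g_scale \<epsilon> g_one" and "\<epsilon> * \<epsilon> = 1"
    and z: "z \<in> \<Gamma> g"
  shows "g_map a b z \<in> g_carrier" "g_D (g_map a b z) = g_scale (\<epsilon> * (of_int (lev g) * im)) (g_map
      a b z)"
proof -
  interpret related_triples a b by (rule rel)
  have zc: "z \<in> g_carrier" and zD: "g_D z = g_scale (of_int (lev g) * im) z"
    using z by (simp_all add: \<Gamma>_iff)
  show c: "g_map a b z \<in> g_carrier" by (rule g_map_carrier[OF zc])
  have "g_map a b (g_D z) = g_scale \<epsilon> (g_D (g_map a b z))"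
    unfolding g_map_bracket[OF g_one_carrier zc] one by (rule g_bracket_scale[OF g_one_carrier c])
  then have "g_scale \<epsilon> (g_scale \<epsilon> (g_D (g_map a b z))) = g_scale \<epsilon> (g_scale (of_int (lev g) * im)
      (g_map a b z))"
    by (simp only: zD g_map_scale)
  then show "g_D (g_map a b z) = g_scale (\<epsilon> * (of_int (lev g) * im)) (g_map a b z)"
    using assms(3) by simp
qed

text \<open>Commuting with an involution up to parity multiplies its eigenvalue at level n by
  (-1)^n, which shifts that coordinate by n. Fixing \<open>g_one\<close> keeps the level.\<close>

lemma realises_shift:
  assumes rel: "related_triples a b" and one: "g_map a b g_one = g_one"
    and comm: "\<And>j z. z \<in> g_carrier \<Longrightarrow> T j (g_map a b z) =
      g_map a b (if (case j of None \<Rightarrow> k | Some i \<Rightarrow> u $ i) = 0 then T j z else g_parity (T j z))"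
  shows "realises (shift_deg k u)"
  unfolding realises_def
proof (intro exI conjI allI subsetI)
  interpret related_triples a b by (rule rel)
  fix g y assume "y \<in> g_map a b ` \<Gamma> g"
  then obtain z where y: "y = g_map a b z" and z: "z \<in> \<Gamma> g" by blast
  have zc: "z \<in> g_carrier" and zT: "T j z = g_scale (T_eig j g) z" for j
    using z by (simp_all add: \<Gamma>_iff)
  note lev = level_of_g_map[OF rel _ _ z, of 1, unfolded g.scale_one mult_1, OF one refl]
  have Pscale: "g_parity (g_scale c z) = g_scale c (g_parity z)" for c
    by (cases z) (simp add: g_parity_def g_scale_def fun_eq_iff oct.scale_minus_right)
  have "T j y = g_scale (T_eig j (shift_deg k u g)) y" for j
  proof -
    define p where "p = (case j of None \<Rightarrow> k | Some i \<Rightarrow> u $ i)"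
    have "T_eig j (shift_deg k u g) = T_eig j g * sgn2 (of_int (lev g) * p)"
      by (cases j) (simp_all add: p_def T_eig_def shift_deg_def)
    moreover have "T j y = g_scale (T_eig j g * sgn2 (of_int (lev g) * p)) y"
      unfolding y comm[OF zc] p_def[symmetric] zT Pscale g_parity_level[OF z]
      using cases_2[of p] by (auto simp: g_map_scale)
    ultimately show ?thesis by simp
  qed
  then show "y \<in> \<Gamma> (shift_deg k u g)"
    using lev unfolding \<Gamma>_iff y by (simp add: shift_deg_def)
qed (rule rel)

lemma T_g_map:
  assumes "related_triples a b"
    and "\<And>i. T_oct j \<circ> a i = a i \<circ> T_oct j" "\<And>i. T_s2 j \<circ> b i = b i \<circ> T_s2 j"
  shows "T j (g_map a b z) = g_map a b (T j z)"
  unfolding T_eq g_map_comp[OF T_related assms(1)] g_map_comp[OF assms(1) T_related] assms(2,3) ..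

lemma T_s2_linear: "T_s2 j (s2_scale c x') = s2_scale c (T_s2 j x')"
  by (cases j) (simp_all add: T_s2_def s2_swap_linear)

text \<open>The signs \<open>sign_c\<close> commute with all four involutions and negate
  \<open>g_one\<close>, so that only the eigenvalue of \<open>g_D\<close> changes sign.\<close>

lemma realises_negation: "realises (\<lambda>(k, u, n). (k, u, - n))"
  unfolding realises_def
proof (intro exI conjI allI subsetI)
  show rel: "related_triples (\<lambda>_. id) (\<lambda>i. s2_scale (sign_c i :: 'a))" by (rule sign_related)
  then interpret related_triples "\<lambda>_. id" "\<lambda>i. s2_scale (sign_c i :: 'a)" .
  fix g y assume "y \<in> g_map (\<lambda>_. id) (\<lambda>i. s2_scale (sign_c i)) ` \<Gamma> g"
  then obtain z where y: "y = g_map (\<lambda>_. id) (\<lambda>i. s2_scale (sign_c i)) z" and z: "z \<in> \<Gamma> g" by blast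
  have one: "g_map (\<lambda>_. id) (\<lambda>i. s2_scale (sign_c i)) g_one = g_scale (-1) (g_one :: 'a g_elem)"
    unfolding g_one_def tens_one_def g_map_generators(4)
    using tensor_linear(6)[of oct_one "s2_one :: 'a s2"] by (simp add: sign_c_def iota_minus)
  note lev = level_of_g_map[OF rel one _ z]
  have "T j y = g_map (\<lambda>_. id) (\<lambda>i. s2_scale (sign_c i)) (T j z)" for j
    unfolding y by (rule T_g_map[OF rel]) (simp_all add: fun_eq_iff T_s2_linear)
  then have "T j y = g_scale (T_eig j g) y" for j
    using z by (simp add: y \<Gamma>_iff g_map_scale)
  moreover have "T_eig j (case g of (k, u, n) \<Rightarrow> (k, u, - n)) = T_eig j g" for j
    by (cases g; cases j) (simp_all add: T_eig_def)
  ultimately show "y \<in> \<Gamma> (case g of (k, u, n) \<Rightarrow> (k, u, - n))"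
    unfolding \<Gamma>_iff using lev by (cases g) (simp add: y)
qed

lemma realises_shift_1: "realises (shift_deg 1 0)"
proof -
  \<comment> \<open>The two diagonal entries i and -i have product 1, as an isometry of the norm ab
    requires.\<close>
  define b :: "3 \<Rightarrow> 'a s2 \<Rightarrow> 'a s2" where
    "b i x = (if i = 0 then x else if i = 1 then (im * fst x, - im * snd x) else (- im * fst x, im
        * snd x))" for i x
  have bT: "b \<in> S2.Tri"
  proof (rule S2.TriI)
    show "bij (b i)" for i
      by (rule o_bij[of "\<lambda>x. if i = 0 then x else - b i x"])
        (auto simp: b_def fun_eq_iff im_im)
    show "b i (x + y) = b i x + b i y" "b i (s2_scale c x) = s2_scale c (b i x)" for i x y c
      by (auto simp: b_def s2_scale_def case_prod_beta algebra_simps)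
    show "s2_B (b i x) (b i y) = s2_B x y" for i x y
    proof -
      have im2: "im * x * (im * y) = - (x * y)" for x y
      proof -
        have "im * x * (im * y) = im * im * (x * y)" by (simp add: mult.commute mult.left_commute)
        then show ?thesis by (simp add: im_im(1))
      qed
      show ?thesis by (cases x; cases y) (simp add: b_def s2_polar_eq im2)
    qed
    show "b 0 (S2_mult x y) = S2_mult (b 1 x) (b 2 y)" for x y
    proof -
      have im2: "im * x * (im * y) = - (x * y)" for x y
      proof -
        have "im * x * (im * y) = im * im * (x * y)" by (simp add: mult.commute mult.left_commute)
        then show ?thesis by (simp add: im_im(1))
      qed
      show ?thesis by (cases x; cases y) (simp add: b_def S2_mult_eq im2)
    qed
  qed
  have rel: "related_triples (\<lambda>_. id) b" by unfold_locales (rule S8.Tri_id bT)+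
  interpret related_triples "\<lambda>_. id" b by (rule rel)
  show ?thesis
  proof (rule realises_shift[OF rel])
    show "g_map (\<lambda>_. id) b g_one = g_one"
      unfolding g_one_def tens_one_def g_map_generators(4) by (simp add: b_def)
    fix j z assume zc: "z \<in> (g_carrier :: 'a g_elem set)"
    show "T j (g_map (\<lambda>_. id) b z) = g_map (\<lambda>_. id) b
      (if (case j of None \<Rightarrow> 1 | Some i \<Rightarrow> 0 $ i) = (0 :: 2) then T j z else g_parity (T j z))"
    proof (cases j)
      case (Some i)
      have "T j (g_map (\<lambda>_. id) b z) = g_map (\<lambda>_. id) b (T j z)"
        by (rule T_g_map[OF rel]) (simp_all add: Some fun_eq_iff T_s2_def)
      then show ?thesis by (simp add: Some)
    next
      case None
      \<comment> \<open>The swap anticommutes with components 1 and 2 of b, whence the signs (1, -1,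
        -1) of parity.\<close>
      have "T_s2 None \<circ> b i = b i \<circ> s2_scale (sign012 i) \<circ> T_s2 None" for i
        by (auto simp: fun_eq_iff T_s2_def b_def s2_swap_def sign012_def s2_scale_def
            case_prod_beta)
      then have "T j (g_map (\<lambda>_. id) b z) = g_map (\<lambda>_. id) b (g_map (\<lambda>_. id) (\<lambda>i. s2_scale
          (sign012 i)) (T j z))"
        unfolding T_eq None g_map_comp[OF T_related rel] g_map_comp[OF sign_related(2) T_related]
        by (subst g_map_comp[OF rel]) (simp_all add: comp_assoc related_triples_def S8.Tri_comp
            S2.Tri_comp
          sign_related(2)[unfolded related_triples_def] T_related[unfolded related_triples_def])
      then show ?thesis by (simp add: None g_parity_eq(2) T_carrier[OF zc])
    qed
  qed
qed

text \<open>In components 1 and 2 of the reflection triple c = X_v occurs once, so moving F_i across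
  costs its sign on c; in component 0 it occurs twice and no sign appears. Component 0 sends 1 to
  -1, which \<open>sign_c\<close> on the other factor compensates.\<close>

lemma realises_shift_0:
  assumes "v \<noteq> 0" shows "realises (shift_deg 0 v)"
proof -
  define c where "c = X v"
  define a where "a = S8.refl_triple c oct_one"
  define b :: "3 \<Rightarrow> 'a s2 \<Rightarrow> 'a s2" where "b i = s2_scale (sign_c i)" for i
  have c2: "oct_B c c = 2" by (simp add: c_def X_orth)
  have aT: "a \<in> S8.Tri" unfolding a_def by (rule S8.refl_triple_Tri[OF c2 oct_polar_one_one])
  have rel: "related_triples a b"
    using sign_related(3) aT unfolding related_triples_def b_def by blast
  interpret related_triples a b by (rule rel)
  have sgc: "sg i c = oct_scale (sgn2 (v $ i)) c" for i by (simp add: c_def sg_X)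
  have sg_refl: "sg i (S8.refl x z) = S8.refl x (sg i z)" if "sg i x = x \<or> sg i x = - x" for i x z
  proof -
    have "oct_B x z = oct_B (sg i x) (sg i z)" by (simp add: sg_auto)
    moreover have "sg i (- y) = - sg i y" for y using sg_linear(2)[of i "-1" y] by simp
    moreover have "sg i (y - y') = sg i y - sg i y'" for y y'
      using sg_linear(1)[of i "y - y'" y'] by (simp add: eq_diff_eq)
    ultimately show ?thesis using that by (auto simp: S8.refl_def sg_linear S8.B_linear)
  qed
  have sg_mult: "sg i (S8_mult x y) = S8_mult (sg i x) (sg i y)" for i x y
    by (simp add: S8_mult_def sg_auto)
  have comm_a: "sg i (a m x) = a m (oct_scale (if v $ i = 0 then 1 else sign012 m) (sg i x))" for
      i m x
  proof (cases "m = 0")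
    case True
    have "sg i c = c \<or> sg i c = - c" using cases_2[of "v $ i"] by (auto simp: sgc)
    then show ?thesis
      using True by (simp add: a_def S8.refl_triple_def sg_refl sg_auto(4) sign012_def)
  next
    case False
    then show ?thesis
      using cases_2[of "v $ i"]
      by (auto simp: a_def S8.refl_triple_def sg_mult sg_auto(4) sgc sign012_def S8.m_linear)
  qed
  show ?thesis
  proof (rule realises_shift[OF rel])
    have "S8.refl oct_one oct_one = (oct_one :: 'a oct)"
      using oct.scale_left_distrib[of 1 1 "oct_one :: 'a oct"] by (simp add: S8.refl_def
          oct_polar_one_one)
    moreover have "S8.refl c oct_one = - oct_one"
      using imag_unitD(1)[OF imag_unit_X[OF assms]] by (simp add: S8.refl_def c_def)
    ultimately have "a 0 oct_one = - oct_one" by (simp add: a_def S8.refl_triple_def)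
    moreover have "b 0 s2_one = - s2_one" by (simp add: b_def sign_c_def)
    ultimately show "g_map a b g_one = g_one"
      unfolding g_one_def tens_one_def g_map_generators(4)
      using tensor_linear(6)[of oct_one "s2_one :: 'a s2"] by (simp add: tensor_linear)
    fix j z assume zc: "z \<in> (g_carrier :: 'a g_elem set)"
    show "T j (g_map a b z) = g_map a b
      (if (case j of None \<Rightarrow> 0 | Some i \<Rightarrow> v $ i) = (0 :: 2) then T j z else g_parity (T j z))"
    proof (cases "(case j of None \<Rightarrow> 0 | Some i \<Rightarrow> v $ i) = (0 :: 2)")
      case True
      have "T j (g_map a b z) = g_map a b (T j z)"
      proof (rule T_g_map[OF rel])
        show "T_oct j \<circ> a i = a i \<circ> T_oct j" for i
          using True by (cases j) (simp_all add: T_oct_def fun_eq_iff comm_a)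
      qed (simp add: b_def fun_eq_iff T_s2_linear)
      then show ?thesis using True by simp
    next
      case False
      then obtain i where j: "j = Some i" and vi: "v $ i \<noteq> 0" by (cases j) auto
      have "T_oct j \<circ> a m = a m \<circ> (oct_scale (sign012 m) \<circ> T_oct j)" for m
        using vi by (simp add: fun_eq_iff j T_oct_def comm_a)
      moreover have "T_s2 j \<circ> b m = b m \<circ> (id \<circ> T_s2 j)" for m
        by (simp add: j T_s2_def)
      moreover have "related_triples (\<lambda>m. oct_scale (sign012 m) \<circ> T_oct j) (\<lambda>m. id \<circ> T_s2 j)"
        using sign_related(1) T_related[of j] S8.Tri_comp S2.Tri_comp
        unfolding related_triples_def by blast
      ultimately have "T j (g_map a b z) = g_map a b (g_map (\<lambda>m. oct_scale (sign012 m)) (\<lambda>_. id)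
          (T j z))"
        unfolding T_eq g_map_comp[OF T_related rel] g_map_comp[OF sign_related(1) T_related]
        by (subst g_map_comp[OF rel]) simp_all
      then show ?thesis using False by (simp add: g_parity_eq(1) T_carrier[OF zc])
    qed
  qed
qed

text \<open>\<Phi> sends X_v to X_{Av} up to sign, so F_i \<Phi> equals \<Phi> composed with the
  product of those F_j for which A_ij = 1. In degree u the eigenvalue of that product is the sign of
  (Au)_i.\<close>

lemma realises_frame_change:
  assumes "invertible A" shows "realises (\<lambda>(k, u, n). (k, A *v u, n))"
proof -
  define \<Phi> where "\<Phi> = oct_Phi e (frame_change e A)"
  note frame' = frame_change_frame[OF assms]
  have rel: "related_triples (\<lambda>_. \<Phi>) (\<lambda>_. id)"
    unfolding related_triples_def \<Phi>_def using oct_Phi_Tri[OF frame frame'] S2.Tri_id by blast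
  interpret related_triples "\<lambda>_. \<Phi>" "\<lambda>_. id" by (rule rel)
  \<comment> \<open>\<open>to\<close> and \<open>tt\<close> are powers of F_j on octonions and on
    the Lie algebra; \<open>sgA i\<close> is the product prescribed by row i of A.\<close>
  define to where "to p j = (if p = 0 then id else sg j)" for p :: 2 and j
  define sgA where "sgA i = to (A $ i $ 0) 0 \<circ> (to (A $ i $ 1) 1 \<circ> to (A $ i $ 2) 2)" for i
  define tt where "tt p j = (if p = 0 then id else T (Some j))" for p :: 2 and j
  have to_rel: "related_triples (\<lambda>_. to p j) (\<lambda>_. id)" for p j
    using T_related[of "Some j"] S8.Tri_id S2.Tri_id
    by (auto simp: to_def related_triples_def T_oct_def T_s2_def)
  have tt: "tt p j z = g_map (\<lambda>_. to p j) (\<lambda>_. id) z" for p j z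
    by (simp add: tt_def to_def g_map_id T_eq T_oct_def T_s2_def)
  have to2_rel: "related_triples (\<lambda>_. to p j \<circ> to p' j') (\<lambda>_. id)" for p j p' j'
    using to_rel[of p j] to_rel[of p' j'] S8.Tri_comp[of "\<lambda>_. to p j" "\<lambda>_. to p' j'"]
    unfolding related_triples_def by blast
  have sgA_rel: "related_triples (\<lambda>_. sgA i) (\<lambda>_. id)" for i
    using to_rel[of "A $ i $ 0" 0] to2_rel[of "A $ i $ 1" 1 "A $ i $ 2" 2]
      S8.Tri_comp[of "\<lambda>_. to (A $ i $ 0) 0" "\<lambda>_. to (A $ i $ 1) 1 \<circ> to (A $ i $ 2) 2"]
    unfolding related_triples_def sgA_def by blast
  have ttt: "g_map (\<lambda>_. sgA i) (\<lambda>_. id) z = tt (A $ i $ 0) 0 (tt (A $ i $ 1) 1 (tt (A $ i $ 2) 2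
      z))" for i z
    unfolding tt sgA_def g_map_comp[OF to_rel to_rel] id_o by (subst g_map_comp[OF to_rel
        to2_rel]) simp
  have mv: "(A *v u) $ i = A $ i $ 0 * u $ 0 + A $ i $ 1 * u $ 1 + A $ i $ 2 * u $ 2" for u i
    by (simp add: matrix_vector_mult_def sum_UNIV_3)
  have to_X: "to p j (X v) = oct_scale (sgn2 (p * v $ j)) (X v)" for p j v
    using cases_2[of p] by (auto simp: to_def sg_X)
  have to_lin: "to p j (oct_scale c x) = oct_scale c (to p j x)" "to p j (x + y) = to p j x + to p
      j y" for p j c x y
    by (simp_all add: to_def sg_linear)
  have \<Phi>X: "\<Phi> (X v) = X (A *v v) \<or> \<Phi> (X v) = - X (A *v v)" for v
    unfolding \<Phi>_def oct_Phi_X[OF frame] by (rule oct_X_frame_change)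
  have \<Phi>_lin: "\<Phi> (x + y) = \<Phi> x + \<Phi> y" "\<Phi> (oct_scale c x) = oct_scale c (\<Phi> x)" for x y c
    by (simp_all add: \<Phi>_def oct_Phi_linear)
  have comm: "sg i (\<Phi> x) = \<Phi> (sgA i x)" for i x
  proof (induction x rule: X_induct)
    case (3 v)
    have "sgA i (X v) = oct_scale (sgn2 ((A *v v) $ i)) (X v)"
      by (simp add: sgA_def to_X to_lin mv mult.commute mult.left_commute)
    moreover have "sg i (- X u) = - sg i (X u)" for u using sg_linear(2)[of i "-1" "X u"] by simp
    ultimately show ?case using \<Phi>X[of v] by (auto simp: \<Phi>_lin sg_X)
  qed (simp_all add: \<Phi>_lin sg_linear sgA_def to_lin)
  show ?thesis
    unfolding realises_def
  proof (intro exI conjI allI subsetI)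
    fix g y assume "y \<in> g_map (\<lambda>_. \<Phi>) (\<lambda>_. id) ` \<Gamma> g"
    then obtain z where y: "y = g_map (\<lambda>_. \<Phi>) (\<lambda>_. id) z" and z: "z \<in> \<Gamma> g" by blast
    obtain k u n where g: "g = (k, u, n)" by (cases g) auto
    have zT: "T j z = g_scale (T_eig j g) z" for j using z by (simp add: \<Gamma>_iff)
    have one: "g_map (\<lambda>_. \<Phi>) (\<lambda>_. id) g_one = (g_one :: 'a g_elem)"
      unfolding g_one_def tens_one_def g_map_generators(4)
      using oct_Phi_automorphism(4)[OF frame frame'] by (simp add: \<Phi>_def)
    note lev = level_of_g_map[OF rel _ _ z, of 1, unfolded g.scale_one mult_1, OF one refl]
    have ttz: "tt p j (g_scale c z) = g_scale (sgn2 (p * u $ j) * c) z" for p j c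
      using cases_2[of p] zT[of "Some j"] by (auto simp: tt_def T_scale T_eig_def g mult.commute)
    have "T j y = g_scale (T_eig j (k, A *v u, n)) y" for j
    proof (cases j)
      case None
      have "T None y = g_map (\<lambda>_. \<Phi>) (\<lambda>_. id) (T None z)"
        unfolding y by (rule T_g_map[OF rel]) (simp_all add: T_oct_def)
      then show ?thesis by (simp add: None zT y g_map_scale T_eig_def g)
    next
      case (Some i)
      have "T (Some i) y = g_map (\<lambda>_. \<Phi>) (\<lambda>_. id) (g_map (\<lambda>_. sgA i) (\<lambda>_. id) z)"
        unfolding y T_eq g_map_comp[OF T_related rel] g_map_comp[OF rel sgA_rel]
        by (simp add: T_oct_def T_s2_def comp_def comm)
      moreover have "g_map (\<lambda>_. sgA i) (\<lambda>_. id) z = g_scale (sgn2 ((A *v u) $ i)) z"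
        using ttz[of "A $ i $ 2" 2 1] by (simp add: ttt ttz mv mult.assoc)
      ultimately have "T (Some i) y = g_scale (sgn2 ((A *v u) $ i)) y"
        unfolding y by (simp only: g_map_scale)
      then show ?thesis by (simp add: Some T_eig_def)
    qed
    then show "y \<in> \<Gamma> (case g of (k, u, n) \<Rightarrow> (k, A *v u, n))"
      using lev unfolding \<Gamma>_iff y by (simp add: g)
  qed (rule rel)
qed

end

section \<open>The Weyl group\<close>

text \<open>The action of \<open>Weyl_model\<close> on \<open>G2\<close> by the matrices of the
  theorem. The sign is stored in Z_2, and the terms with b and D do not see it because n and -n
  agree modulo 2.\<close>

definition Waff :: "(2 \<times> (2 ^ 3)) \<times> (2 ^ 3 ^ 3) \<times> 2 \<Rightarrow> G2 \<Rightarrow> G2" where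
  "Waff = (\<lambda>((b, D), A, c) (k, u, n).
     (k + of_int n * b, A *v u + of_int n *s D, if c = 0 then n else - n))"

lemma carrier_Weyl_model: "m \<in> carrier Weyl_model \<longleftrightarrow> invertible (fst (snd m))"
  by (cases m) (simp add: Weyl_model_def semidirect_def GL3_Z2_def DirProd_def)

lemma mult_Weyl_model:
  "((b, D), A, c) \<otimes>\<^bsub>Weyl_model\<^esub> ((b', D'), A', c') = ((b + b', D + A *v D'), A ** A', c + c')"
  by (simp add: Weyl_model_def semidirect_def GL3_Z2_def DirProd_def)

lemma one_Weyl_model: "\<one>\<^bsub>Weyl_model\<^esub> = ((0, 0), mat 1, 0)"
  by (simp add: Weyl_model_def semidirect_def GL3_Z2_def DirProd_def zero_prod_def)

lemma minus_2 [simp]: "- (x :: 2) = x"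
  using cases_2[of x] by auto

lemma Waff_one: "Waff \<one>\<^bsub>Weyl_model\<^esub> = id"
  by (auto simp: Waff_def one_Weyl_model fun_eq_iff)

lemma Waff_mult: "Waff (m \<otimes>\<^bsub>Weyl_model\<^esub> m') = Waff m \<circ> Waff m'"
proof -
  obtain b D A c where m: "m = ((b, D), A, c)" by (cases m) auto
  obtain b' D' A' c' where m': "m' = ((b', D'), A', c')" by (cases m') auto
  have "(if c + c' = 0 then n else - n) = (if c = 0 then if c' = 0 then n else - n else - (if c' =
      0 then n else - n))" for n :: int
    using cases_2[of c] cases_2[of c'] by auto
  moreover have "A *v (p *s x) = p *s (A *v x)" for p :: 2 and x
    using cases_2[of p] by auto
  moreover have "p *s (x + y) = p *s x + p *s y" for p :: 2 and x y :: "2 ^ 3"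
    by (rule vector_add_ldistrib)
  ultimately have "Waff (m \<otimes>\<^bsub>Weyl_model\<^esub> m') (k, u, n) = Waff m (Waff m' (k, u, n))" for k u n
    by (simp add: m m' mult_Weyl_model Waff_def matrix_vector_right_distrib
        matrix_vector_mul_assoc[symmetric] algebra_simps)
  then show ?thesis by (auto simp: fun_eq_iff)
qed

lemma Waff_add: "Waff m (g + h) = Waff m g + Waff m h"
proof -
  obtain b D A c where m: "m = ((b, D), A, c)" by (cases m) auto
  show ?thesis
    by (cases g; cases h)
      (simp add: m Waff_def matrix_vector_right_distrib distrib_right vec3_eq_iff)
qed

lemma Waff_inj:
  assumes "Waff m = Waff m'" shows "m = m'"
proof -
  obtain b D A c where m: "m = ((b, D), A, c)" by (cases m) auto
  obtain b' D' A' c' where m': "m' = ((b', D'), A', c')" by (cases m') auto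
  have "A *v u = A' *v u" for u
    using fun_cong[OF assms, of "(0, u, 0)"] by (simp add: m m' Waff_def)
  then have "A = A'" by (simp add: matrix_eq)
  then show ?thesis
    using fun_cong[OF assms, of "(0, 0, 1)"] cases_2[of c] cases_2[of c']
    by (auto simp: m m' Waff_def split: if_splits)
qed

text \<open>\<open>Waff\<close> is faithful and multiplicative, so associativity and the unit law
  are inherited from composition of functions.\<close>

lemma group_Weyl_model: "group Weyl_model"
proof (rule groupI)
  fix x y z :: "(2 \<times> (2 ^ 3)) \<times> (2 ^ 3 ^ 3) \<times> 2"
  show "\<one>\<^bsub>Weyl_model\<^esub> \<in> carrier Weyl_model"
    by (simp add: carrier_Weyl_model one_Weyl_model invertible_def exI[of _ "mat 1"])
  show "\<one>\<^bsub>Weyl_model\<^esub> \<otimes>\<^bsub>Weyl_model\<^esub> x = x"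
    by (rule Waff_inj) (simp add: Waff_mult Waff_one)
  show "x \<otimes>\<^bsub>Weyl_model\<^esub> y \<otimes>\<^bsub>Weyl_model\<^esub> z = x \<otimes>\<^bsub>Weyl_model\<^esub> (y \<otimes>\<^bsub>Weyl_model\<^esub> z)"
    by (rule Waff_inj) (simp add: Waff_mult comp_assoc)
  obtain b D A c where x: "x = ((b, D), A, c)" by (cases x) auto
  obtain b' D' A' c' where y: "y = ((b', D'), A', c')" by (cases y) auto
  assume "x \<in> carrier Weyl_model"
  then have A: "invertible A" by (simp add: carrier_Weyl_model x)
  show "x \<otimes>\<^bsub>Weyl_model\<^esub> y \<in> carrier Weyl_model" if "y \<in> carrier Weyl_model"
    using that A by (simp add: x y mult_Weyl_model carrier_Weyl_model invertible_mult)
  obtain A1 where A1: "A ** A1 = mat 1" "A1 ** A = mat 1" using A unfolding invertible_def by blast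
  have "((b, - (A1 *v D)), A1, c) \<otimes>\<^bsub>Weyl_model\<^esub> x = \<one>\<^bsub>Weyl_model\<^esub>"
    by (simp add: x mult_Weyl_model one_Weyl_model A1)
  moreover have "invertible A1" using A1 unfolding invertible_def by blast
  ultimately show "\<exists>y\<in>carrier Weyl_model. y \<otimes>\<^bsub>Weyl_model\<^esub> x = \<one>\<^bsub>Weyl_model\<^esub>"
    by (intro bexI[of _ "((b, - (A1 *v D)), A1, c)"]) (simp_all add: carrier_Weyl_model)
qed

lemma Waff_inverse:
  assumes "m \<in> carrier Weyl_model"
  shows "\<exists>m'\<in>carrier Weyl_model. (\<forall>g. Waff m (Waff m' g) = g) \<and> (\<forall>g. Waff m' (Waff m g) = g)"
proof (intro bexI conjI allI)
  interpret group Weyl_model by (rule group_Weyl_model)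
  show "inv\<^bsub>Weyl_model\<^esub> m \<in> carrier Weyl_model" using assms by simp
  show "Waff m (Waff (inv\<^bsub>Weyl_model\<^esub> m) g) = g" "Waff (inv\<^bsub>Weyl_model\<^esub> m) (Waff m g) = g" for g
    using fun_cong[OF Waff_mult[of m "inv\<^bsub>Weyl_model\<^esub> m"], of g]
      fun_cong[OF Waff_mult[of "inv\<^bsub>Weyl_model\<^esub> m" m], of g] assms
    by (simp_all add: Waff_one)
qed

lemma Waff_auto:
  assumes "m \<in> carrier Weyl_model" shows "Waff m \<in> auto additive_group"
proof -
  obtain m' where "m' \<in> carrier Weyl_model" and m': "\<And>g. Waff m (Waff m' g) = g" "\<And>g. Waff m'
      (Waff m g) = g"
    using Waff_inverse[OF assms] by blast
  have "Waff m' \<circ> Waff m = id" "Waff m \<circ> Waff m' = id"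
    by (rule ext, simp only: comp_apply id_apply m')+
  then have "bij (Waff m)" by (rule o_bij)
  moreover have "Waff m \<in> hom additive_group additive_group"
    by (rule homI) (simp_all only: additive_group_simps Waff_add UNIV_I)
  ultimately show ?thesis by (simp only: auto_def Bij_def additive_group_simps extensional_UNIV
      Int_iff mem_Collect_eq UNIV_I simp_thms)
qed

lemma matrix_of_Waff:
  "matrix_of (Waff ((b, D), A, c)) = ((1, 0, b), (0, A, D), (0, 0, if c = 0 then 1 else - 1))"
proof -
  have "(\<chi> i j. (A *v axis j 1) $ i) = A"
    by (simp add: vec_eq_iff matrix_vector_mult_def axis_def if_distrib cong: if_cong)
  then show ?thesis by (simp add: matrix_of_def Waff_def vec_eq_iff)
qed

text \<open>Over Z_2 additivity already gives linearity, as 0 and 1 are the only scalars.\<close>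

lemma additive_matrix:
  fixes f :: "2 ^ 3 \<Rightarrow> 2 ^ 3"
  assumes "\<And>u v. f (u + v) = f u + f v"
  obtains A where "\<And>u. f u = A *v u"
proof
  fix u
  have 0: "f 0 = 0" using assms[of 0 0] by simp
  have s: "f (p *s v) = p *s f v" for p v using cases_2[of p] 0 by auto
  have "f u = u $ 1 *s f (axis 1 1) + u $ 2 *s f (axis 2 1) + u $ 0 *s f (axis 0 1)"
    by (subst vec3_axis_expand[of u]) (simp only: assms s)
  then show "f u = (\<chi> i j. f (axis j 1) $ i) *v u"
    by (simp add: vec_eq_iff matrix_vector_mult_def sum_UNIV_3 algebra_simps)
qed

text \<open>The space is finite, so the map is bijective, and its additive inverse is again given by
  a matrix.\<close>

lemma injective_matrix_invertible:
  fixes A :: "2 ^ 3 ^ 3"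
  assumes "inj ((*v) A)" shows "invertible A"
proof -
  have "surj ((*v) A)" by (rule finite_UNIV_inj_surj[OF _ assms]) simp
  then have r: "A *v (inv_into UNIV ((*v) A) u) = u" for u by (simp add: surj_f_inv_f)
  have "inv_into UNIV ((*v) A) (u + v) = inv_into UNIV ((*v) A) u + inv_into UNIV ((*v) A) v" for
      u v
    by (rule injD[OF assms]) (simp add: r matrix_vector_right_distrib)
  then obtain A1 where A1: "\<And>u. inv_into UNIV ((*v) A) u = A1 *v u"
    using additive_matrix[of "inv_into UNIV ((*v) A)"] by metis
  have "A ** A1 = mat 1" using r by (simp add: matrix_eq matrix_vector_mul_assoc[symmetric] A1)
  moreover have "A1 ** A = mat 1"
    using inv_into_f_f[OF assms] by (simp add: matrix_eq matrix_vector_mul_assoc[symmetric]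
        A1[symmetric])
  ultimately show ?thesis unfolding invertible_def by blast
qed

lemma G2_induct [case_names level0 one add minus]:
  fixes g :: G2
  assumes "\<And>k u. P (k, u, 0)" "P (0, 0, 1)" "\<And>g h. P g \<Longrightarrow> P h \<Longrightarrow> P (g + h)" "\<And>g. P g \<Longrightarrow> P (- g)"
  shows "P g"
proof -
  have "P (0, 0, n)" for n
  proof (induction n rule: int_induct[where k = 0])
    case (step1 i)
    then show ?case using assms(3)[OF _ assms(2)] by fastforce
  next
    case (step2 i)
    then show ?case using assms(3)[OF _ assms(4)[OF assms(2)]] by fastforce
  qed (rule assms(1))
  then show ?thesis using assms(3)[OF assms(1)[of "fst g" "fst (snd g)"], of "(0, 0, snd (snd g))"]
    by (cases g) simp
qed

section \<open>From automorphisms of the grading to matrices and back\<close>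

context gamma2
begin

abbreviation auts :: "('a g_elem \<Rightarrow> 'a g_elem) set" where
  "auts \<equiv> algebra_on.automorphisms g_carrier g_scale g_bracket"

abbreviation Aut\<Gamma> :: "('a g_elem \<Rightarrow> 'a g_elem) set" where
  "Aut\<Gamma> \<equiv> algebra_on.Aut_grading g_carrier g_scale g_bracket G \<Gamma>"

lemma autsD:
  assumes "f \<in> auts"
  shows "f \<in> Bij g_carrier" "bij_betw f g_carrier g_carrier"
    "x \<in> g_carrier \<Longrightarrow> y \<in> g_carrier \<Longrightarrow> f (x + y) = f x + f y"
    "x \<in> g_carrier \<Longrightarrow> f (g_scale c x) = g_scale c (f x)"
    "x \<in> g_carrier \<Longrightarrow> y \<in> g_carrier \<Longrightarrow> f (g_bracket x y) = g_bracket (f x) (f y)"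
    "x \<in> g_carrier \<Longrightarrow> f x \<in> g_carrier"
proof -
  show "f \<in> Bij g_carrier"
    and "x \<in> g_carrier \<Longrightarrow> y \<in> g_carrier \<Longrightarrow> f (x + y) = f x + f y"
    and "x \<in> g_carrier \<Longrightarrow> f (g_scale c x) = g_scale c (f x)"
    and "x \<in> g_carrier \<Longrightarrow> y \<in> g_carrier \<Longrightarrow> f (g_bracket x y) = g_bracket (f x) (f y)"
    using assms unfolding algebra_on.automorphisms_def by blast+
  then show b: "bij_betw f g_carrier g_carrier" by (simp add: Bij_def)
  show "x \<in> g_carrier \<Longrightarrow> f x \<in> g_carrier" using bij_betwE[OF b] by blast
qed

lemma auts_zero: "f \<in> auts \<Longrightarrow> f 0 = 0"
  using autsD(4)[of f 0 0] g_carrier_closed(3) by simp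

lemma auts_eq_0: "f \<in> auts \<Longrightarrow> x \<in> g_carrier \<Longrightarrow> f x = 0 \<longleftrightarrow> x = 0"
  using auts_zero[of f] autsD(2)[of f] g_carrier_closed(3)
  by (metis bij_betw_imp_inj_on inj_on_eq_iff)

lemma image_supp:
  assumes "f \<in> auts" "f ` \<Gamma> s = \<Gamma> t" shows "s \<in> supp \<longleftrightarrow> t \<in> supp"
  using auts_eq_0[OF assms(1)] \<Gamma>_V[of s] unfolding Supp_iff assms(2)[symmetric] by blast

lemma realises_Waff:
  assumes "m \<in> carrier Weyl_model" shows "realises (Waff m)"
proof -
  obtain b D A c where m: "m = ((b, D), A, c)" by (cases m) auto
  have A: "invertible A" using assms by (simp add: carrier_Weyl_model m)
  have id: "realises id"
    unfolding realises_def
    by (intro exI[of _ "\<lambda>_. id"]) (auto simp: related_triples_def S8.Tri_id S2.Tri_id g_map_id)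
  have "realises (shift_deg b 0)"
  proof (cases "b = 0")
    case True
    then have "shift_deg b 0 = id" by (simp add: shift_deg_def fun_eq_iff)
    then show ?thesis using id by simp
  next
    case False
    then have "b = 1" using cases_2[of b] by simp
    then show ?thesis using realises_shift_1 by simp
  qed
  moreover have "realises (shift_deg 0 D)"
  proof (cases "D = 0")
    case True
    then have "shift_deg 0 D = id" by (simp add: shift_deg_def fun_eq_iff)
    then show ?thesis using id by simp
  qed (rule realises_shift_0)
  moreover have "realises (if c = 0 then id else (\<lambda>(k, u, n). (k, u, - n)))"
    using id realises_negation by simp
  \<comment> \<open>The block triangular matrix factored into its two unipotent columns, the block A
    and the sign.\<close>
  moreover have "Waff m = shift_deg b 0 \<circ> shift_deg 0 D \<circ> (\<lambda>(k, u, n). (k, A *v u, n)) \<circ>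
    (if c = 0 then id else (\<lambda>(k, u, n). (k, u, - n)))"
    by (auto simp: m Waff_def shift_deg_def fun_eq_iff)
  ultimately show ?thesis
    using realises_frame_change[OF A] by (simp only: realises_comp)
qed

lemma Waff_realised:
  assumes "m \<in> carrier Weyl_model"
  shows "\<exists>f\<in>auts. \<forall>g. f ` \<Gamma> g = \<Gamma> (Waff m g)"
proof -
  obtain a b where rel: "related_triples a b" and sub: "\<And>g. g_map a b ` \<Gamma> g \<subseteq> \<Gamma> (Waff m g)"
    using realises_Waff[OF assms] unfolding realises_def by blast
  interpret related_triples a b by (rule rel)
  define f where "f = restrict (g_map a b) g_carrier"
  have f: "f \<in> auts" unfolding f_def by (rule g_map_automorphism)
  obtain m' where "m' \<in> carrier Weyl_model" and m': "\<And>g. Waff m (Waff m' g) = g" "\<And>g. Waff m'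
      (Waff m g) = g"
    using Waff_inverse[OF assms] by blast
  have "f ` \<Gamma> g = \<Gamma> (Waff m g)" for g
  proof (rule image_component[OF autsD(2)[OF f] autsD(3)[OF f]])
    show "inj (Waff m)" by (rule inj_on_inverseI) (rule m')
    show "f ` \<Gamma> g \<subseteq> \<Gamma> (Waff m g)" for g
      using sub[of g] \<Gamma>_V[of g] by (auto simp: f_def)
  qed
  then show ?thesis using f by blast
qed

lemma Waff_supp:
  assumes "m \<in> carrier Weyl_model" shows "Waff m s \<in> supp \<longleftrightarrow> s \<in> supp"
  using Waff_realised[OF assms] image_supp by blast

lemma Waff_unique:
  assumes "m \<in> carrier Weyl_model" "m' \<in> carrier Weyl_model" "\<And>s. s \<in> supp \<Longrightarrow> \<Gamma> (Waff m s) = \<Gamma>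
      (Waff m' s)"
  shows "m = m'"
proof (rule Waff_inj, rule ext)
  fix g show "Waff m g = Waff m' g"
  proof (induction g rule: supp_induct)
    case (1 s)
    then show ?case using Supp_inj assms Waff_supp by blast
  qed (simp only: Waff_add)
qed

text \<open>The degrees \<open>(k, u)\<close> of the components of level 2 are \<open>(1, 0)\<close> and all \<open>(0, u)\<close> with
  \<open>u \<noteq> 0\<close>. Among them \<open>(1, 0)\<close> is the only one whose sum with any other one does not lie in this
  set, hence it is fixed.\<close>

lemma additive_preserving_supp:
  assumes add: "\<And>g h. \<phi> (g + h) = \<phi> g + \<phi> h" and sup: "\<And>s. s \<in> supp \<Longrightarrow> \<phi> s \<in> supp"
    and inj: "inj_on \<phi> supp"
  shows "\<exists>m\<in>carrier Weyl_model. \<phi> = Waff m"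
proof -
  have zero: "\<phi> 0 = 0" using add[of 0 0] by simp
  \<comment> \<open>The map induced on Z_2 x Z_2^3, the torsion of \<open>G2\<close>, which any
    additive map preserves.\<close>
  define \<psi> where "\<psi> x = (fst (\<phi> (fst x, snd x, 0)), fst (snd (\<phi> (fst x, snd x, 0))))" for x
  have \<phi>0: "\<phi> (k, u, 0) = (fst (\<psi> (k, u)), snd (\<psi> (k, u)), 0)" for k u
  proof -
    have "\<phi> (k, u, 0) + \<phi> (k, u, 0) = 0" using add[of "(k, u, 0)" "(k, u, 0)"] zero
      by (simp add: zero_prod_def)
    then have "lev (\<phi> (k, u, 0)) + lev (\<phi> (k, u, 0)) = 0" by (metis snd_add snd_zero)
    then show ?thesis by (simp add: \<psi>_def prod_eq_iff)
  qed
  have \<psi>_add: "\<psi> (x + y) = \<psi> x + \<psi> y" for x y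
    using add[of "(fst x, snd x, 0)" "(fst y, snd y, 0)"] by (simp add: \<psi>_def)
  obtain b D c where c: "\<phi> (0, 0, 1) = (b, D, c)" by (cases "\<phi> (0, 0, 1)") auto
  have two: "\<phi> (k, u, 2) = (fst (\<psi> (k, u)), snd (\<psi> (k, u)), 2 * c)" for k u
  proof -
    have "((k, u, 2) :: G2) = (k, u, 0) + ((0, 0, 1) + (0, 0, 1))" by simp
    then have "\<phi> (k, u, 2) = \<phi> (k, u, 0) + (\<phi> (0, 0, 1) + \<phi> (0, 0, 1))" by (simp only: add)
    then show ?thesis by (simp add: \<phi>0 c)
  qed
  have top2: "(k, u, 2) \<in> supp" if "(k, u) \<in> top_degrees" for k u
    using supp_level_2(1)[of 1, OF _ that] by simp
  have t10: "(1, 0) \<in> top_degrees" and t0: "(0, u) \<in> top_degrees \<longleftrightarrow> u \<noteq> 0" and t1: "(1, u) \<in>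
      top_degrees \<longleftrightarrow> u = 0" for u
    by (simp_all add: top_degrees_iff)
  \<comment> \<open>For c = 0 the supported degrees (1, 0, 2) and (1, 0, 0) would have the same
    image.\<close>
  have "c \<noteq> 0"
  proof
    assume "c = 0"
    then have "\<phi> (1, 0, 2) = \<phi> (1, 0, 0)" by (simp add: two \<phi>0)
    then have "(1, 0, 2) = ((1, 0, 0) :: G2)"
      by (rule inj_onD[OF inj _ top2[OF t10] supp_level_0])
    then show False by simp
  qed
  \<comment> \<open>Level 2 goes to level 2c, which must again occur in the support.\<close>
  moreover have "\<bar>c\<bar> \<le> 1" using supp_level[OF sup[OF top2[OF t10]]] by (simp add: two) linarith
  ultimately have c1: "c = 1 \<or> c = -1" by linarith
  have \<psi>_top: "\<psi> x \<in> top_degrees" if "x \<in> top_degrees" for x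
    using supp_level[OF sup[OF top2[of "fst x" "snd x"]]] that c1 by (auto simp: two)
  have \<psi>_inj: "inj \<psi>"
  proof (rule injI)
    fix x y assume "\<psi> x = \<psi> y"
    then have "\<phi> (fst x, snd x, 0) = \<phi> (fst y, snd y, 0)" by (simp add: \<phi>0)
    then have "(fst x, snd x, 0) = ((fst y, snd y, 0) :: G2)"
      by (rule inj_onD[OF inj _ supp_level_0 supp_level_0])
    then show "x = y" by (simp add: prod_eq_iff)
  qed
  have "finite top_degrees" by simp
  then have "\<psi> ` top_degrees = top_degrees"
    using \<psi>_top by (intro endo_inj_surj) (auto intro: inj_on_subset[OF \<psi>_inj])
  then have \<psi>_top_iff: "\<psi> x \<in> top_degrees \<longleftrightarrow> x \<in> top_degrees" for x
    using \<psi>_inj by (metis inj_image_mem_iff)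
  have \<psi>10: "\<psi> (1, 0) = (1, 0)"
  proof (rule ccontr)
    assume ne: "\<psi> (1, 0) \<noteq> (1, 0)"
    obtain k p where kp: "\<psi> (1, 0) = (k, p)" by (cases "\<psi> (1, 0)")
    have "k = 0" "p \<noteq> 0"
      using \<psi>_top[OF t10] ne cases_2[of k] by (auto simp: kp top_degrees_iff)
    have ax: "axis 1 1 \<noteq> (0 :: 2 ^ 3)" "axis 2 1 \<noteq> (0 :: 2 ^ 3)" "axis 1 1 \<noteq> (axis 2 1 :: 2 ^ 3)"
      by (simp_all add: axis_eq_0_iff axis_eq_axis)
    then have "\<psi> (0, axis 1 1) \<noteq> \<psi> (0, axis 2 1)" using \<psi>_inj by (simp add: inj_eq)
    \<comment> \<open>Of two distinct nonzero vectors at least one is not sent to (1, 0). Adding (1,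
      0) to it gives a label outside the top degrees whose image lies inside, a
      contradiction.\<close>
    then obtain u where u: "u \<noteq> 0" "\<psi> (0, u) \<noteq> (1, 0)" using ax by metis
    obtain l r where lr: "\<psi> (0, u) = (l, r)" by (cases "\<psi> (0, u)")
    have "l = 0" "r \<noteq> 0"
      using \<psi>_top[of "(0, u)"] u cases_2[of l] by (auto simp: lr top_degrees_iff)
    have "\<psi> (0, u) \<noteq> \<psi> (1, 0)" using \<psi>_inj by (simp add: inj_eq)
    then have "p \<noteq> r" by (simp add: kp lr \<open>k = 0\<close> \<open>l = 0\<close>)
    then have "p + r \<noteq> 0" by (simp add: vec2_add_eq_0_iff)
    moreover have "\<psi> (1, u) = (0, p + r)"
      using \<psi>_add[of "(1, 0)" "(0, u)"] by (simp add: kp lr \<open>k = 0\<close> \<open>l = 0\<close>)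
    ultimately have "(1, u) \<in> top_degrees" using \<psi>_top_iff[of "(1, u)"] t0 by simp
    then show False using u t1 by simp
  qed
  define f where "f u = snd (\<psi> (0, u))" for u
  have \<psi>0: "\<psi> (0, u) = (0, f u)" for u
  proof (cases "u = 0")
    case True
    have "\<psi> (0, 0) = 0" using \<psi>_add[of 0 0] by (simp add: zero_prod_def)
    then show ?thesis by (simp add: True f_def prod_eq_iff)
  next
    case False
    have "\<psi> (0, u) \<noteq> \<psi> (1, 0)" using \<psi>_inj by (simp add: inj_eq)
    moreover have "\<psi> (0, u) \<in> top_degrees" using \<psi>_top t0 False by blast
    moreover obtain l r where "\<psi> (0, u) = (l, r)" by (cases "\<psi> (0, u)")
    ultimately show ?thesis using cases_2[of l] by (auto simp: \<psi>10 f_def top_degrees_iff)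
  qed
  have "f (u + v) = f u + f v" for u v using \<psi>_add[of "(0, u)" "(0, v)"] by (simp add: \<psi>0)
  then obtain A where A: "\<And>u. f u = A *v u" using additive_matrix[of f] by metis
  have "inj ((*v) A)"
  proof (rule injI)
    fix u v assume "A *v u = A *v v"
    then have "\<psi> (0, u) = \<psi> (0, v)" by (simp add: \<psi>0 A)
    then show "u = v" using \<psi>_inj by (simp add: inj_eq)
  qed
  then have inv: "invertible A" by (rule injective_matrix_invertible)
  have \<psi>_eq: "\<psi> (k, u) = (k, A *v u)" for k u
    using cases_2[of k] \<psi>_add[of "(1, 0)" "(0, u)"] by (auto simp: \<psi>0 \<psi>10 A)
  define m where "m = ((b, D), A, if c = 1 then 0 else 1 :: 2)"
  have "\<phi> g = Waff m g" for g
  proof (induction g rule: G2_induct)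
    case (level0 k u)
    show ?case by (simp add: \<phi>0 \<psi>_eq m_def Waff_def)
  next
    case one
    show ?case using c1 by (auto simp: c m_def Waff_def)
  next
    case (add g h)
    then show ?case by (simp only: assms(1) Waff_add)
  next
    case (minus g)
    have "\<phi> (- g) = - \<phi> g" using assms(1)[of g "- g"] zero by (simp add: eq_neg_iff_add_eq_0
        add.commute)
    moreover have "Waff m (- g) = - Waff m g"
      using Waff_add[of m g "- g"] Waff_add[of m 0 0] by (simp add: eq_neg_iff_add_eq_0 add.commute)
    ultimately show ?case using minus by simp
  qed
  then have "\<phi> = Waff m" by blast
  moreover have "m \<in> carrier Weyl_model" by (simp add: carrier_Weyl_model m_def inv)
  ultimately show ?thesis by blast
qed

end

context gamma2
begin

lemma Aut_grading_iff:
  "f \<in> Aut\<Gamma> \<longleftrightarrow> f \<in> auts \<and> (`) f ` (\<Gamma> ` supp) = \<Gamma> ` supp"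
  by (simp add: algebra_on.Aut_grading_def algebra_on.components_def)

text \<open>All axioms are transported along f. The transported grading serves as a second
  realization over the same group, to which universality is applied.\<close>

lemma image_graded_space:
  assumes f: "f \<in> auts"
  shows "graded_space g_scale g_carrier g_bracket (\<lambda>g. f ` \<Gamma> g)"
proof
  note D = autsD[OF f]
  have inj: "inj_on f g_carrier" using D(2) by (rule bij_betw_imp_inj_on)
  have \<Gamma>c: "x \<in> \<Gamma> g \<Longrightarrow> x \<in> g_carrier" for x g using \<Gamma>_V by blast
  show "g.subspace g_carrier" by (rule g_subspace)
  show "g.subspace (f ` \<Gamma> g)" for g
  proof (rule g.subspaceI)
    show "0 \<in> f ` \<Gamma> g" using auts_zero[OF f] zero_\<Gamma> by (metis imageI)
    show "x + y \<in> f ` \<Gamma> g" if xy: "x \<in> f ` \<Gamma> g" "y \<in> f ` \<Gamma> g" for x y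
    proof -
      obtain a b where a: "a \<in> \<Gamma> g" "x = f a" and b: "b \<in> \<Gamma> g" "y = f b" using xy by blast
      then show ?thesis
        unfolding a(2) b(2) D(3)[OF \<Gamma>c[OF a(1)] \<Gamma>c[OF b(1)], symmetric]
        using g.subspace_add[OF \<Gamma>_subspace] by blast
    qed
    show "g_scale c x \<in> f ` \<Gamma> g" if x: "x \<in> f ` \<Gamma> g" for c x
    proof -
      obtain a where a: "a \<in> \<Gamma> g" "x = f a" using x by blast
      then show ?thesis
        unfolding a(2) D(4)[OF \<Gamma>c[OF a(1)], symmetric] using g.subspace_scale[OF \<Gamma>_subspace] by
            blast
    qed
  qed
  show "f ` \<Gamma> g \<subseteq> g_carrier" for g using D(6) \<Gamma>c by blast
  have f_sum: "f (\<Sum>g\<in>S. c g) = (\<Sum>g\<in>S. f (c g))" if "finite S" "\<And>g. g \<in> S \<Longrightarrow> c g \<in> g_carrier" for S c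
    using that
  proof (induction S)
    case (insert x F)
    then show ?case by (simp add: D(3) g.subspace_sum[OF g_subspace])
  qed (simp add: auts_zero[OF f])
  show "homogeneous_sum (\<lambda>g. f ` \<Gamma> g) z" if "z \<in> g_carrier" for z
  proof -
    have "z \<in> f ` g_carrier" using that unfolding bij_betw_imp_surj_on[OF D(2)] .
    then obtain y where "z = f y" "y \<in> g_carrier" by (rule imageE)
    note y = this(2,1)
    obtain c where c: "\<forall>g. c g \<in> \<Gamma> g" "finite {g. c g \<noteq> 0}" "y = (\<Sum>g | c g \<noteq> 0. c g)"
      using decompose[OF y(1)] unfolding homogeneous_sum_def by blast
    have cc: "c g \<in> g_carrier" for g using c(1) \<Gamma>c by blast
    have "f (c g) = 0 \<longleftrightarrow> c g = 0" for g by (rule auts_eq_0[OF f cc])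
    then have "{g. f (c g) \<noteq> 0} = {g. c g \<noteq> 0}" by simp
    moreover have "z = (\<Sum>g | c g \<noteq> 0. f (c g))" unfolding y(2) c(3) by (rule f_sum[OF c(2) cc])
    ultimately show ?thesis
      unfolding homogeneous_sum_def using c(1,2) by (intro exI[of _ "\<lambda>g. f (c g)"]) auto
  qed
  show "c g = 0" if "finite S" and c: "\<And>g. g \<in> S \<Longrightarrow> c g \<in> f ` \<Gamma> g" and "(\<Sum>g\<in>S. c g) = 0" "g \<in> S"
    for S c g
  proof -
    have "\<forall>g\<in>S. \<exists>x. x \<in> \<Gamma> g \<and> c g = f x" using c by blast
    then obtain d where d: "\<And>g. g \<in> S \<Longrightarrow> d g \<in> \<Gamma> g" "\<And>g. g \<in> S \<Longrightarrow> c g = f (d g)" by metis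
    have dc: "d g \<in> g_carrier" if "g \<in> S" for g by (rule \<Gamma>c[OF d(1)[OF that]])
    have "f (\<Sum>g\<in>S. d g) = (\<Sum>g\<in>S. f (d g))" by (rule f_sum[OF that(1)]) (rule dc)
    also have "\<dots> = (\<Sum>g\<in>S. c g)" by (rule sum.cong) (simp_all only: d(2))
    also have "\<dots> = 0" by (rule that(3))
    finally have "f (\<Sum>g\<in>S. d g) = 0" .
    moreover have "(\<Sum>g\<in>S. d g) \<in> g_carrier" by (rule g.subspace_sum[OF g_subspace]) (rule dc)
    ultimately have "(\<Sum>g\<in>S. d g) = 0" using auts_eq_0[OF f] by blast
    then have "d g = 0" using independent_\<Gamma>[OF that(1) d(1)] that(4) by blast
    then show ?thesis using d(2)[OF that(4)] auts_zero[OF f] by simp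
  qed
  show "g_bracket x y \<in> f ` \<Gamma> (g + h)" if xy: "x \<in> f ` \<Gamma> g" "y \<in> f ` \<Gamma> h" for x y g h
  proof -
    obtain a b where a: "a \<in> \<Gamma> g" "x = f a" and b: "b \<in> \<Gamma> h" "y = f b" using xy by blast
    show ?thesis
      unfolding a(2) b(2) D(5)[OF \<Gamma>c[OF a(1)] \<Gamma>c[OF b(1)], symmetric]
      by (rule imageI[OF mul_\<Gamma>[OF a(1) b(1)]])
  qed
qed

text \<open>As f permutes the components, its image grading has the same ones, and universality
  yields an additive \<phi> with f(\<Gamma>(\<phi> s)) = \<Gamma> s. This map goes opposite to the
  one induced by f, hence the passage from m to its inverse m'.\<close>

lemma Aut_grading_Waff:
  assumes "f \<in> Aut\<Gamma>"
  shows "\<exists>m\<in>carrier Weyl_model. \<forall>s\<in>supp. f ` \<Gamma> s = \<Gamma> (Waff m s)"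
proof -
  have f: "f \<in> auts" and comp: "(`) f ` (\<Gamma> ` supp) = \<Gamma> ` supp" using assms Aut_grading_iff by blast+
  define \<Delta> where "\<Delta> g = f ` \<Gamma> g" for g
  interpret \<Delta>: graded_space g_scale g_carrier g_bracket \<Delta>
    unfolding \<Delta>_def by (rule image_graded_space[OF f])
  have supp: "algebra_on.Supp G \<Delta> = supp"
  proof (rule Set.set_eqI)
    fix g
    have "(\<exists>x\<in>f ` \<Gamma> g. x \<noteq> 0) \<longleftrightarrow> (\<exists>x\<in>\<Gamma> g. x \<noteq> 0)"
      using auts_eq_0[OF f] \<Gamma>_V[of g] by blast
    then show "g \<in> algebra_on.Supp G \<Delta> \<longleftrightarrow> g \<in> supp" unfolding \<Delta>.Supp_iff Supp_iff \<Delta>_def .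
  qed
  have "algebra_on.components G \<Delta> = algebra_on.components G \<Gamma>"
  proof -
    have "algebra_on.components G \<Delta> = (`) f ` (\<Gamma> ` supp)"
      unfolding algebra_on.components_def supp \<Delta>_def image_image ..
    then show ?thesis unfolding comp by (simp only: algebra_on.components_def)
  qed
  then have "\<exists>!\<phi>. \<phi> \<in> hom G G \<and> \<phi> \<in> extensional (carrier G) \<and> (\<forall>s\<in>supp. \<Delta> (\<phi> s) = \<Gamma> s)"
    using universal[where 'h = G2] \<Delta>.is_grading unfolding algebra_on.universal_group_def by blast
  then obtain \<phi> where \<phi>: "\<phi> \<in> hom G G" "\<And>s. s \<in> supp \<Longrightarrow> f ` \<Gamma> (\<phi> s) = \<Gamma> s" unfolding \<Delta>_def by blast
  have add: "\<phi> (g + h) = \<phi> g + \<phi> h" for g h using hom_mult[OF \<phi>(1), of g h] by simp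
  have sup: "\<phi> s \<in> supp" if "s \<in> supp" for s using image_supp[OF f \<phi>(2)[OF that]] that by blast
  have "inj_on \<phi> supp"
    by (rule inj_onI) (use \<phi>(2) Supp_inj in metis)
  then obtain m where m: "m \<in> carrier Weyl_model" "\<phi> = Waff m"
    using additive_preserving_supp[OF add sup] by blast
  obtain m' where m': "m' \<in> carrier Weyl_model" "\<And>g. Waff m (Waff m' g) = g"
    using Waff_inverse[OF m(1)] by blast
  have "f ` \<Gamma> s = \<Gamma> (Waff m' s)" if "s \<in> supp" for s
    using \<phi>(2)[of "Waff m' s"] Waff_supp[OF m'(1)] that by (simp add: m(2) m'(2))
  then show ?thesis using m'(1) by blast
qed

lemma Waff_Aut_grading:
  assumes f: "f \<in> auts" and m: "m \<in> carrier Weyl_model" and s: "\<And>s. s \<in> supp \<Longrightarrow> f ` \<Gamma> s = \<Gamma> (Waff m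
      s)"
  shows "f \<in> Aut\<Gamma>"
proof -
  obtain m' where m': "m' \<in> carrier Weyl_model" "\<And>g. Waff m (Waff m' g) = g"
    using Waff_inverse[OF m] by blast
  have "(`) f ` (\<Gamma> ` supp) = \<Gamma> ` (Waff m ` supp)" by (simp add: image_image s cong: image_cong)
  moreover have "Waff m ` supp = supp"
  proof
    show "Waff m ` supp \<subseteq> supp" using Waff_supp[OF m] by blast
    show "supp \<subseteq> Waff m ` supp"
    proof
      fix t assume "t \<in> supp"
      then have "Waff m' t \<in> supp" using Waff_supp[OF m'(1)] by blast
      then show "t \<in> Waff m ` supp" using m'(2)[of t] by (metis imageI)
    qed
  qed
  ultimately show ?thesis using f by (simp add: Aut_grading_iff)
qed

section \<open>The label homomorphism and the Weyl group\<close>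

definition weyl_label :: "('a g_elem \<Rightarrow> 'a g_elem) \<Rightarrow> (2 \<times> (2 ^ 3)) \<times> (2 ^ 3 ^ 3) \<times> 2" where
  "weyl_label f = (THE m. m \<in> carrier Weyl_model \<and> (\<forall>s\<in>supp. f ` \<Gamma> s = \<Gamma> (Waff m s)))"

lemma weyl_label_eqI:
  assumes "m \<in> carrier Weyl_model" "\<And>s. s \<in> supp \<Longrightarrow> f ` \<Gamma> s = \<Gamma> (Waff m s)"
  shows "weyl_label f = m"
  unfolding weyl_label_def
proof (rule the_equality)
  show "m' = m" if m': "m' \<in> carrier Weyl_model \<and> (\<forall>s\<in>supp. f ` \<Gamma> s = \<Gamma> (Waff m' s))" for m'
    by (rule Waff_unique) (use m' assms in auto)
qed (use assms in blast)

lemma weyl_label: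
  assumes "f \<in> Aut\<Gamma>"
  shows "weyl_label f \<in> carrier Weyl_model" "s \<in> supp \<Longrightarrow> f ` \<Gamma> s = \<Gamma> (Waff (weyl_label f) s)"
proof -
  obtain m where "m \<in> carrier Weyl_model" "\<forall>s\<in>supp. f ` \<Gamma> s = \<Gamma> (Waff m s)"
    using Aut_grading_Waff[OF assms] by blast
  moreover from this have "weyl_label f = m" by (intro weyl_label_eqI) auto
  ultimately show "weyl_label f \<in> carrier Weyl_model" "s \<in> supp \<Longrightarrow> f ` \<Gamma> s = \<Gamma> (Waff (weyl_label f)
      s)"
    by auto
qed

lemma weyl_label_surj:
  assumes m: "m \<in> carrier Weyl_model" shows "\<exists>f\<in>Aut\<Gamma>. weyl_label f = m"
proof -
  obtain f where f: "f \<in> auts" "\<And>g. f ` \<Gamma> g = \<Gamma> (Waff m g)" using Waff_realised[OF m] by blast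
  have "f \<in> Aut\<Gamma>" by (rule Waff_Aut_grading[OF f(1) m f(2)])
  moreover have "weyl_label f = m" by (rule weyl_label_eqI[OF m f(2)])
  ultimately show ?thesis by blast
qed

lemma weyl_label_image: "weyl_label ` Aut\<Gamma> = carrier Weyl_model"
proof
  show "weyl_label ` Aut\<Gamma> \<subseteq> carrier Weyl_model" using weyl_label(1) by blast
  show "carrier Weyl_model \<subseteq> weyl_label ` Aut\<Gamma>"
  proof
    fix m assume "m \<in> carrier Weyl_model"
    then obtain f where "f \<in> Aut\<Gamma>" "weyl_label f = m" using weyl_label_surj by blast
    then show "m \<in> weyl_label ` Aut\<Gamma>" by blast
  qed
qed

text \<open>The support generates \<open>G2\<close> and nonzero components determine their degrees,
  so the definite description has the \<open>Waff\<close> of the label as its only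
  candidate.\<close>

lemma induced_auto_eq:
  assumes "f \<in> Aut\<Gamma>"
  shows "algebra_on.induced_auto G \<Gamma> f = Waff (weyl_label f)"
  unfolding algebra_on.induced_auto_def
proof (rule the_equality)
  note label = weyl_label[OF assms]
  show "Waff (weyl_label f) \<in> auto G \<and> (\<forall>s\<in>supp. f ` \<Gamma> s = \<Gamma> (Waff (weyl_label f) s))"
    using Waff_auto[OF label(1)] label(2) by blast
  fix \<alpha> assume \<alpha>: "\<alpha> \<in> auto G \<and> (\<forall>s\<in>supp. f ` \<Gamma> s = \<Gamma> (\<alpha> s))"
  then have hom: "\<alpha> \<in> hom G G" by (simp add: auto_def)
  show "\<alpha> = Waff (weyl_label f)"
  proof
    fix g show "\<alpha> g = Waff (weyl_label f) g"
    proof (induction g rule: supp_induct)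
      case (1 s)
      have "Waff (weyl_label f) s \<in> supp" using Waff_supp[OF label(1)] 1 by blast
      moreover have "\<Gamma> (Waff (weyl_label f) s) = \<Gamma> (\<alpha> s)" using \<alpha> label(2) 1 by metis
      ultimately show ?case by (rule Supp_inj[symmetric])
    next
      case (2 g h)
      then show ?case using hom_mult[OF hom, of g h] by (simp add: Waff_add)
    qed
  qed
qed

lemma Weyl_subgroup_eq: "algebra_on.Weyl_subgroup g_carrier g_scale g_bracket G \<Gamma> = Waff ` carrier
    Weyl_model"
proof -
  have "algebra_on.induced_auto G \<Gamma> ` Aut\<Gamma> = (\<lambda>f. Waff (weyl_label f)) ` Aut\<Gamma>"
    by (rule image_cong) (simp_all only: induced_auto_eq)
  then show ?thesis
    unfolding algebra_on.Weyl_subgroup_def weyl_label_image[symmetric] image_image .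
qed

lemma compose_image: "compose g_carrier f h ` \<Gamma> s = f ` (h ` \<Gamma> s)"
  unfolding image_image by (rule image_cong) (simp_all only: compose_eq subsetD[OF \<Gamma>_V])

lemma auts_compose:
  assumes f: "f \<in> auts" and h: "h \<in> auts" shows "compose g_carrier f h \<in> auts"
proof -
  note F = autsD[OF f] and H = autsD[OF h]
  show ?thesis
    unfolding algebra_on.automorphisms_def mem_Collect_eq
    using compose_Bij[OF F(1) H(1)]
    by (simp add: compose_def g_carrier_closed g_bracket_closed F H)
qed

lemma auts_inverse:
  assumes f: "f \<in> auts" shows "restrict (inv_into g_carrier f) g_carrier \<in> auts"
proof -
  note F = autsD[OF f]
  define h where "h = inv_into g_carrier f"
  have h: "h x \<in> g_carrier" "f (h x) = x" if "x \<in> g_carrier" for x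
    using that F(2) by (simp_all add: h_def bij_betw_def f_inv_into_f inv_into_into)
  have eq: "h x = y" if "y \<in> g_carrier" "f y = x" for x y
    using that F(2) by (auto simp: h_def bij_betw_def)
  have "h (x + y) = h x + h y" "h (g_scale c x) = g_scale c (h x)" "h (g_bracket x y) = g_bracket
      (h x) (h y)"
    if "x \<in> g_carrier" "y \<in> g_carrier" for x y c
    using that by (auto intro!: eq simp: F h g_carrier_closed g_bracket_closed)
  then show ?thesis
    unfolding algebra_on.automorphisms_def mem_Collect_eq
    using restrict_inv_into_Bij[OF F(1)]
    by (auto simp: h_def[symmetric] g_carrier_closed g_bracket_closed)
qed

lemma group_Aut_grading: "subgroup Aut\<Gamma> (BijGroup g_carrier)"
proof -
  interpret B: group "BijGroup (g_carrier :: 'a g_elem set)" by (rule group_BijGroup)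
  have sub: "f \<in> Bij g_carrier" if "f \<in> Aut\<Gamma>" for f using that autsD(1) Aut_grading_iff by blast
  obtain f0 where f0: "f0 \<in> Aut\<Gamma>"
    using weyl_label_surj[OF group.is_monoid[OF group_Weyl_model, THEN monoid.one_closed]] by blast
  show ?thesis
  proof (rule B.subgroupI)
    show "Aut\<Gamma> \<subseteq> carrier (BijGroup g_carrier)" using sub by (auto simp: BijGroup_def)
    show "Aut\<Gamma> \<noteq> {}" using f0 by blast
    show "inv\<^bsub>BijGroup g_carrier\<^esub> f \<in> Aut\<Gamma>" if f: "f \<in> Aut\<Gamma>" for f
    proof -
      define h where "h = restrict (inv_into g_carrier f) g_carrier"
      have fa: "f \<in> auts" using f Aut_grading_iff by blast
      have h: "h \<in> auts" unfolding h_def by (rule auts_inverse[OF fa])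
      note label = weyl_label[OF f]
      obtain m' where m': "m' \<in> carrier Weyl_model" "\<And>g. Waff (weyl_label f) (Waff m' g) = g"
        using Waff_inverse[OF label(1)] by blast
      have "h ` \<Gamma> s = \<Gamma> (Waff m' s)" if "s \<in> supp" for s
      proof -
        have "\<Gamma> s = f ` \<Gamma> (Waff m' s)"
          using label(2)[of "Waff m' s"] Waff_supp[OF m'(1)] that m'(2) by simp
        moreover have "h (f x) = x" if "x \<in> g_carrier" for x
          using that autsD(2,6)[OF fa] by (simp add: h_def bij_betw_def)
        then have "(\<lambda>x. h (f x)) ` \<Gamma> (Waff m' s) = (\<lambda>x. x) ` \<Gamma> (Waff m' s)"
          using \<Gamma>_V[of "Waff m' s"] by (intro image_cong) blast+
        ultimately show ?thesis by (simp only: image_image image_ident)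
      qed
      then have "h \<in> Aut\<Gamma>" by (rule Waff_Aut_grading[OF h m'(1)])
      then show ?thesis using inv_BijGroup[OF sub[OF f]] by (simp add: h_def)
    qed
    show "f \<otimes>\<^bsub>BijGroup g_carrier\<^esub> h \<in> Aut\<Gamma>" if f: "f \<in> Aut\<Gamma>" and h: "h \<in> Aut\<Gamma>" for f h
    proof -
      have fh: "f \<in> auts" "h \<in> auts" using f h Aut_grading_iff by blast+
      have "f \<otimes>\<^bsub>BijGroup g_carrier\<^esub> h = compose g_carrier f h" using sub f h by (simp add:
          BijGroup_def)
      moreover have "(`) (compose g_carrier f h) ` (\<Gamma> ` supp) = \<Gamma> ` supp"
      proof -
        have "compose g_carrier f h ` \<Gamma> s = f ` (h ` \<Gamma> s)" for s
          by (rule compose_image)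
        then have "(`) (compose g_carrier f h) ` (\<Gamma> ` supp) = (`) f ` ((`) h ` (\<Gamma> ` supp))"
          by (simp add: image_image)
        then show ?thesis using f h by (simp add: Aut_grading_iff)
      qed
      ultimately show ?thesis using auts_compose[OF fh] by (simp add: Aut_grading_iff)
    qed
  qed
qed

text \<open>The first isomorphism theorem for \<open>weyl_label\<close>: it is onto, and its kernel
  consists of the automorphisms whose label acts trivially, that is, of those fixing every
  component.\<close>

lemma Weyl_group_iso: "algebra_on.Weyl_group g_carrier g_scale g_bracket G \<Gamma> \<cong> Weyl_model"
proof -
  define K where "K = (BijGroup g_carrier)\<lparr>carrier := Aut\<Gamma>\<rparr>"
  have K: "group K" unfolding K_def
    by (rule subgroup.subgroup_is_group[OF group_Aut_grading group_BijGroup])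
  have KC: "carrier K = Aut\<Gamma>" by (simp add: K_def)
  have "weyl_label (f \<otimes>\<^bsub>K\<^esub> h) = weyl_label f \<otimes>\<^bsub>Weyl_model\<^esub> weyl_label h"
    if f: "f \<in> Aut\<Gamma>" and h: "h \<in> Aut\<Gamma>" for f h
  proof (rule weyl_label_eqI)
    interpret W: group Weyl_model by (rule group_Weyl_model)
    show "weyl_label f \<otimes>\<^bsub>Weyl_model\<^esub> weyl_label h \<in> carrier Weyl_model"
      using weyl_label(1) f h by simp
    fix s assume s: "s \<in> supp"
    have "f \<otimes>\<^bsub>K\<^esub> h = compose g_carrier f h"
      using autsD(1) f h by (simp add: K_def BijGroup_def Aut_grading_iff)
    then have "(f \<otimes>\<^bsub>K\<^esub> h) ` \<Gamma> s = f ` (h ` \<Gamma> s)" by (simp only: compose_image)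
    also have "\<dots> = \<Gamma> (Waff (weyl_label f) (Waff (weyl_label h) s))"
      using weyl_label[OF f] weyl_label[OF h] Waff_supp s by simp
    finally show "(f \<otimes>\<^bsub>K\<^esub> h) ` \<Gamma> s = \<Gamma> (Waff (weyl_label f \<otimes>\<^bsub>Weyl_model\<^esub> weyl_label h) s)"
      by (simp add: Waff_mult)
  qed
  then have "weyl_label \<in> hom K Weyl_model"
    by (intro homI) (simp_all add: KC weyl_label(1))
  then interpret group_hom K Weyl_model weyl_label
    using K group_Weyl_model by (simp add: group_hom_def group_hom_axioms_def)
  have "weyl_label ` carrier K = carrier Weyl_model"
    unfolding KC by (rule weyl_label_image)
  then have "K Mod kernel K Weyl_model weyl_label \<cong> Weyl_model" by (rule FactGroup_iso)
  moreover have "kernel K Weyl_model weyl_label = algebra_on.Stab_grading g_carrier g_scale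
      g_bracket G \<Gamma>"
  proof (intro Set.set_eqI iffI)
    fix f assume "f \<in> kernel K Weyl_model weyl_label"
    then have f: "f \<in> Aut\<Gamma>" "weyl_label f = \<one>\<^bsub>Weyl_model\<^esub>" by (simp_all add: kernel_def KC)
    then show "f \<in> algebra_on.Stab_grading g_carrier g_scale g_bracket G \<Gamma>"
      using weyl_label(2)[OF f(1)]
      by (auto simp: algebra_on.Stab_grading_def algebra_on.components_def Aut_grading_iff Waff_one)
  next
    fix f assume "f \<in> algebra_on.Stab_grading g_carrier g_scale g_bracket G \<Gamma>"
    then have f: "f \<in> auts" "\<And>s. s \<in> supp \<Longrightarrow> f ` \<Gamma> s = \<Gamma> (Waff \<one>\<^bsub>Weyl_model\<^esub> s)"
      by (auto simp: algebra_on.Stab_grading_def algebra_on.components_def Waff_one)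
    have one: "\<one>\<^bsub>Weyl_model\<^esub> \<in> carrier Weyl_model"
      by (rule group.is_monoid[OF group_Weyl_model, THEN monoid.one_closed])
    have "f \<in> Aut\<Gamma>" by (rule Waff_Aut_grading[OF f(1) one f(2)])
    moreover have "weyl_label f = \<one>\<^bsub>Weyl_model\<^esub>" by (rule weyl_label_eqI[OF one f(2)])
    ultimately show "f \<in> kernel K Weyl_model weyl_label" by (simp add: kernel_def KC)
  qed
  ultimately show ?thesis by (simp add: algebra_on.Weyl_group_def K_def)
qed

end

theorem proposition5p2:
  fixes w :: "3 \<Rightarrow> 'a::{alg_closed_field, field_char_0} oct" and im :: 'a
  defines "\<Gamma>\<^sub>2 \<equiv> Gamma2 w im" and "G\<^sub>2 \<equiv> (additive_group :: G2 monoid)"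
  assumes "\<forall>i. polar oct_norm (w i) oct_one = 0"
    and "\<forall>i j. i \<noteq> j \<longrightarrow> polar oct_norm (w i) (w j) = 0"
    and "\<forall>i. oct_mult (w i) (w i) = oct_one"
    and "polar oct_norm (w 3) (oct_mult (w 1) (w 2)) = 0"
    and "im ^ 2 = -1"
  shows "algebra_on.universal_group g_carrier g_scale g_bracket TYPE('h) G\<^sub>2 \<Gamma>\<^sub>2 \<and>
    matrix_of ` algebra_on.Weyl_subgroup g_carrier g_scale g_bracket G\<^sub>2 \<Gamma>\<^sub>2 =
      {((1, 0, b),
        (0, A, D),
        (0, 0, c)) | b c A D. b \<in> {0, 1} \<and> c \<in> {1, -1} \<and> invertible A} \<and>
    algebra_on.Weyl_group g_carrier g_scale g_bracket G\<^sub>2 \<Gamma>\<^sub>2 \<cong> Weyl_model"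
proof -
  interpret gamma2 w im
    using assms(3-) by unfold_locales
  have "matrix_of ` Waff ` carrier Weyl_model =
    {((1, 0, b), (0, A, D), (0, 0, c)) | b c A D. b \<in> {0, 1} \<and> c \<in> {1, -1} \<and> invertible A}"
    (is "?L = ?R")
  proof (intro equalityI subsetI)
    fix M assume "M \<in> ?L"
    then obtain b D A c where "invertible A" "M = matrix_of (Waff ((b, D), A, c))"
      by (auto simp: carrier_Weyl_model)
    moreover have "b \<in> {0, 1}" using cases_2[of b] by simp
    ultimately show "M \<in> ?R"
      unfolding matrix_of_Waff by auto
  next
    fix M assume "M \<in> ?R"
    then obtain b c A D where M: "M = ((1, 0, b), (0, A, D), (0, 0, c))"
      and c: "c \<in> {1, -1}" and A: "invertible A" by blast
    \<comment> \<open>The integer sign is recoded in Z_2, as 0 for 1 and as 1 for -1.\<close>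
    have "M = matrix_of (Waff ((b, D), A, if c = 1 then 0 else 1))"
      using c unfolding matrix_of_Waff M by auto
    moreover have "((b, D), A, if c = 1 then 0 else 1) \<in> carrier Weyl_model"
      using A by (simp add: carrier_Weyl_model)
    ultimately show "M \<in> ?L" by blast
  qed
  then show ?thesis
    unfolding assms(1,2) using universal Weyl_group_iso by (simp only: Weyl_subgroup_eq simp_thms)
qed

end
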